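(* Let $k\geq 1$ and let $\mathcal{S}_{\ell\geqslant k}=\bigcup_{\ell\geqslant k}\mathcal{S}_\ell$ be the set of over-determined submodules of $\mathcal{A}^k$, with its Zariski topology. The behavior of a generic submodule in $\mathcal{S}_{\ell\geqslant k}$ is uncontrollable: the set of $\mathcal{P}\in\mathcal{S}_{\ell\geqslant k}$ with $\mathfrak{i}_k\neq 0$ is a nonempty Zariski open set, and for every such $\mathcal{P}$ the behavior $\mathcal{B}_\mathcal{F}(\mathcal{P})$ ($\mathcal{F}=\mathcal{D}'$ or $\mathcal{C}^\infty$) is uncontrollable. In particular, the behavior of a generic square submodule is uncontrollable: the set of $\mathcal{P}\in\mathcal{S}_k$ with $\mathfrak{i}_k\neq 0$ is a nonempty Zariski open subset of $\mathcal{S}_k$ consisting of submodules with uncontrollable behavior.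
   Context: $\mathcal{A}=\mathbb{C}[\partial_1,\ldots,\partial_n]$, $n\geq 1$, is the (commutative polynomial) ring of constant coefficient partial differential operators on $\mathbb{R}^n$; $\mathcal{F}$ is the $\mathcal{A}$-module of complex-valued distributions $\mathcal{D}'$ or smooth functions $\mathcal{C}^\infty$ on $\mathbb{R}^n$. For a submodule $\mathcal{P}\subseteq\mathcal{A}^k$, $\mathcal{B}_\mathcal{F}(\mathcal{P})=\{f\in\mathcal{F}^k : \sum_j a_j(\partial)f_j=0 \text{ for all } (a_1,\ldots,a_k)\in\mathcal{P}\}$. A behavior is controllable if, given any two subsets $U_1,U_2$ of $\mathbb{R}^n$ whose closures do not intersect and any $f_1,f_2$ in the behavior, there is an $f$ in the behavior such that $f=f_1$ on some neighborhood of $U_1$ and $f=f_2$ on some neighborhood of $U_2$. A sub-behavior of $\mathcal{B}_\mathcal{F}(\mathcal{P})$ is a behavior $\mathcal{B}_\mathcal{F}(\mathcal{Q})$, $\mathcal{Q}\subseteq\mathcal{A}^k$ a submodule, contained in $\mathcal{B}_\mathcal{F}(\mathcal{P})$. A behavior is uncontrollable if it does not contain any nonzero controllable sub-behavior. $\mathfrak{i}_k$ denotes the ideal of $\mathcal{A}$ generated by the $k\times k$ minors of any matrix $P(\partial)$ whose rows generate $\mathcal{P}$; it depends only on $\mathcal{P}$ (it is the $0$-th Fitting ideal of $\mathcal{A}^k/\mathcal{P}$). $\mathcal{M}_{\ell,k}$ is the set of $\ell\times k$ matrices with entries in $\mathcal{A}$, and $\mathcal{M}_{\ell,k}(d)$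 the subset of matrices all of whose entries have degree at most $d$. By taking coefficients, $\mathcal{M}_{\ell,k}(d)$ is identified with $\mathbb{C}^{N(d)}$, $N(d)=\ell k\binom{n+d}{n}$, with its Zariski topology. $\mathcal{M}_{\ell,k}$ carries the direct limit topology (also called Zariski): a subset is open if and only if its intersection with each $\mathcal{M}_{\ell,k}(d)$ is Zariski open in $\mathcal{M}_{\ell,k}(d)$. $\mathcal{R}_{\ell,k}\subset\mathcal{M}_{\ell,k}$ is the subset (with the subspace topology) of matrices such that the submodule of $\mathcal{A}^k$ generated by the $\ell$ rows cannot be generated by fewer than $\ell$ elements. $\mathcal{S}_\ell$ is the set of submodules of $\mathcal{A}^k$ which can be generated by $\ell$ elements but not fewer. The Zariski topology on $\mathcal{S}_\ell$ is the quotient topology for the surjection $\Pi:\mathcal{R}_{\ell,k}\to\mathcal{S}_\ell$ sending a matrix to the submodule generated by its rows; $\mathcal{S}_{\ell\geqslant k}$ has the disjoint union topology. *)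

theory Defs
  imports
    "HOL-Analysis.Analysis"
    "HOL-Library.Poly_Mapping"
    "HOL-Library.Function_Algebras"
    "HOL-Algebra.Ideal"
    "Jordan_Normal_Form.VS_Connect"
    "Jordan_Normal_Form.DL_Submatrix"
begin

unbundle no vec_syntax
hide_const (open) Finite_Cartesian_Product.vec Finite_Cartesian_Product.row
  Finite_Cartesian_Product.rows Determinants.det

section \<open>Differential operators with constant coefficients\<close>

text \<open>
  The number of variables is \<open>CARD('n)\<close>. A monomial is a multi-index \<open>'n \<Rightarrow>\<^sub>0 nat\<close>, and the
  convolution product of \<^theory>\<open>HOL-Library.Poly_Mapping\<close> is the product of polynomials.
\<close>

type_synonym 'n diffop = "('n \<Rightarrow>\<^sub>0 nat) \<Rightarrow>\<^sub>0 complex"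

definition mdeg :: "('n::finite \<Rightarrow>\<^sub>0 nat) \<Rightarrow> nat" where
  "mdeg m = (\<Sum>i\<in>UNIV. Poly_Mapping.lookup m i)"

definition partial_deriv :: "'n::finite \<Rightarrow> (real^'n \<Rightarrow> complex) \<Rightarrow> real^'n \<Rightarrow> complex" where
  "partial_deriv i f = (\<lambda>x. frechet_derivative f (at x) (axis i 1))"

text \<open>\<open>C\<^sup>\<infinity>\<close>: every iterated partial derivative is (totally) differentiable everywhere; in
  particular all partial derivatives of all orders exist and are continuous.\<close>

definition smooth :: "(real^'n::finite \<Rightarrow> complex) \<Rightarrow> bool" where
  "smooth f \<longleftrightarrow> (\<forall>is x. foldr partial_deriv is f differentiable (at x))"

text \<open>Only used for smooth functions, where the order of differentiation is irrelevant.\<close>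

definition multi_deriv :: "('n::finite \<Rightarrow>\<^sub>0 nat) \<Rightarrow> (real^'n \<Rightarrow> complex) \<Rightarrow> real^'n \<Rightarrow> complex" where
  "multi_deriv m f = foldr partial_deriv (SOME is. \<forall>i. count_list is i = Poly_Mapping.lookup m i) f"

definition smooth_apply :: "'n::finite diffop \<Rightarrow> (real^'n \<Rightarrow> complex) \<Rightarrow> real^'n \<Rightarrow> complex" where
  "smooth_apply p f =
     (\<lambda>x. \<Sum>m\<in>Poly_Mapping.keys p. Poly_Mapping.lookup p m * multi_deriv m f x)"

section \<open>Distributions\<close>

definition supp :: "(real^'n::finite \<Rightarrow> complex) \<Rightarrow> (real^'n) set" where
  "supp f = closure {x. f x \<noteq> 0}"

definition test_fun :: "(real^'n::finite \<Rightarrow> complex) \<Rightarrow> bool" where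
  "test_fun \<phi> \<longleftrightarrow> smooth \<phi> \<and> compact (supp \<phi>)"

text \<open>A distribution is a continuous linear functional on the space of test functions; as a HOL
  function it is extended by \<open>0\<close> to all other functions, so that equality of functionals is
  equality of HOL functions. Continuity is expressed by the usual seminorm estimates.\<close>

definition distribution :: "((real^'n::finite \<Rightarrow> complex) \<Rightarrow> complex) \<Rightarrow> bool" where
  "distribution T \<longleftrightarrow>
     (\<forall>\<phi>. \<not> test_fun \<phi> \<longrightarrow> T \<phi> = 0) \<and>
     (\<forall>\<phi> \<psi>. test_fun \<phi> \<longrightarrow> test_fun \<psi> \<longrightarrow> T (\<lambda>x. \<phi> x + \<psi> x) = T \<phi> + T \<psi>) \<and>
     (\<forall>c \<phi>. test_fun \<phi> \<longrightarrow> T (\<lambda>x. c * \<phi> x) = c * T \<phi>) \<and>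
     (\<forall>K. compact K \<longrightarrow>
        (\<exists>C N. \<forall>\<phi>. test_fun \<phi> \<longrightarrow> supp \<phi> \<subseteq> K \<longrightarrow>
           cmod (T \<phi>) \<le> C * (\<Sum>m | mdeg m \<le> N. SUP x. cmod (multi_deriv m \<phi> x))))"

text \<open>The transposed action: \<open>(\<partial>\<^sup>m T) \<phi> = (-1)\<^sup>|\<^sup>m\<^sup>| T (\<partial>\<^sup>m \<phi>)\<close>.\<close>

definition distr_apply :: "'n::finite diffop \<Rightarrow> ((real^'n \<Rightarrow> complex) \<Rightarrow> complex)
    \<Rightarrow> (real^'n \<Rightarrow> complex) \<Rightarrow> complex" where
  "distr_apply p T = (\<lambda>\<phi>. if test_fun \<phi>
     then \<Sum>m\<in>Poly_Mapping.keys p.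
            Poly_Mapping.lookup p m * ((-1) ^ mdeg m * T (multi_deriv m \<phi>))
     else 0)"

section \<open>Behaviors\<close>

text \<open>What is needed of the module \<open>\<F>\<close>: its elements, the action of the operators, and equality
  of two elements on an open set. Addition and zero are the pointwise ones of
  \<^theory>\<open>HOL-Library.Function_Algebras\<close>.\<close>

record ('n::finite, 'f) signal_space =
  signals :: "'f set"
  act :: "'n diffop \<Rightarrow> 'f \<Rightarrow> 'f"
  eq_on :: "(real^'n) set \<Rightarrow> 'f \<Rightarrow> 'f \<Rightarrow> bool"

definition smooth_space :: "('n::finite, real^'n \<Rightarrow> complex) signal_space" where
  "smooth_space = \<lparr>signals = {f. smooth f}, act = smooth_apply,
     eq_on = (\<lambda>V f g. \<forall>x\<in>V. f x = g x)\<rparr>"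

definition distr_space :: "('n::finite, (real^'n \<Rightarrow> complex) \<Rightarrow> complex) signal_space" where
  "distr_space = \<lparr>signals = {T. distribution T}, act = distr_apply,
     eq_on = (\<lambda>V S T. \<forall>\<phi>. test_fun \<phi> \<longrightarrow> supp \<phi> \<subseteq> V \<longrightarrow> S \<phi> = T \<phi>)\<rparr>"

abbreviation free_module :: "nat \<Rightarrow> ('n::finite diffop, 'n diffop Matrix.vec) module" where
  "free_module k \<equiv> module_vec TYPE('n diffop) k"

abbreviation is_submodule :: "nat \<Rightarrow> 'n::finite diffop Matrix.vec set \<Rightarrow> bool" where
  "is_submodule k P \<equiv> LinearCombinations.submodule class_ring P (free_module k)"

abbreviation span_of :: "nat \<Rightarrow> 'n::finite diffop Matrix.vec set \<Rightarrow> 'n diffop Matrix.vec set" where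
  "span_of k \<equiv> LinearCombinations.module.span class_ring (free_module k)"

definition behavior :: "('n::finite, 'f::comm_monoid_add) signal_space \<Rightarrow> nat
    \<Rightarrow> 'n diffop Matrix.vec set \<Rightarrow> 'f Matrix.vec set" where
  "behavior F k P = {f \<in> carrier_vec k. (\<forall>j<k. f $ j \<in> signals F) \<and>
     (\<forall>a\<in>P. (\<Sum>j<k. act F (a $ j) (f $ j)) = 0)}"

definition controllable :: "('n::finite, 'f) signal_space \<Rightarrow> nat \<Rightarrow> 'f Matrix.vec set \<Rightarrow> bool" where
  "controllable F k B \<longleftrightarrow>
     (\<forall>U\<^sub>1 U\<^sub>2. closure U\<^sub>1 \<inter> closure U\<^sub>2 = {} \<longrightarrow>
       (\<forall>f\<^sub>1\<in>B. \<forall>f\<^sub>2\<in>B. \<exists>f\<in>B.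
          (\<exists>V. open V \<and> U\<^sub>1 \<subseteq> V \<and> (\<forall>j<k. eq_on F V (f $ j) (f\<^sub>1 $ j))) \<and>
          (\<exists>V. open V \<and> U\<^sub>2 \<subseteq> V \<and> (\<forall>j<k. eq_on F V (f $ j) (f\<^sub>2 $ j)))))"

definition uncontrollable :: "('n::finite, 'f::comm_monoid_add) signal_space \<Rightarrow> nat
    \<Rightarrow> 'f Matrix.vec set \<Rightarrow> bool" where
  "uncontrollable F k B \<longleftrightarrow>
     \<not> (\<exists>Q. is_submodule k Q \<and> behavior F k Q \<subseteq> B \<and> behavior F k Q \<noteq> {0\<^sub>v k} \<and>
           controllable F k (behavior F k Q))"

section \<open>The ideal of maximal minors\<close>

definition row_module :: "nat \<Rightarrow> 'n::finite diffop mat \<Rightarrow> 'n diffop Matrix.vec set" where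
  "row_module k M = span_of k (set (rows M))"

definition minors_ideal :: "nat \<Rightarrow> 'n::finite diffop mat \<Rightarrow> 'n diffop set" where
  "minors_ideal k M = genideal class_ring
     {Determinant.det (submatrix M I UNIV) | I. I \<subseteq> {..<dim_row M} \<and> card I = k}"

text \<open>The rows of the chosen matrix generate \<open>P\<close>; as a Fitting ideal of the quotient module, the
  result depends on \<open>P\<close> only. Used only for finitely generated \<open>P\<close>, so such a matrix exists.\<close>

definition fitting_ideal :: "nat \<Rightarrow> 'n::finite diffop Matrix.vec set \<Rightarrow> 'n diffop set" where
  "fitting_ideal k P = minors_ideal k (SOME M. dim_col M = k \<and> row_module k M = P)"

section \<open>Zariski topologies\<close>

definition mpoly_eval :: "(('i \<Rightarrow>\<^sub>0 nat) \<Rightarrow>\<^sub>0 complex) \<Rightarrow> ('i \<Rightarrow> complex) \<Rightarrow> complex" where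
  "mpoly_eval p x = (\<Sum>m\<in>Poly_Mapping.keys p.
     Poly_Mapping.lookup p m * (\<Prod>i\<in>Poly_Mapping.keys m. x i ^ Poly_Mapping.lookup m i))"

definition mpoly_vars :: "(('i \<Rightarrow>\<^sub>0 nat) \<Rightarrow>\<^sub>0 complex) \<Rightarrow> 'i set" where
  "mpoly_vars p = (\<Union>m\<in>Poly_Mapping.keys p. Poly_Mapping.keys m)"

lemma mpoly_eval_superset:
  assumes "finite S" "Poly_Mapping.keys p \<subseteq> S"
  shows "mpoly_eval p x = (\<Sum>m\<in>S.
    Poly_Mapping.lookup p m * (\<Prod>i\<in>Poly_Mapping.keys m. x i ^ Poly_Mapping.lookup m i))"
  unfolding mpoly_eval_def using assms
  by (intro sum.mono_neutral_left) (auto simp: in_keys_iff)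

lemma mpoly_eval_add: "mpoly_eval (p + q) x = mpoly_eval p x + mpoly_eval q x"
proof -
  let ?S = "Poly_Mapping.keys p \<union> Poly_Mapping.keys q"
  have "Poly_Mapping.keys (p + q) \<subseteq> ?S" by (rule Poly_Mapping.keys_add)
  then show ?thesis
    by (subst (1 2 3) mpoly_eval_superset[of ?S])
      (auto simp: lookup_add algebra_simps sum.distrib)
qed

lemma mpoly_eval_0 [simp]: "mpoly_eval 0 x = 0"
  by (simp add: mpoly_eval_def)

lemma mpoly_eval_single:
  "mpoly_eval (Poly_Mapping.single m c) x =
     c * (\<Prod>i\<in>Poly_Mapping.keys m. x i ^ Poly_Mapping.lookup m i)"
  by (subst mpoly_eval_superset[of "{m}"]) auto

lemma mpoly_eval_mult: "mpoly_eval (p * q) x = mpoly_eval p x * mpoly_eval q x"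
proof -
  have monom: "(\<Prod>i\<in>Poly_Mapping.keys (a + b). x i ^ Poly_Mapping.lookup (a + b) i) =
      (\<Prod>i\<in>Poly_Mapping.keys a. x i ^ Poly_Mapping.lookup a i) *
      (\<Prod>i\<in>Poly_Mapping.keys b. x i ^ Poly_Mapping.lookup b i)" for a b
  proof -
    let ?S = "Poly_Mapping.keys a \<union> Poly_Mapping.keys b"
    have *: "(\<Prod>i\<in>Poly_Mapping.keys c. x i ^ Poly_Mapping.lookup c i) =
        (\<Prod>i\<in>?S. x i ^ Poly_Mapping.lookup c i)"
      if "Poly_Mapping.keys c \<subseteq> ?S" for c
      using that by (intro prod.mono_neutral_left) (auto simp: in_keys_iff)
    have ab: "Poly_Mapping.keys (a + b) \<subseteq> ?S" by (rule Poly_Mapping.keys_add)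
    show ?thesis
      unfolding *[OF ab] *[OF Un_upper1] *[OF Un_upper2]
      by (simp only: lookup_add power_add prod.distrib)
  qed
  have single: "mpoly_eval (Poly_Mapping.single a c * q) x =
      mpoly_eval (Poly_Mapping.single a c) x * mpoly_eval q x" for a c
  proof (induction q rule: update_induct)
    case const then show ?case by simp
  next
    case (update f b d)
    have "Poly_Mapping.update b d f = f + Poly_Mapping.single b d"
      using update.hyps(1)
      by (intro poly_mapping_eqI) (auto simp: lookup_update lookup_add lookup_single in_keys_iff when_def)
    then show ?case
      using update.IH by (simp add: distrib_left mpoly_eval_add mult_single mpoly_eval_single monom)
  qed
  show ?thesis
  proof (induction p rule: update_induct)
    case const then show ?case by simp
  next
    case (update f b d)
    have "Poly_Mapping.update b d f = f + Poly_Mapping.single b d"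
      using update.hyps(1)
      by (intro poly_mapping_eqI) (auto simp: lookup_update lookup_add lookup_single in_keys_iff when_def)
    then show ?case
      using update.IH by (simp add: distrib_right mpoly_eval_add single)
  qed
qed

lemma mpoly_vars_mult: "mpoly_vars (p * q) \<subseteq> mpoly_vars p \<union> mpoly_vars q"
proof
  fix i assume "i \<in> mpoly_vars (p * q)"
  then obtain m where m: "m \<in> Poly_Mapping.keys (p * q)" "i \<in> Poly_Mapping.keys m" by (auto simp: mpoly_vars_def)
  then obtain a b where "m = a + b" "a \<in> Poly_Mapping.keys p" "b \<in> Poly_Mapping.keys q"
    using keys_mult[of p q] by blast
  with m(2) show "i \<in> mpoly_vars p \<union> mpoly_vars q"
    using Poly_Mapping.keys_add[of a b] by (auto simp: mpoly_vars_def)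
qed

text \<open>Affine space with coordinates indexed by a finite set \<open>I\<close>: the open sets are the
  complements of the common zero sets of families of polynomials in these coordinates.\<close>

definition zariski_topology :: "'i set \<Rightarrow> ('i \<Rightarrow> complex) topology" where
  "zariski_topology I = topology (\<lambda>U. \<exists>F. (\<forall>p\<in>F. mpoly_vars p \<subseteq> I) \<and>
     U = (I \<rightarrow>\<^sub>E UNIV) - {x. \<forall>p\<in>F. mpoly_eval p x = 0})"

lemma openin_zariski_topology:
  "openin (zariski_topology I) U \<longleftrightarrow> (\<exists>F. (\<forall>p\<in>F. mpoly_vars p \<subseteq> I) \<and>
     U = (I \<rightarrow>\<^sub>E UNIV) - {x. \<forall>p\<in>F. mpoly_eval p x = 0})"
proof -
  let ?E = "I \<rightarrow>\<^sub>E (UNIV :: complex set)"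
  let ?op = "\<lambda>U. \<exists>F. (\<forall>p\<in>F. mpoly_vars p \<subseteq> I) \<and> U = ?E - {x. \<forall>p\<in>F. mpoly_eval p x = 0}"
  have "istopology ?op"
    unfolding istopology_def
  proof (intro conjI allI impI)
    fix S T assume "?op S" "?op T"
    then obtain F G where
      F: "\<forall>p\<in>F. mpoly_vars p \<subseteq> I" "S = ?E - {x. \<forall>p\<in>F. mpoly_eval p x = 0}" and
      G: "\<forall>p\<in>G. mpoly_vars p \<subseteq> I" "T = ?E - {x. \<forall>p\<in>G. mpoly_eval p x = 0}" by blast
    let ?H = "{p * q | p q. p \<in> F \<and> q \<in> G}"
    have "\<forall>p\<in>?H. mpoly_vars p \<subseteq> I"
      using F(1) G(1) mpoly_vars_mult by fastforce
    moreover have "S \<inter> T = ?E - {x. \<forall>p\<in>?H. mpoly_eval p x = 0}"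
    proof (rule Set.set_eqI, rule iffI)
      fix x assume x: "x \<in> S \<inter> T"
      then obtain p q where "p \<in> F" "mpoly_eval p x \<noteq> 0" "q \<in> G" "mpoly_eval q x \<noteq> 0"
        unfolding F(2) G(2) by blast
      then have "p * q \<in> ?H" "mpoly_eval (p * q) x \<noteq> 0"
        by (auto simp only: mem_Collect_eq mpoly_eval_mult mult_eq_0_iff)
      with x show "x \<in> ?E - {x. \<forall>p\<in>?H. mpoly_eval p x = 0}"
        unfolding F(2) by blast
    next
      fix x assume x: "x \<in> ?E - {x. \<forall>p\<in>?H. mpoly_eval p x = 0}"
      then obtain p q where "p \<in> F" "q \<in> G" "mpoly_eval (p * q) x \<noteq> 0" by blast
      with x show "x \<in> S \<inter> T"
        unfolding F(2) G(2) by (auto simp only: mpoly_eval_mult mult_eq_0_iff)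
    qed
    ultimately show "?op (S \<inter> T)" by blast
  next
    fix \<K> assume "\<forall>K\<in>\<K>. ?op K"
    from bchoice[OF this] obtain F where F: "\<forall>K\<in>\<K>. (\<forall>p\<in>F K. mpoly_vars p \<subseteq> I) \<and>
        K = ?E - {x. \<forall>p\<in>F K. mpoly_eval p x = 0}" by blast
    have "(\<Union>K\<in>\<K>. K) = (\<Union>K\<in>\<K>. ?E - {x. \<forall>p\<in>F K. mpoly_eval p x = 0})"
      by (rule SUP_cong[OF refl]) (rule conjunct2[OF bspec[OF F]])
    also have "\<dots> = ?E - {x. \<forall>p\<in>\<Union>(F ` \<K>). mpoly_eval p x = 0}" by blast
    finally have "\<Union>\<K> = ?E - {x. \<forall>p\<in>\<Union>(F ` \<K>). mpoly_eval p x = 0}" by simp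
    moreover have "\<forall>p\<in>\<Union>(F ` \<K>). mpoly_vars p \<subseteq> I"
      using conjunct1[OF bspec[OF F]] by blast
    ultimately show "?op (\<Union>\<K>)" by blast
  qed
  then show ?thesis by (simp add: zariski_topology_def)
qed

text \<open>The final topology on \<open>\<Union>i\<in>I. topspace (X i)\<close> for the inclusions of the pieces: the direct
  limit topology for an increasing sequence of pieces, the disjoint union topology for pairwise
  disjoint pieces.\<close>

definition union_topology :: "'i set \<Rightarrow> ('i \<Rightarrow> 'a topology) \<Rightarrow> 'a topology" where
  "union_topology I X = topology (\<lambda>U. U \<subseteq> (\<Union>i\<in>I. topspace (X i)) \<and>
     (\<forall>i\<in>I. openin (X i) (U \<inter> topspace (X i))))"

lemma openin_union_topology:
  "openin (union_topology I X) U \<longleftrightarrow> U \<subseteq> (\<Union>i\<in>I. topspace (X i)) \<and>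
     (\<forall>i\<in>I. openin (X i) (U \<inter> topspace (X i)))"
proof -
  let ?op = "\<lambda>U. U \<subseteq> (\<Union>i\<in>I. topspace (X i)) \<and> (\<forall>i\<in>I. openin (X i) (U \<inter> topspace (X i)))"
  have "istopology ?op"
    unfolding istopology_def
  proof (intro conjI allI impI ballI; (elim conjE)?)
    fix S T i
    assume "\<forall>i\<in>I. openin (X i) (S \<inter> topspace (X i))" "\<forall>i\<in>I. openin (X i) (T \<inter> topspace (X i))"
      and "i \<in> I"
    then have "openin (X i) ((S \<inter> topspace (X i)) \<inter> (T \<inter> topspace (X i)))"
      using openin_Int by blast
    also have "(S \<inter> topspace (X i)) \<inter> (T \<inter> topspace (X i)) = S \<inter> T \<inter> topspace (X i)" by blast
    finally show "openin (X i) (S \<inter> T \<inter> topspace (X i))" .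
  next
    fix \<K> i assume "\<forall>K\<in>\<K>. ?op K" "i \<in> I"
    then have "openin (X i) (\<Union>K\<in>\<K>. K \<inter> topspace (X i))"
      by (intro openin_Union) auto
    also have "(\<Union>K\<in>\<K>. K \<inter> topspace (X i)) = \<Union>\<K> \<inter> topspace (X i)" by blast
    finally show "openin (X i) (\<Union>\<K> \<inter> topspace (X i))" .
  qed blast+
  then show ?thesis by (simp add: union_topology_def)
qed

lemma topspace_union_topology:
  "topspace (union_topology I X) = (\<Union>i\<in>I. topspace (X i))"
proof
  show "topspace (union_topology I X) \<subseteq> (\<Union>i\<in>I. topspace (X i))"
    using openin_topspace[of "union_topology I X"] unfolding openin_union_topology by (rule conjunct1)
  have "openin (union_topology I X) (\<Union>i\<in>I. topspace (X i))"
    unfolding openin_union_topology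
  proof (intro conjI ballI)
    fix i assume "i \<in> I"
    then have "(\<Union>i\<in>I. topspace (X i)) \<inter> topspace (X i) = topspace (X i)" by blast
    then show "openin (X i) ((\<Union>i\<in>I. topspace (X i)) \<inter> topspace (X i))" by simp
  qed simp
  then show "(\<Union>i\<in>I. topspace (X i)) \<subseteq> topspace (union_topology I X)"
    by (rule openin_subset)
qed

definition quotient_topology :: "'a topology \<Rightarrow> ('a \<Rightarrow> 'b) \<Rightarrow> 'b topology" where
  "quotient_topology X f = topology (\<lambda>U. U \<subseteq> f ` topspace X \<and> openin X {x \<in> topspace X. f x \<in> U})"

lemma openin_quotient_topology:
  "openin (quotient_topology X f) U \<longleftrightarrow> U \<subseteq> f ` topspace X \<and> openin X {x \<in> topspace X. f x \<in> U}"
proof -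
  let ?op = "\<lambda>U. U \<subseteq> f ` topspace X \<and> openin X {x \<in> topspace X. f x \<in> U}"
  have "istopology ?op"
    unfolding istopology_def
  proof (intro conjI allI impI; (elim conjE)?)
    fix S T assume "openin X {x \<in> topspace X. f x \<in> S}" "openin X {x \<in> topspace X. f x \<in> T}"
    then have "openin X ({x \<in> topspace X. f x \<in> S} \<inter> {x \<in> topspace X. f x \<in> T})"
      by (rule openin_Int)
    also have "{x \<in> topspace X. f x \<in> S} \<inter> {x \<in> topspace X. f x \<in> T} =
        {x \<in> topspace X. f x \<in> S \<inter> T}" by blast
    finally show "openin X {x \<in> topspace X. f x \<in> S \<inter> T}" .
  next
    fix \<K> assume "\<forall>K\<in>\<K>. ?op K"
    then have "openin X (\<Union>K\<in>\<K>. {x \<in> topspace X. f x \<in> K})"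
      by (intro openin_Union) auto
    also have "(\<Union>K\<in>\<K>. {x \<in> topspace X. f x \<in> K}) = {x \<in> topspace X. f x \<in> \<Union>\<K>}" by blast
    finally show "openin X {x \<in> topspace X. f x \<in> \<Union>\<K>}" .
  qed blast+
  then show ?thesis by (simp add: quotient_topology_def)
qed

section \<open>Matrices and submodules\<close>

definition mats_deg :: "nat \<Rightarrow> nat \<Rightarrow> nat \<Rightarrow> 'n::finite diffop mat set" where
  "mats_deg l k d = {M \<in> carrier_mat l k.
     \<forall>i<l. \<forall>j<k. \<forall>m\<in>Poly_Mapping.keys (M $$ (i, j)). mdeg m \<le> d}"

definition coeff_indices :: "nat \<Rightarrow> nat \<Rightarrow> nat \<Rightarrow> (nat \<times> nat \<times> ('n::finite \<Rightarrow>\<^sub>0 nat)) set" where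
  "coeff_indices l k d = {(i, j, m). i < l \<and> j < k \<and> mdeg m \<le> d}"

definition mat_coeffs :: "nat \<Rightarrow> nat \<Rightarrow> nat \<Rightarrow> 'n::finite diffop mat
    \<Rightarrow> nat \<times> nat \<times> ('n \<Rightarrow>\<^sub>0 nat) \<Rightarrow> complex" where
  "mat_coeffs l k d M =
     restrict (\<lambda>(i, j, m). Poly_Mapping.lookup (M $$ (i, j)) m) (coeff_indices l k d)"

text \<open>\<^term>\<open>mat_coeffs l k d\<close> is a bijection from \<^term>\<open>mats_deg l k d\<close> onto affine space with the
  finitely many coordinates \<^term>\<open>coeff_indices l k d\<close>, along which the topology is transported.\<close>

definition mats_deg_topology :: "nat \<Rightarrow> nat \<Rightarrow> nat \<Rightarrow> 'n::finite diffop mat topology" where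
  "mats_deg_topology l k d =
     pullback_topology (mats_deg l k d) (mat_coeffs l k d) (zariski_topology (coeff_indices l k d))"

lemma topspace_mats_deg_topology:
  "topspace (mats_deg_topology l k d :: 'n::finite diffop mat topology) = mats_deg l k d"
proof -
  let ?E = "coeff_indices l k d \<rightarrow>\<^sub>E UNIV :: (nat \<times> nat \<times> ('n \<Rightarrow>\<^sub>0 nat) \<Rightarrow> complex) set"
  have op: "openin (zariski_topology (coeff_indices l k d)) ?E"
    unfolding openin_zariski_topology
    by (intro exI[of _ "{1}"]) (auto simp: mpoly_vars_def mpoly_eval_single simp flip: single_one)
  have "mats_deg l k d = mat_coeffs l k d -` ?E \<inter> mats_deg l k d"
    by (auto simp: mat_coeffs_def)
  with op have "openin (mats_deg_topology l k d) (mats_deg l k d :: 'n diffop mat set)"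
    unfolding mats_deg_topology_def openin_pullback_topology by blast
  then show ?thesis
    by (intro subset_antisym openin_subset)
      (auto simp: mats_deg_topology_def topspace_pullback_topology)
qed

definition mats_topology :: "nat \<Rightarrow> nat \<Rightarrow> 'n::finite diffop mat topology" where
  "mats_topology l k = union_topology UNIV (mats_deg_topology l k)"

lemma topspace_mats_topology: "topspace (mats_topology l k) = carrier_mat l k"
proof -
  have "M \<in> (\<Union>d. mats_deg l k d)" if M: "M \<in> carrier_mat l k" for M :: "'a diffop mat"
  proof -
    let ?D = "mdeg ` (\<Union>i<l. \<Union>j<k. Poly_Mapping.keys (M $$ (i, j)))"
    have "finite ?D" by auto
    then have "mdeg m \<le> Max ?D" if "i < l" "j < k" "m \<in> Poly_Mapping.keys (M $$ (i, j))" for i j m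
      using that by (intro Max_ge) auto
    then have "M \<in> mats_deg l k (Max ?D)" using M by (auto simp: mats_deg_def)
    then show ?thesis by blast
  qed
  then show ?thesis
    by (auto simp: mats_topology_def topspace_union_topology topspace_mats_deg_topology)
      (auto simp: mats_deg_def)
qed

text \<open>\<open>P\<close> can be generated by \<open>r\<close> elements (not necessarily distinct, hence \<open>\<le>\<close>).\<close>

definition generated_by :: "nat \<Rightarrow> nat \<Rightarrow> 'n::finite diffop Matrix.vec set \<Rightarrow> bool" where
  "generated_by k r P \<longleftrightarrow> (\<exists>G. G \<subseteq> carrier_vec k \<and> finite G \<and> card G \<le> r \<and> span_of k G = P)"

definition min_mats :: "nat \<Rightarrow> nat \<Rightarrow> 'n::finite diffop mat set" where
  "min_mats l k = {M \<in> carrier_mat l k. \<not> (\<exists>r<l. generated_by k r (row_module k M))}"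

definition submodules :: "nat \<Rightarrow> nat \<Rightarrow> 'n::finite diffop Matrix.vec set set" where
  "submodules l k = {P. is_submodule k P \<and> generated_by k l P \<and> \<not> (\<exists>r<l. generated_by k r P)}"

lemma row_module_min_mats: "row_module k ` min_mats l k = submodules l k"
proof (rule Set.set_eqI, rule iffI)
  fix P :: "'a diffop Matrix.vec set"
  interpret vec_module "TYPE('a diffop)" k .
  assume "P \<in> row_module k ` min_mats l k"
  then obtain M where M: "M \<in> carrier_mat l k" "P = row_module k M"
    and min: "\<not> (\<exists>r<l. generated_by k r P)" by (auto simp: min_mats_def)
  have G: "set (rows M) \<subseteq> carrier_vec k" using M(1) by (auto simp: rows_def)
  have "card (set (rows M)) \<le> l" using card_length[of "rows M"] M(1) by auto
  then have "generated_by k l P"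
    unfolding generated_by_def M(2) row_module_def using G by blast
  moreover have "is_submodule k P"
    unfolding M(2) row_module_def using span_is_submodule[OF G] .
  ultimately show "P \<in> submodules l k" using min by (simp add: submodules_def)
next
  fix P :: "'a diffop Matrix.vec set"
  assume P: "P \<in> submodules l k"
  then obtain G where G: "G \<subseteq> carrier_vec k" "finite G" "card G \<le> l" "span_of k G = P"
    by (auto simp: submodules_def generated_by_def)
  have "generated_by k (card G) P" unfolding generated_by_def using G by blast
  then have "\<not> card G < l" using P by (auto simp: submodules_def)
  with G(3) have "card G = l" by simp
  then obtain vs where vs: "set vs = G" "length vs = l"
    using finite_distinct_list[OF G(2)] distinct_card by metis
  let ?M = "mat_of_rows k vs"
  have "rows ?M = vs" using vs(1) G(1) by (intro rows_mat_of_rows) auto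
  then have "row_module k ?M = P" by (simp add: row_module_def vs G(4))
  moreover have "?M \<in> carrier_mat l k" by (simp add: vs(2) mat_of_rows_def)
  ultimately have "?M \<in> min_mats l k" using P by (simp add: min_mats_def submodules_def)
  then show "P \<in> row_module k ` min_mats l k"
    using \<open>row_module k ?M = P\<close> by blast
qed

lemma submodules_disjoint: "l \<noteq> l' \<Longrightarrow> submodules l k \<inter> submodules l' k = {}"
proof (cases l l' rule: linorder_cases)
  case less then show ?thesis by (auto simp: submodules_def)
next
  case greater then show ?thesis by (auto simp: submodules_def)
qed simp

definition submodules_topology :: "nat \<Rightarrow> nat \<Rightarrow> 'n::finite diffop Matrix.vec set topology" where
  "submodules_topology l k =
     quotient_topology (subtopology (mats_topology l k) (min_mats l k)) (row_module k)"

lemma topspace_submodules_topology: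
  "topspace (submodules_topology l k :: 'n::finite diffop Matrix.vec set topology) = submodules l k"
proof -
  have top: "topspace (quotient_topology X f) = f ` topspace X" for X :: "'x topology" and f :: "'x \<Rightarrow> 'y"
  proof (rule subset_antisym)
    show "topspace (quotient_topology X f) \<subseteq> f ` topspace X"
      using openin_topspace[of "quotient_topology X f"] unfolding openin_quotient_topology
      by (rule conjunct1)
    have "{x \<in> topspace X. f x \<in> f ` topspace X} = topspace X" by blast
    then show "f ` topspace X \<subseteq> topspace (quotient_topology X f)"
      by (intro openin_subset) (simp add: openin_quotient_topology)
  qed
  have "carrier_mat l k \<inter> min_mats l k = (min_mats l k :: 'n diffop mat set)" by (auto simp: min_mats_def)
  then show ?thesis
    by (simp add: submodules_topology_def top topspace_mats_topology row_module_min_mats)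
qed

definition overdet_submodules :: "nat \<Rightarrow> 'n::finite diffop Matrix.vec set set" where
  "overdet_submodules k = (\<Union>l\<in>{k..}. submodules l k)"

definition overdet_topology :: "nat \<Rightarrow> 'n::finite diffop Matrix.vec set topology" where
  "overdet_topology k = union_topology {k..} (\<lambda>l. submodules_topology l k)"

end

theory Submission
  imports Defs
begin

text \<open>
  If \<open>\<ii>\<^sub>k \<noteq> 0\<close>, the adjugate of a square matrix of elements of \<open>P\<close> with determinant \<open>a \<noteq> 0\<close> shows that
  \<open>a\<close> times each unit vector lies in \<open>P\<close>, so \<open>a\<close> annihilates every component of every element
  of the behavior. A nonzero controllable sub-behavior would contain an element that agrees with a
  given nonzero element on a cube and vanishes outside a larger one, i.e. a nonzero compactly
  supported \<open>f\<close> with \<open>a f = 0\<close>. No such \<open>f\<close> exists: pairing with polynomials, \<open>f\<close> kills the image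
  of the transpose of \<open>a\<close>, which consists of all polynomials, and polynomials are dense in
  \<open>C\<^sup>N\<close> on cubes. Openness holds because, for fixed degree, the coefficients of the minors are
  polynomials in the coefficients of the matrix, and because \<open>\<ii>\<^sub>k \<noteq> 0\<close> depends only on the row
  module, the determinant being multilinear in the rows.
\<close>

section \<open>Smooth functions\<close>

text \<open>The absence of compactly supported solutions is often read off from Fourier-Laplace
  transforms; here it rests on pairings with polynomials, the Stone-Weierstrass theorem and mean
  value estimates in one variable. The obstacle for distributions is that they are continuous only
  with respect to seminorms of some order \<open>N\<close>, so uniform approximation is not enough
  and all derivatives up to order \<open>N\<close> must be approximated as well. Polynomials are not
  test functions either: they are multiplied by a cutoff that is 1 on the cube carrying the
  distribution, so that the operator does not notice it. For smooth \<open>f\<close> the pairing is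
  an integral over a cube, and integration by parts replaces the transposed action. On the algebraic
  side, \<open>fitting_ideal\<close> refers to an unspecified matrix, while openness in a quotient
  topology calls for a criterion in terms of the submodule alone: the existence of \<open>k\<close>
  elements with nonzero determinant (\<open>nondegenerate\<close>).\<close>

abbreviation iter_deriv :: "'n::finite list \<Rightarrow> (real^'n \<Rightarrow> complex) \<Rightarrow> real^'n \<Rightarrow> complex" where
  "iter_deriv js f \<equiv> foldr partial_deriv js f"

lemma partial_deriv_eq:
  "(f has_derivative f') (at x) \<Longrightarrow> partial_deriv i f x = f' (axis i 1)"
  unfolding partial_deriv_def by (metis frechet_derivative_at)

text \<open>Turns the differentiability required by \<open>smooth\<close> into a derivative to which
  the calculus rules apply; \<open>partial_deriv\<close> is its value on a unit vector.\<close>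

lemma has_derivative_frechet:
  "f differentiable (at x) \<Longrightarrow> (f has_derivative frechet_derivative f (at x)) (at x)"
  by (simp add: frechet_derivative_works)

text \<open>Restricting to a line parallel to an axis makes the mean value inequality for functions
  of one real variable available.\<close>

lemma has_derivative_partial_line:
  assumes "f differentiable (at (x + s *\<^sub>R axis i 1))"
  shows "((\<lambda>t. f (x + t *\<^sub>R axis i 1)) has_derivative
    (\<lambda>h. h *\<^sub>R partial_deriv i f (x + s *\<^sub>R axis i 1))) (at s)"
proof -
  let ?F = "frechet_derivative f (at (x + s *\<^sub>R axis i 1))"
  have "((\<lambda>t. x + t *\<^sub>R axis i 1) has_derivative (\<lambda>h. h *\<^sub>R axis i 1)) (at s)"
    by (auto intro!: derivative_eq_intros)
  from has_derivative_compose[OF this has_derivative_frechet[OF assms]]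
  have "((\<lambda>t. f (x + t *\<^sub>R axis i 1)) has_derivative (\<lambda>h. ?F (h *\<^sub>R axis i 1))) (at s)" .
  moreover have "?F (h *\<^sub>R axis i 1) = h *\<^sub>R partial_deriv i f (x + s *\<^sub>R axis i 1)" for h
    using linear_frechet_derivative[OF assms] by (simp add: partial_deriv_def linear_scale)
  ultimately show ?thesis by simp
qed

text \<open>\<open>smooth\<close> quantifies over all lists of derivatives, which does not lend
  itself to induction: differentiating a product yields two new products. Counting the order and
  recursing on the innermost derivative makes closure under sums, products and inverses an induction
  on \<open>k\<close>.\<close>

fun diff_upto :: "nat \<Rightarrow> (real^'n::finite \<Rightarrow> complex) \<Rightarrow> bool" where
  "diff_upto 0 f \<longleftrightarrow> (\<forall>x. f differentiable (at x))"
| "diff_upto (Suc k) f \<longleftrightarrow> (\<forall>x. f differentiable (at x)) \<and> (\<forall>i. diff_upto k (partial_deriv i f))"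

lemma diff_upto_iff:
  "diff_upto k f \<longleftrightarrow> (\<forall>js. length js \<le> k \<longrightarrow> (\<forall>x. iter_deriv js f differentiable (at x)))"
proof (induction k arbitrary: f)
  case 0 then show ?case by simp
next
  case (Suc k)
  show ?case
  proof
    assume L: "diff_upto (Suc k) f"
    show "\<forall>js. length js \<le> Suc k \<longrightarrow> (\<forall>x. iter_deriv js f differentiable (at x))"
    proof (intro allI impI)
      fix js :: "'a list" and x assume "length js \<le> Suc k"
      \<comment> \<open>\<open>foldr\<close> applies the last entry of the list first, hence the
        case split from the right.\<close>
      then show "iter_deriv js f differentiable (at x)"
        using L Suc.IH by (cases js rule: rev_cases) auto
    qed
  next
    assume R: "\<forall>js. length js \<le> Suc k \<longrightarrow> (\<forall>x. iter_deriv js f differentiable (at x))"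
    have "diff_upto k (partial_deriv i f)" for i
      unfolding Suc.IH
    proof (intro allI impI)
      fix js :: "'a list" and x assume "length js \<le> k"
      then show "iter_deriv js (partial_deriv i f) differentiable (at x)"
        using R[rule_format, of "js @ [i]" x] by simp
    qed
    then show "diff_upto (Suc k) f" using R[rule_format, of "[]"] by simp
  qed
qed

lemma smooth_iff_diff_upto: "smooth f \<longleftrightarrow> (\<forall>k. diff_upto k f)"
  unfolding smooth_def diff_upto_iff by auto

lemma diff_upto_differentiable: "diff_upto k f \<Longrightarrow> f differentiable (at x)"
  by (cases k) auto

lemma diff_upto_Suc: "diff_upto (Suc k) f \<Longrightarrow> diff_upto k f"
  by (auto simp: diff_upto_iff)

lemma smooth_differentiable: "smooth f \<Longrightarrow> f differentiable (at x)"
  unfolding smooth_iff_diff_upto using diff_upto_differentiable by blast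

lemma smooth_partial_deriv: "smooth f \<Longrightarrow> smooth (partial_deriv i f)"
  unfolding smooth_iff_diff_upto by (metis diff_upto.simps(2))

lemma smooth_iter_deriv: "smooth f \<Longrightarrow> smooth (iter_deriv js f)"
  by (induction js) (auto intro: smooth_partial_deriv)

lemma smooth_continuous_on: "smooth f \<Longrightarrow> continuous_on S f"
  by (meson continuous_at_imp_continuous_on differentiable_imp_continuous_within smooth_differentiable)

lemma smoothI:
  assumes "\<And>x. f differentiable (at x)" "\<And>i. smooth (partial_deriv i f)"
  shows "smooth f"
  unfolding smooth_iff_diff_upto
proof
  fix k show "diff_upto k f" using assms by (cases k) (auto simp: smooth_iff_diff_upto)
qed

lemma partial_deriv_const [simp]: "partial_deriv i (\<lambda>x. c) = (\<lambda>x. 0)"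
  by (rule ext) (simp add: partial_deriv_eq[OF has_derivative_const])

lemma smooth_const [simp]: "smooth (\<lambda>x :: real^'n::finite. c)"
proof -
  have "diff_upto k (\<lambda>x :: real^'n. c)" for k and c :: complex by (induction k arbitrary: c) auto
  then show ?thesis by (simp add: smooth_iff_diff_upto)
qed

lemma partial_deriv_add:
  assumes "\<And>x. f differentiable (at x)" "\<And>x. g differentiable (at x)"
  shows "partial_deriv i (\<lambda>x. f x + g x) = (\<lambda>x. partial_deriv i f x + partial_deriv i g x)"
  by (rule ext, subst partial_deriv_eq[OF has_derivative_add[OF has_derivative_frechet has_derivative_frechet]])
    (auto simp: assms partial_deriv_def)

lemma diff_upto_add: "diff_upto k f \<Longrightarrow> diff_upto k g \<Longrightarrow> diff_upto k (\<lambda>x. f x + g x)"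
proof (induction k arbitrary: f g)
  case 0 then show ?case by (auto intro: differentiable_add)
next
  case (Suc k)
  then show ?case by (auto intro: differentiable_add simp: partial_deriv_add)
qed

lemma smooth_add: "smooth f \<Longrightarrow> smooth g \<Longrightarrow> smooth (\<lambda>x. f x + g x)"
  by (simp add: smooth_iff_diff_upto diff_upto_add)

lemma partial_deriv_mult:
  fixes f g :: "real^'n::finite \<Rightarrow> complex"
  assumes "\<And>x. f differentiable (at x)" "\<And>x. g differentiable (at x)"
  shows "partial_deriv i (\<lambda>x. f x * g x) = (\<lambda>x. partial_deriv i f x * g x + f x * partial_deriv i g x)"
  by (rule ext, subst partial_deriv_eq[OF has_derivative_mult[OF has_derivative_frechet has_derivative_frechet]])
    (auto simp: assms partial_deriv_def)

lemma diff_upto_mult: "diff_upto k f \<Longrightarrow> diff_upto k g \<Longrightarrow> diff_upto k (\<lambda>x. f x * g x)"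
proof (induction k arbitrary: f g)
  case 0 then show ?case by (auto intro: differentiable_mult)
next
  case (Suc k)
  have "diff_upto k (\<lambda>x. partial_deriv i f x * g x + f x * partial_deriv i g x)" for i
    by (intro diff_upto_add Suc.IH diff_upto_Suc[OF Suc.prems(1)] diff_upto_Suc[OF Suc.prems(2)])
      (use Suc.prems in auto)
  then show ?case using Suc.prems by (auto intro: differentiable_mult simp: partial_deriv_mult)
qed

lemma smooth_mult: "smooth f \<Longrightarrow> smooth g \<Longrightarrow> smooth (\<lambda>x. f x * g x)"
  by (simp add: smooth_iff_diff_upto diff_upto_mult)

lemma smooth_cmult: "smooth f \<Longrightarrow> smooth (\<lambda>x. c * f x)"
  by (intro smooth_mult smooth_const)

lemma smooth_uminus: "smooth f \<Longrightarrow> smooth (\<lambda>x. - f x)"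
  using smooth_cmult[of f "-1"] by simp

lemma smooth_diff: "smooth f \<Longrightarrow> smooth g \<Longrightarrow> smooth (\<lambda>x. f x - g x)"
  using smooth_add[OF _ smooth_uminus, of f g] by simp

lemma smooth_prod: "(\<And>i. i \<in> I \<Longrightarrow> smooth (f i)) \<Longrightarrow> smooth (\<lambda>x. \<Prod>i\<in>I. f i x)"
  by (induction I rule: infinite_finite_induct) (auto intro: smooth_mult)

lemma smooth_power: "smooth f \<Longrightarrow> smooth (\<lambda>x. f x ^ n)"
  by (induction n) (auto intro: smooth_mult)

text \<open>Written as a product instead of a quotient by a square, so that
  \<open>diff_upto_mult\<close> and the induction hypothesis for the inverse apply to the right-hand
  side.\<close>

lemma partial_deriv_inverse:
  fixes f :: "real^'n::finite \<Rightarrow> complex"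
  assumes "\<And>x. f differentiable (at x)" "\<And>x. f x \<noteq> 0"
  shows "partial_deriv i (\<lambda>x. inverse (f x)) =
    (\<lambda>x. (- 1) * (partial_deriv i f x * (inverse (f x) * inverse (f x))))"
  by (rule ext, subst partial_deriv_eq[OF Deriv.has_derivative_inverse[OF _ has_derivative_frechet]])
    (auto simp: assms partial_deriv_def)

lemma diff_upto_inverse:
  assumes "\<And>x. f x \<noteq> 0"
  shows "diff_upto k f \<Longrightarrow> diff_upto k (\<lambda>x. inverse (f x))"
proof (induction k)
  case 0 then show ?case using assms by (auto intro: differentiable_inverse)
next
  case (Suc k)
  have d: "f differentiable (at x)" for x using Suc.prems by simp
  have "diff_upto k (\<lambda>x. - 1)" using smooth_const smooth_iff_diff_upto by blast
  then have "diff_upto k (\<lambda>x. (- 1) * (partial_deriv i f x * (inverse (f x) * inverse (f x))))" for i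
    by (intro diff_upto_mult Suc.IH diff_upto_Suc[OF Suc.prems]) (use Suc.prems in auto)
  then show ?case
    using assms d by (auto intro: differentiable_inverse simp: partial_deriv_inverse)
qed

lemma smooth_inverse: "smooth f \<Longrightarrow> (\<And>x. f x \<noteq> 0) \<Longrightarrow> smooth (\<lambda>x. inverse (f x))"
  by (simp add: smooth_iff_diff_upto diff_upto_inverse)

lemma partial_deriv_cmult:
  "smooth f \<Longrightarrow> partial_deriv i (\<lambda>x. c * f x) = (\<lambda>x. c * partial_deriv i f x)"
  by (subst partial_deriv_mult) (auto simp: smooth_differentiable)

lemma partial_deriv_coord:
  "partial_deriv i (\<lambda>x. of_real (vec_nth x j)) = (\<lambda>x. if i = j then 1 else 0)"
proof (rule ext)
  fix x :: "real^'a"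
  have "((\<lambda>x::real^'a. complex_of_real (vec_nth x j)) has_derivative (\<lambda>h. of_real (vec_nth h j))) (at x)"
    by (intro bounded_linear_imp_has_derivative bounded_linear_of_real[THEN bounded_linear_compose] bounded_linear_vec_nth)
  from partial_deriv_eq[OF this, of i]
  show "partial_deriv i (\<lambda>x::real^'a. complex_of_real (vec_nth x j)) x = (if i = j then 1 else 0)"
    by (simp add: axis_def)
qed

lemma smooth_coord: "smooth (\<lambda>x. of_real (vec_nth x j))"
proof (rule smoothI)
  fix x :: "real^'a"
  have "((\<lambda>x::real^'a. complex_of_real (vec_nth x j)) has_derivative (\<lambda>h. of_real (vec_nth h j))) (at x)"
    by (intro bounded_linear_imp_has_derivative bounded_linear_of_real[THEN bounded_linear_compose] bounded_linear_vec_nth)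
  then show "(\<lambda>x::real^'a. complex_of_real (vec_nth x j)) differentiable (at x)"
    by (auto simp: differentiable_def)
qed (simp add: partial_deriv_coord)

lemma iter_deriv_add:
  "smooth f \<Longrightarrow> smooth g \<Longrightarrow>
    iter_deriv js (\<lambda>x. f x + g x) = (\<lambda>x. iter_deriv js f x + iter_deriv js g x)"
  by (induction js) (auto simp: partial_deriv_add smooth_differentiable smooth_iter_deriv)

lemma iter_deriv_cmult:
  "smooth f \<Longrightarrow> iter_deriv js (\<lambda>x. c * f x) = (\<lambda>x. c * iter_deriv js f x)"
  by (induction js) (auto simp: partial_deriv_cmult smooth_iter_deriv)

lemma iter_deriv_diff:
  assumes "smooth f" "smooth g"
  shows "iter_deriv js (\<lambda>x. f x - g x) = (\<lambda>x. iter_deriv js f x - iter_deriv js g x)"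
proof -
  have "iter_deriv js (\<lambda>x. f x + (- 1) * g x) = (\<lambda>x. iter_deriv js f x + (- 1) * iter_deriv js g x)"
    using assms by (simp only: iter_deriv_add iter_deriv_cmult smooth_cmult)
  then show ?thesis by simp
qed

section \<open>Symmetry of mixed partial derivatives\<close>

text \<open>Young's argument: the mean value inequality along axis \<open>i\<close> is applied to
  the increment of \<open>f\<close> in direction \<open>j\<close>, and
  \<open>G = partial_deriv i f\<close> is expanded to first order at \<open>x\<close>.\<close>

lemma second_difference_bound:
  fixes f :: "real^'n::finite \<Rightarrow> complex"
  assumes f: "\<And>x. f differentiable (at x)" and g: "partial_deriv i f differentiable (at x)"
    and "\<epsilon> > 0"
  shows "\<exists>\<delta>>0. \<forall>t. 0 < t \<and> t < \<delta> \<longrightarrow>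
    cmod (f (x + t *\<^sub>R axis i 1 + t *\<^sub>R axis j 1) - f (x + t *\<^sub>R axis i 1) - f (x + t *\<^sub>R axis j 1) + f x
      - of_real (t\<^sup>2) * partial_deriv j (partial_deriv i f) x) \<le> \<epsilon> * t\<^sup>2"
proof -
  define e d where "e = (axis i 1 :: real^'n)" and "d = (axis j 1 :: real^'n)"
  define G where "G = partial_deriv i f"
  define G' where "G' = frechet_derivative G (at x)"
  have hd: "(G has_derivative G') (at x)"
    using g by (simp add: G_def G'_def frechet_derivative_works)
  define B where "B = partial_deriv j G x"
  have B: "B = G' d" using partial_deriv_eq[OF hd] by (simp add: B_def d_def)
  have lin: "linear G'" using has_derivative_linear[OF hd] .
  have n1: "norm e = 1" "norm d = 1" by (simp_all add: e_def d_def)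
  \<comment> \<open>The two points at which \<open>G\<close> is expanded below lie within
    \<open>2 * t\<close> and \<open>t\<close> of \<open>x\<close>. The errors, two thirds and one
    third of \<open>\<epsilon> * t\<close>, add up to \<open>\<epsilon> * t\<close>, and
    \<open>t < \<delta> / 2\<close> keeps both points in range.\<close>
  obtain \<delta> where \<delta>: "\<delta> > 0"
    "\<And>y. norm (y - x) < \<delta> \<Longrightarrow> norm (G y - G x - G' (y - x)) \<le> \<epsilon> / 3 * norm (y - x)"
  proof -
    have "\<epsilon> / 3 > 0" using \<open>\<epsilon> > 0\<close> by simp
    then show ?thesis using hd that unfolding has_derivative_at_alt by blast
  qed
  have "cmod (f (x + t *\<^sub>R e + t *\<^sub>R d) - f (x + t *\<^sub>R e) - f (x + t *\<^sub>R d) + f x - of_real (t\<^sup>2) * B) \<le> \<epsilon> * t\<^sup>2"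
    if t: "0 < t" "t < \<delta> / 2" for t
  proof -
    \<comment> \<open>The subtracted linear term is the expected contribution of \<open>B\<close>,
      so that \<open>\<gamma>'\<close> measures only the error in the expansion of
      \<open>G\<close>.\<close>
    define \<gamma> where "\<gamma> = (\<lambda>s. f ((x + t *\<^sub>R d) + s *\<^sub>R e) - f (x + s *\<^sub>R e) - s *\<^sub>R (of_real t * B))"
    define \<gamma>' where "\<gamma>' = (\<lambda>s h. h *\<^sub>R G ((x + t *\<^sub>R d) + s *\<^sub>R e) - h *\<^sub>R G (x + s *\<^sub>R e) - h *\<^sub>R (of_real t * B))"
    have D: "(\<gamma> has_derivative \<gamma>' s) (at s)" for s
      unfolding \<gamma>_def \<gamma>'_def G_def e_def
      by (intro has_derivative_diff has_derivative_partial_line f has_derivative_scaleR_left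
          has_derivative_ident)
    have c: "continuous_on {0..t} \<gamma>"
      using D by (meson continuous_at_imp_continuous_on has_derivative_continuous)
    obtain s where s: "s \<in> {0<..<t}" "norm (\<gamma> t - \<gamma> 0) \<le> norm (\<gamma>' s (t - 0))"
      using mvt_general[OF t(1) c D] by blast
    have n: "norm (s *\<^sub>R e) \<le> t" "norm (t *\<^sub>R d + s *\<^sub>R e) \<le> 2 * t"
      using s(1) n1 norm_triangle_ineq[of "t *\<^sub>R d" "s *\<^sub>R e"] by auto
    define r1 where "r1 = G (x + (t *\<^sub>R d + s *\<^sub>R e)) - G x - G' (t *\<^sub>R d + s *\<^sub>R e)"
    define r2 where "r2 = G (x + s *\<^sub>R e) - G x - G' (s *\<^sub>R e)"
    have "norm r1 \<le> \<epsilon> / 3 * norm (t *\<^sub>R d + s *\<^sub>R e)"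
      using \<delta>(2)[of "x + (t *\<^sub>R d + s *\<^sub>R e)"] n t by (simp add: r1_def)
    also have "\<dots> \<le> \<epsilon> / 3 * (2 * t)" using n \<open>\<epsilon> > 0\<close> by (intro mult_left_mono) auto
    finally have r1: "norm r1 \<le> \<epsilon> / 3 * (2 * t)" .
    have "norm r2 \<le> \<epsilon> / 3 * norm (s *\<^sub>R e)"
      using \<delta>(2)[of "x + s *\<^sub>R e"] n t by (simp add: r2_def)
    also have "\<dots> \<le> \<epsilon> / 3 * t" using n \<open>\<epsilon> > 0\<close> by (intro mult_left_mono) auto
    finally have r2: "norm r2 \<le> \<epsilon> / 3 * t" .
    have "\<gamma>' s (t - 0) = t *\<^sub>R (r1 - r2)"
      by (simp add: \<gamma>'_def r1_def r2_def B linear_add[OF lin] linear_scale[OF lin] algebra_simps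
          scaleR_conv_of_real[where 'a = complex])
    moreover have "norm (r1 - r2) \<le> \<epsilon> * t"
      using norm_triangle_ineq4[of r1 r2] r1 r2 by simp
    ultimately have "norm (\<gamma>' s (t - 0)) \<le> t * (\<epsilon> * t)"
      using t by (simp add: mult_left_mono)
    with s(2) have "norm (\<gamma> t - \<gamma> 0) \<le> \<epsilon> * t\<^sup>2" by (simp add: power2_eq_square algebra_simps)
    moreover have "\<gamma> t - \<gamma> 0 = f (x + t *\<^sub>R e + t *\<^sub>R d) - f (x + t *\<^sub>R e) - f (x + t *\<^sub>R d) + f x - of_real (t\<^sup>2) * B"
      by (simp add: \<gamma>_def scaleR_conv_of_real[where 'a = complex] power2_eq_square algebra_simps)
    ultimately show ?thesis by simp
  qed
  then show ?thesis
    using \<delta>(1) unfolding e_def d_def B_def G_def by (intro exI[of _ "\<delta>/2"]) auto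
qed

text \<open>The second difference is symmetric in the two directions, so both mixed derivatives
  approximate the same quotient \<open>X / q\<close>.\<close>

lemma partial_deriv_commute:
  assumes "smooth f"
  shows "partial_deriv i (partial_deriv j f) = partial_deriv j (partial_deriv i f)"
proof (rule ext)
  fix x
  let ?A = "partial_deriv i (partial_deriv j f) x" and ?B = "partial_deriv j (partial_deriv i f) x"
  have "cmod (?A - ?B) \<le> \<epsilon>" if "\<epsilon> > 0" for \<epsilon>
  proof -
    have e: "\<epsilon> / 2 > 0" using that by simp
    obtain \<delta>1 where \<delta>1: "\<delta>1 > 0" "\<And>t. 0 < t \<Longrightarrow> t < \<delta>1 \<Longrightarrow>
      cmod (f (x + t *\<^sub>R axis i 1 + t *\<^sub>R axis j 1) - f (x + t *\<^sub>R axis i 1) - f (x + t *\<^sub>R axis j 1) + f x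
        - of_real (t\<^sup>2) * ?B) \<le> \<epsilon> / 2 * t\<^sup>2"
      using second_difference_bound[OF smooth_differentiable[OF assms]
          smooth_differentiable[OF smooth_partial_deriv[OF assms]] e, where i = i and x = x and j = j] by blast
    obtain \<delta>2 where \<delta>2: "\<delta>2 > 0" "\<And>t. 0 < t \<Longrightarrow> t < \<delta>2 \<Longrightarrow>
      cmod (f (x + t *\<^sub>R axis j 1 + t *\<^sub>R axis i 1) - f (x + t *\<^sub>R axis j 1) - f (x + t *\<^sub>R axis i 1) + f x
        - of_real (t\<^sup>2) * ?A) \<le> \<epsilon> / 2 * t\<^sup>2"
      using second_difference_bound[OF smooth_differentiable[OF assms]
          smooth_differentiable[OF smooth_partial_deriv[OF assms]] e, where i = j and x = x and j = i] by blast
    define t where "t = min \<delta>1 \<delta>2 / 2"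
    have t: "0 < t" "t < \<delta>1" "t < \<delta>2" using \<delta>1(1) \<delta>2(1) by (auto simp: t_def)
    define X where "X = f (x + t *\<^sub>R axis i 1 + t *\<^sub>R axis j 1) - f (x + t *\<^sub>R axis i 1) - f (x + t *\<^sub>R axis j 1) + f x"
    define q where "q = complex_of_real (t\<^sup>2)"
    have q: "cmod q = t\<^sup>2" by (simp add: q_def del: of_real_power)
    have b: "cmod (X - q * ?B) \<le> \<epsilon> / 2 * t\<^sup>2"
      unfolding X_def q_def by (rule \<delta>1(2)[OF t(1,2)])
    have X2: "X = f (x + t *\<^sub>R axis j 1 + t *\<^sub>R axis i 1) - f (x + t *\<^sub>R axis j 1)
        - f (x + t *\<^sub>R axis i 1) + f x"
      by (simp add: X_def add.commute add.left_commute)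
    have a: "cmod (X - q * ?A) \<le> \<epsilon> / 2 * t\<^sup>2"
      unfolding X2 q_def by (rule \<delta>2(2)[OF t(1,3)])
    have "t\<^sup>2 * cmod (?A - ?B) = cmod ((X - q * ?B) - (X - q * ?A))"
      by (simp only: q[symmetric] norm_mult[symmetric]) (simp add: algebra_simps)
    also have "\<dots> \<le> \<epsilon> / 2 * t\<^sup>2 + \<epsilon> / 2 * t\<^sup>2"
      using norm_triangle_ineq4[of "X - q * ?B" "X - q * ?A"] a b by linarith
    also have "\<dots> = t\<^sup>2 * \<epsilon>" by simp
    finally have "t\<^sup>2 * cmod (?A - ?B) \<le> t\<^sup>2 * \<epsilon>" .
    then show ?thesis using t(1) by simp
  qed
  then have "cmod (?A - ?B) \<le> 0" by (rule field_le_epsilon) simp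
  then show "?A = ?B" by simp
qed

lemma iter_deriv_commute:
  "smooth f \<Longrightarrow> iter_deriv js (partial_deriv i f) = partial_deriv i (iter_deriv js f)"
proof (induction js)
  case (Cons j js)
  then show ?case using partial_deriv_commute[OF smooth_iter_deriv[OF Cons.prems, of js]] by simp
qed simp

text \<open>Used in the polynomial approximation to make a chosen derivative the innermost
  one.\<close>

lemma iter_deriv_perm:
  assumes "smooth f" "mset js = mset ks"
  shows "iter_deriv js f = iter_deriv ks f"
  using assms(2)
proof (induction js arbitrary: ks)
  case (Cons j js)
  then have "j \<in> set ks" by (metis list.set_intros(1) set_mset_mset)
  then obtain a b where ks: "ks = a @ j # b" by (meson split_list)
  have "iter_deriv js f = iter_deriv (a @ b) f" using Cons ks by (intro Cons.IH) auto
  then show ?case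
    using iter_deriv_commute[OF smooth_iter_deriv[OF assms(1)], of a j b] by (simp add: ks)
qed simp

lemma list_with_counts: "\<exists>js :: 'n::finite list. \<forall>i. count_list js i = f i"
proof -
  obtain js :: "'n list" where "mset js = (\<Sum>i\<in>UNIV. replicate_mset (f i) i)" using ex_mset by blast
  then have "count_list js i = f i" for i
    by (simp add: count_mset[symmetric] count_sum)
  then show ?thesis by blast
qed

text \<open>The list picked by \<open>SOME\<close> depends on \<open>m\<close> only, so one list
  serves all functions and the equality is one of operators. Its counts and its length are all that
  is used of it later.\<close>

lemma multi_deriv_list:
  obtains js :: "'n::finite list" where "multi_deriv m = iter_deriv js"
    "\<And>i. count_list js i = Poly_Mapping.lookup m i" "length js = mdeg m"
proof -
  define js where "js = (SOME is. \<forall>i. count_list is i = Poly_Mapping.lookup m i)"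
  have c: "\<forall>i. count_list js i = Poly_Mapping.lookup m i"
    unfolding js_def by (rule someI_ex) (rule list_with_counts)
  have "sum (count_list js) (set js) = length js" by (rule sum_count_set) auto
  moreover have "sum (count_list js) (set js) = sum (count_list js) UNIV"
    by (intro sum.mono_neutral_left) (auto simp: count_list_0_iff)
  ultimately have "length js = mdeg m" using c by (simp add: mdeg_def)
  then show ?thesis using that[of js] c by (auto simp: js_def multi_deriv_def fun_eq_iff)
qed

lemma partial_deriv_local:
  assumes "open V" "x \<in> V" "\<And>y. y \<in> V \<Longrightarrow> f y = g y" "f differentiable (at x)"
  shows "partial_deriv i f x = partial_deriv i g x"
proof -
  have "(f has_derivative frechet_derivative f (at x)) (at x)" using assms(4) by (rule has_derivative_frechet)
  from has_derivative_transform_within_open[OF this assms(1,2)] assms(3)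
  have "(g has_derivative frechet_derivative f (at x)) (at x)" by blast
  from partial_deriv_eq[OF this] show ?thesis by (simp add: partial_deriv_def)
qed

lemma iter_deriv_local:
  assumes "open V" "smooth f" "\<And>y. y \<in> V \<Longrightarrow> f y = g y" "x \<in> V"
  shows "iter_deriv js f x = iter_deriv js g x"
  using assms(4)
proof (induction js arbitrary: x)
  case (Cons j js)
  then show ?case
    using partial_deriv_local[OF assms(1) Cons.prems Cons.IH smooth_differentiable[OF smooth_iter_deriv[OF assms(2)]]]
    by simp
qed (use assms in simp)

section \<open>Polynomial functions\<close>

definition mon :: "('n::finite \<Rightarrow> nat) \<Rightarrow> real^'n \<Rightarrow> complex" where
  "mon \<alpha> x = (\<Prod>i\<in>UNIV. of_real (vec_nth x i) ^ \<alpha> i)"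

text \<open>Generated by terms under sums only, so that an argument about a linear functional has
  just these two cases; closure under products is derived.\<close>

inductive polyfun :: "(real^'n::finite \<Rightarrow> complex) \<Rightarrow> bool" where
  monom: "polyfun (\<lambda>x. c * mon \<alpha> x)"
| add: "polyfun p \<Longrightarrow> polyfun q \<Longrightarrow> polyfun (\<lambda>x. p x + q x)"

lemma smooth_mon: "smooth (mon \<alpha>)"
  unfolding mon_def by (intro smooth_prod smooth_power smooth_coord)

lemma polyfun_smooth: "polyfun p \<Longrightarrow> smooth p"
  by (induction rule: polyfun.induct) (auto intro: smooth_cmult smooth_mon smooth_add)

lemma polyfun_mon: "polyfun (mon \<alpha>)"
  using polyfun.monom[of 1 \<alpha>] by simp

lemma polyfun_cmult: "polyfun p \<Longrightarrow> polyfun (\<lambda>x. c * p x)"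
proof (induction rule: polyfun.induct)
  case (monom d \<alpha>) then show ?case using polyfun.monom[of "c * d" \<alpha>] by (simp add: mult.assoc)
next
  case (add p q) then show ?case by (auto simp: distrib_left intro: polyfun.add)
qed

lemma polyfun_mult:
  assumes "polyfun p" "polyfun q"
  shows "polyfun (\<lambda>x. p x * q x)"
  using assms(1)
proof (induction rule: polyfun.induct)
  case (monom c \<alpha>)
  show ?case using assms(2)
  proof (induction rule: polyfun.induct)
    case (monom d \<beta>)
    have "mon (\<lambda>i. \<alpha> i + \<beta> i) x = mon \<alpha> x * mon \<beta> x" for x
      by (simp add: mon_def power_add prod.distrib)
    then show ?case using polyfun.monom[of "c * d" "\<lambda>i. \<alpha> i + \<beta> i"] by (simp add: ac_simps)
  next
    case (add p q) then show ?case by (auto simp: distrib_left intro: polyfun.add)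
  qed
next
  case (add p q) then show ?case by (auto simp: distrib_right intro: polyfun.add)
qed

lemma polyfun_const: "polyfun (\<lambda>x. c)"
  using polyfun.monom[of c "\<lambda>i. 0"] by (simp add: mon_def)

lemma polyfun_sum: "(\<And>i. i \<in> I \<Longrightarrow> polyfun (f i)) \<Longrightarrow> polyfun (\<lambda>x. \<Sum>i\<in>I. f i x)"
  by (induction I rule: infinite_finite_induct) (auto intro: polyfun_const polyfun.add)

lemma polyfun_coord: "polyfun (\<lambda>x. of_real (vec_nth x j))"
proof -
  have "mon (\<lambda>i. if i = j then 1 else 0) x = of_real (vec_nth x j)" for x :: "real^'a"
  proof -
    have "of_real (vec_nth x i) ^ (if i = j then 1 else 0)
        = (if i = j then of_real (vec_nth x i) else (1::complex))" for i by simp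
    then show ?thesis by (simp add: mon_def)
  qed
  then show ?thesis using polyfun_mon[of "\<lambda>i. if i = j then 1 else 0"] by presburger
qed

text \<open>Translates the polynomials of the Stone-Weierstrass theorem, which are generated by
  bounded linear forms instead of coordinates; a linear form is expanded in the standard
  basis.\<close>

lemma polyfun_of_real: "real_polynomial_function g \<Longrightarrow> polyfun (\<lambda>x. of_real (g x))"
proof (induction rule: real_polynomial_function.induct)
  case (linear f)
  then have "linear f" by (simp add: bounded_linear.linear)
  have fx: "f x = (\<Sum>i\<in>UNIV. vec_nth x i * f (axis i 1))" for x
  proof -
    have "f x = f (\<Sum>i\<in>UNIV. vec_nth x i *\<^sub>R axis i 1)"
      using basis_expansion[of x] by (simp add: scalar_mult_eq_scaleR)
    also have "\<dots> = (\<Sum>i\<in>UNIV. vec_nth x i * f (axis i 1))"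
      using \<open>linear f\<close> by (simp add: linear_sum linear_scale)
    finally show ?thesis .
  qed
  have "(\<lambda>x. complex_of_real (f x)) =
      (\<lambda>x. \<Sum>i\<in>UNIV. of_real (f (axis i 1)) * of_real (vec_nth x i))"
    by (rule ext, subst fx) (simp add: mult.commute)
  then show ?case by (simp only:) (intro polyfun_sum polyfun_cmult polyfun_coord)
qed (auto intro: polyfun_const polyfun.add polyfun_mult)

lemma polyfun_dense:
  fixes f :: "real^'n::finite \<Rightarrow> complex"
  assumes "compact S" "continuous_on S f" "\<epsilon> > 0"
  shows "\<exists>p. polyfun p \<and> (\<forall>x\<in>S. cmod (f x - p x) < \<epsilon>)"
proof -
  have e: "\<epsilon> / 2 > 0" using assms(3) by simp
  obtain g where g: "real_polynomial_function g" "\<And>x. x \<in> S \<Longrightarrow> \<bar>Re (f x) - g x\<bar> < \<epsilon> / 2"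
    using Stone_Weierstrass_real_polynomial_function[OF assms(1) _ e] continuous_on_Re[OF assms(2)] by blast
  obtain h where h: "real_polynomial_function h" "\<And>x. x \<in> S \<Longrightarrow> \<bar>Im (f x) - h x\<bar> < \<epsilon> / 2"
    using Stone_Weierstrass_real_polynomial_function[OF assms(1) _ e] continuous_on_Im[OF assms(2)] by blast
  let ?p = "\<lambda>x. of_real (g x) + \<i> * of_real (h x)"
  have "cmod (f x - ?p x) < \<epsilon>" if "x \<in> S" for x
    using cmod_le[of "f x - ?p x"] g(2)[OF that] h(2)[OF that] by simp
  moreover have "polyfun ?p" by (intro polyfun.add polyfun_cmult polyfun_of_real g h)
  ultimately show ?thesis by blast
qed

section \<open>Derivatives and primitives of monomials\<close>

lemma partial_deriv_power:
  "smooth f \<Longrightarrow> partial_deriv i (\<lambda>x. f x ^ n) = (\<lambda>x. of_nat n * (f x ^ (n - 1) * partial_deriv i f x))"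
proof (induction n)
  case (Suc n)
  have "partial_deriv i (\<lambda>x. f x * f x ^ n) =
      (\<lambda>x. partial_deriv i f x * f x ^ n + f x * partial_deriv i (\<lambda>x. f x ^ n) x)"
    using Suc.prems by (intro partial_deriv_mult smooth_differentiable smooth_power)
  also have "\<dots> = (\<lambda>x. of_nat (Suc n) * (f x ^ n * partial_deriv i f x))"
    using Suc by (cases n) (auto simp: algebra_simps)
  finally show ?case by simp
qed simp

text \<open>At \<open>\<alpha> j = 0\<close> the truncated exponent is harmless, since the factor
  \<open>of_nat (\<alpha> j)\<close> vanishes.\<close>

lemma partial_deriv_mon:
  "partial_deriv j (mon \<alpha>) = (\<lambda>x. of_nat (\<alpha> j) * mon (\<alpha>(j := \<alpha> j - 1)) x)"
proof -
  let ?c = "\<lambda>i (x :: real^'a). complex_of_real (vec_nth x i)"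
  let ?r = "\<lambda>x. \<Prod>i\<in>UNIV - {j}. ?c i x ^ \<alpha> i"
  have z: "partial_deriv j (\<lambda>x. \<Prod>i\<in>I. ?c i x ^ \<alpha> i) = (\<lambda>x. 0)" if "finite I" "j \<notin> I" for I
    using that
  proof (induction I rule: finite_induct)
    case (insert a I)
    have "partial_deriv j (\<lambda>x. ?c a x ^ \<alpha> a * (\<Prod>i\<in>I. ?c i x ^ \<alpha> i)) = (\<lambda>x. 0)"
      using insert
      by (subst partial_deriv_mult)
        (auto intro!: smooth_differentiable smooth_power smooth_coord smooth_prod
          simp: partial_deriv_power smooth_coord partial_deriv_coord)
    then show ?case using insert by simp
  qed simp
  have m: "mon \<beta> x = ?c j x ^ \<beta> j * (\<Prod>i\<in>UNIV - {j}. ?c i x ^ \<beta> i)" for \<beta> x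
    unfolding mon_def by (rule prod.remove) auto
  have "partial_deriv j (\<lambda>x. ?c j x ^ \<alpha> j * ?r x) =
      (\<lambda>x. partial_deriv j (\<lambda>x. ?c j x ^ \<alpha> j) x * ?r x + ?c j x ^ \<alpha> j * partial_deriv j ?r x)"
    by (intro partial_deriv_mult smooth_differentiable smooth_power smooth_coord smooth_prod)
  also have "\<dots> = (\<lambda>x. of_nat (\<alpha> j) * (?c j x ^ (\<alpha> j - 1) * ?r x))"
    by (simp add: z partial_deriv_power smooth_coord partial_deriv_coord algebra_simps)
  finally have "partial_deriv j (\<lambda>x. ?c j x ^ \<alpha> j * ?r x) = (\<lambda>x. of_nat (\<alpha> j) * (?c j x ^ (\<alpha> j - 1) * ?r x))" .
  moreover have "mon \<alpha> = (\<lambda>x. ?c j x ^ \<alpha> j * ?r x)" by (rule ext) (rule m)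
  moreover have "mon (\<alpha>(j := \<alpha> j - 1)) x = ?c j x ^ (\<alpha> j - 1) * ?r x" for x
    by (subst m) (auto intro!: arg_cong2[where f = "(*)"] prod.cong)
  ultimately show ?thesis by simp
qed

text \<open>The constant is a product of falling factorials; only whether it vanishes is recorded.
  When it does, the truncated exponents carry no meaning.\<close>

lemma iter_deriv_mon:
  "\<exists>c. iter_deriv js (mon \<alpha>) = (\<lambda>x. c * mon (\<lambda>i. \<alpha> i - count_list js i) x) \<and>
    (c \<noteq> 0 \<longleftrightarrow> (\<forall>i. count_list js i \<le> \<alpha> i))"
proof (induction js)
  case Nil show ?case by (intro exI[of _ 1]) auto
next
  case (Cons j js)
  then obtain c where c: "iter_deriv js (mon \<alpha>) = (\<lambda>x. c * mon (\<lambda>i. \<alpha> i - count_list js i) x)"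
    "c \<noteq> 0 \<longleftrightarrow> (\<forall>i. count_list js i \<le> \<alpha> i)" by blast
  let ?d = "c * of_nat (\<alpha> j - count_list js j)"
  have eq: "(\<lambda>i. \<alpha> i - count_list js i)(j := \<alpha> j - count_list js j - 1) = (\<lambda>i. \<alpha> i - count_list (j # js) i)"
    by auto
  have "iter_deriv (j # js) (mon \<alpha>) = (\<lambda>x. ?d * mon (\<lambda>i. \<alpha> i - count_list (j # js) i) x)"
    by (simp only: foldr_Cons o_apply c(1) partial_deriv_cmult[OF smooth_mon] partial_deriv_mon eq mult.assoc)
  moreover have "?d \<noteq> 0 \<longleftrightarrow> (\<forall>i. count_list (j # js) i \<le> \<alpha> i)"
  proof
    assume "?d \<noteq> 0"
    then have "count_list js j < \<alpha> j" "\<forall>i. count_list js i \<le> \<alpha> i" using c(2) by auto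
    then show "\<forall>i. count_list (j # js) i \<le> \<alpha> i" by auto
  next
    assume *: "\<forall>i. count_list (j # js) i \<le> \<alpha> i"
    have "count_list js i \<le> \<alpha> i" for i using spec[OF *, of i] by (simp split: if_splits)
    then have "c \<noteq> 0" using c(2) by blast
    moreover have "count_list js j < \<alpha> j" using spec[OF *, of j] by simp
    ultimately show "?d \<noteq> 0" by simp
  qed
  ultimately show ?case by blast
qed

lemma polyfun_primitive:
  "polyfun q \<Longrightarrow> \<exists>p. polyfun p \<and> partial_deriv j p = q \<and> (\<forall>x. vec_nth x j = c \<longrightarrow> p x = 0)"
proof (induction rule: polyfun.induct)
  case (monom d \<alpha>)
  define k where "k = d / of_nat (Suc (\<alpha> j))"
  have k: "k * of_nat (Suc (\<alpha> j)) = d" by (simp add: k_def del: of_nat_Suc)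
  \<comment> \<open>The constant of integration may depend on the other variables:
    \<open>?p2\<close> is the monomial without its power of the \<open>j\<close>-th coordinate,
    scaled so that the primitive vanishes on the hyperplane.\<close>
  define k' where "k' = - k * of_real c ^ Suc (\<alpha> j)"
  let ?p1 = "mon (\<alpha>(j := Suc (\<alpha> j)))" and ?p2 = "mon (\<alpha>(j := 0))"
  let ?p = "\<lambda>x. k * ?p1 x + k' * ?p2 x"
  have "polyfun ?p" by (intro polyfun.intros)
  moreover have "partial_deriv j ?p = (\<lambda>x. d * mon \<alpha> x)"
    by (subst partial_deriv_add)
      (auto intro!: smooth_differentiable smooth_cmult smooth_mon
        simp: partial_deriv_cmult smooth_mon partial_deriv_mon k mult.assoc[symmetric] simp del: of_nat_Suc)
  moreover have "?p x = 0" if "vec_nth x j = c" for x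
  proof -
    have "?p1 x = of_real c ^ Suc (\<alpha> j) * (\<Prod>i\<in>UNIV - {j}. of_real (vec_nth x i) ^ \<alpha> i)"
      unfolding mon_def by (subst prod.remove[of _ j]) (auto simp: that intro!: prod.cong)
    moreover have "?p2 x = (\<Prod>i\<in>UNIV - {j}. of_real (vec_nth x i) ^ \<alpha> i)"
      unfolding mon_def by (subst prod.remove[of _ j]) (auto intro!: prod.cong)
    ultimately show ?thesis by (simp add: k'_def)
  qed
  ultimately show ?case by blast
next
  case (add q1 q2)
  then obtain p1 p2 where
    "polyfun p1" "partial_deriv j p1 = q1" "\<forall>x. vec_nth x j = c \<longrightarrow> p1 x = 0"
    "polyfun p2" "partial_deriv j p2 = q2" "\<forall>x. vec_nth x j = c \<longrightarrow> p2 x = 0" by blast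
  then show ?case
    by (intro exI[of _ "\<lambda>x. p1 x + p2 x"])
      (auto intro: polyfun.add simp: partial_deriv_add smooth_differentiable polyfun_smooth)
qed

section \<open>Polynomial approximation with derivatives on cubes\<close>

lemma iter_deriv_hyperplane_zero:
  assumes "smooth h" "\<And>x. vec_nth x j = c \<Longrightarrow> h x = 0" "j \<notin> set ks" "vec_nth x j = c"
  shows "iter_deriv ks h x = 0"
  using assms(3,4)
proof (induction ks arbitrary: x)
  case (Cons i ks)
  let ?u = "iter_deriv ks h"
  \<comment> \<open>Since \<open>i \<noteq> j\<close>, the line in direction \<open>i\<close> stays
    in the hyperplane, where the induction hypothesis applies.\<close>
  have z: "(\<lambda>t. ?u (x + t *\<^sub>R axis i 1)) = (\<lambda>t. 0)"
    using Cons by (intro ext Cons.IH) (auto simp: axis_def)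
  have "((\<lambda>t. ?u (x + t *\<^sub>R axis i 1)) has_derivative (\<lambda>h. h *\<^sub>R partial_deriv i ?u (x + 0 *\<^sub>R axis i 1))) (at 0)"
    by (intro has_derivative_partial_line smooth_differentiable smooth_iter_deriv assms)
  then have "((\<lambda>t :: real. 0) has_derivative (\<lambda>h. h *\<^sub>R partial_deriv i ?u (x + 0 *\<^sub>R axis i 1))) (at 0)"
    by (simp only: z)
  from has_derivative_unique[OF this has_derivative_const]
  have "(\<lambda>h. h *\<^sub>R partial_deriv i ?u (x + 0 *\<^sub>R axis i 1)) = (\<lambda>h. 0)" .
  from fun_cong[OF this, of 1] show ?case by simp
qed (use assms in simp)

text \<open>Cubes rather than balls: they are boxes, as integration wants them, and their faces lie
  in coordinate hyperplanes from which one can integrate along an axis.\<close>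

definition cube :: "real \<Rightarrow> (real^'n::finite) set" where
  "cube S = {x. \<forall>i. \<bar>vec_nth x i\<bar> \<le> S}"

lemma cube_cbox: "(cube S :: (real^'n::finite) set) = cbox (vec_lambda (\<lambda>i. - S)) (vec_lambda (\<lambda>i. S))"
  by (auto simp: cube_def mem_box_cart abs_le_iff minus_le_iff)

lemma compact_cube: "compact (cube S)"
  unfolding cube_cbox by (rule compact_cbox)

lemma closed_cube: "closed (cube S)"
  by (rule compact_imp_closed[OF compact_cube])

text \<open>Approximate a derivative, and integrate the approximation from the face on which the
  function vanishes.\<close>

lemma polyfun_approx_smooth:
  assumes "smooth \<phi>" "\<And>x. \<exists>i. vec_nth x i < - R \<Longrightarrow> \<phi> x = 0" "R < S" "0 < S" "\<epsilon> > 0"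
  shows "\<exists>p. polyfun p \<and> (\<forall>ks x. mset ks \<subseteq># mset js \<longrightarrow> x \<in> cube S \<longrightarrow>
    cmod (iter_deriv ks (\<lambda>x. \<phi> x - p x) x) \<le> \<epsilon>)"
  using assms
proof (induction js arbitrary: \<phi> \<epsilon>)
  case Nil
  obtain p where "polyfun p" "\<forall>x\<in>cube S. cmod (\<phi> x - p x) < \<epsilon>"
    using polyfun_dense[OF compact_cube smooth_continuous_on[OF Nil.prems(1)] Nil.prems(5)] by blast
  then show ?case by (intro exI[of _ p]) (auto simp: less_imp_le)
next
  case (Cons j js)
  define \<psi> where "\<psi> = partial_deriv j \<phi>"
  \<comment> \<open>The divisor \<open>2 * S + 1\<close> serves both uses of the bound: directly,
    where \<open>\<epsilon>' \<le> \<epsilon>\<close> suffices, and after integration over a length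
    of at most \<open>2 * S\<close>.\<close>
  define \<epsilon>' where "\<epsilon>' = \<epsilon> / (2 * S + 1)"
  have e: "\<epsilon>' > 0" "\<epsilon>' \<le> \<epsilon>" "2 * S * \<epsilon>' \<le> \<epsilon>"
    using Cons.prems by (auto simp: \<epsilon>'_def divide_simps algebra_simps)
  have "\<psi> x = 0" if neg: "\<exists>i. vec_nth x i < - R" for x
  proof -
    obtain i where i: "vec_nth x i < - R" using neg by blast
    have "open {x :: real^'a. vec_nth x i < - R}"
      by (intro open_Collect_less continuous_intros)
    from partial_deriv_local[OF this, of x \<phi> "\<lambda>x. 0" j] show ?thesis
      using i Cons.prems(2) smooth_differentiable[OF Cons.prems(1)] by (auto simp: \<psi>_def)
  qed
  from Cons.IH[OF smooth_partial_deriv[OF Cons.prems(1), of j, folded \<psi>_def] this Cons.prems(3,4) e(1)]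
  obtain q where q: "polyfun q" "\<And>ks x. mset ks \<subseteq># mset js \<Longrightarrow> x \<in> cube S \<Longrightarrow>
      cmod (iter_deriv ks (\<lambda>x. \<psi> x - q x) x) \<le> \<epsilon>'"
    by blast
  obtain p where p: "polyfun p" "partial_deriv j p = q" "\<And>x. vec_nth x j = - S \<Longrightarrow> p x = 0"
    using polyfun_primitive[OF q(1)] by metis
  define h where "h = (\<lambda>x. \<phi> x - p x)"
  have h: "smooth h" unfolding h_def using Cons.prems(1) polyfun_smooth[OF p(1)] by (rule smooth_diff)
  have "iter_deriv [j] h = (\<lambda>x. iter_deriv [j] \<phi> x - iter_deriv [j] p x)"
    unfolding h_def using Cons.prems(1) polyfun_smooth[OF p(1)] by (rule iter_deriv_diff)
  then have dh: "partial_deriv j h = (\<lambda>x. \<psi> x - q x)" by (simp add: \<psi>_def p(2))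
  have "cmod (iter_deriv ks h x) \<le> \<epsilon>" if ks: "mset ks \<subseteq># mset (j # js)" and x: "x \<in> cube S" for ks x
  proof (cases "j \<in> set ks")
    case True
    \<comment> \<open>One occurrence of \<open>j\<close> is moved to the innermost place, where it
      turns \<open>h\<close> into \<open>\<psi> - q\<close>; the induction hypothesis covers the
      remaining derivatives without any integration.\<close>
    have "iter_deriv ks h = iter_deriv (remove1 j ks @ [j]) h"
      using True by (intro iter_deriv_perm h) simp
    also have "\<dots> = iter_deriv (remove1 j ks) (\<lambda>x. \<psi> x - q x)" by (simp add: dh)
    finally have "iter_deriv ks h = iter_deriv (remove1 j ks) (\<lambda>x. \<psi> x - q x)" .
    moreover have "mset (remove1 j ks) \<subseteq># mset js"
      using ks by (simp add: subset_eq_diff_conv)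
    ultimately show ?thesis using q(2)[OF _ x, of "remove1 j ks"] e by simp
  next
    case False
    then have ks': "mset ks \<subseteq># mset js"
      using ks unfolding subseteq_mset_def by (metis count_add_mset count_mset_0_iff le0 mset.simps(2))
    define u where "u = iter_deriv ks h"
    have du: "partial_deriv j u = iter_deriv ks (\<lambda>x. \<psi> x - q x)"
      unfolding u_def dh[symmetric] by (rule iter_deriv_commute[OF h, symmetric])
    \<comment> \<open>The projection of \<open>x\<close> to the face where the \<open>j\<close>-th
      coordinate is \<open>- S\<close>. On that hyperplane \<open>p\<close> vanishes by the choice
      of primitive and \<open>\<phi>\<close> because \<open>- S < - R\<close>. The derivatives in
      \<open>ks\<close> are tangential to it, hence \<open>u x0 = 0\<close>, and the mean value
      inequality from \<open>x0\<close> to \<open>x\<close> bounds \<open>u x\<close>.\<close>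
    define x0 where "x0 = x - (vec_nth x j + S) *\<^sub>R axis j 1"
    have xj: "- S \<le> vec_nth x j" "vec_nth x j \<le> S" using x by (auto simp: cube_def abs_le_iff minus_le_iff)
    have x0j: "vec_nth x0 j = - S" by (simp add: x0_def axis_def)
    have "h y = 0" if "vec_nth y j = - S" for y
    proof -
      have "\<exists>i. vec_nth y i < - R" using that Cons.prems(3) by (intro exI[of _ j]) simp
      then show ?thesis using p(3)[OF that] Cons.prems(2) by (simp add: h_def)
    qed
    then have u0: "u x0 = 0"
      unfolding u_def by (rule iter_deriv_hyperplane_zero[OF h _ False x0j])
    show ?thesis
    proof (cases "vec_nth x j = - S")
      case True then show ?thesis using u0 Cons.prems by (simp add: x0_def u_def)
    next
      case False
      then have pos: "0 < vec_nth x j + S" using xj by simp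
      let ?f = "\<lambda>t. u (x0 + t *\<^sub>R axis j 1)"
      let ?f' = "\<lambda>t h. h *\<^sub>R partial_deriv j u (x0 + t *\<^sub>R axis j 1)"
      have D: "(?f has_derivative ?f' t) (at t)" for t
        unfolding u_def by (intro has_derivative_partial_line smooth_differentiable smooth_iter_deriv h)
      have c: "continuous_on {0..vec_nth x j + S} ?f"
        using D by (meson continuous_at_imp_continuous_on has_derivative_continuous)
      obtain t where t: "t \<in> {0<..<vec_nth x j + S}"
        "norm (?f (vec_nth x j + S) - ?f 0) \<le> norm (?f' t (vec_nth x j + S - 0))"
        using mvt_general[OF pos c D] by blast
      have "x0 + t *\<^sub>R axis j 1 \<in> cube S"
        unfolding cube_def
      proof (intro CollectI allI)
        fix i
        have "\<bar>vec_nth x i\<bar> \<le> S" using x by (simp add: cube_def)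
        then show "\<bar>vec_nth (x0 + t *\<^sub>R axis j 1) i\<bar> \<le> S"
          using t(1) xj(2) by (cases "i = j") (auto simp: x0_def axis_def abs_le_iff)
      qed
      then have "cmod (partial_deriv j u (x0 + t *\<^sub>R axis j 1)) \<le> \<epsilon>'"
        unfolding du using q(2)[OF ks'] by blast
      then have "norm (?f' t (vec_nth x j + S - 0)) \<le> (vec_nth x j + S) * \<epsilon>'"
        using pos by (simp add: mult_left_mono)
      also have "\<dots> \<le> 2 * S * \<epsilon>'" using xj e by (intro mult_right_mono) auto
      finally have "norm (?f' t (vec_nth x j + S - 0)) \<le> \<epsilon>" using e by simp
      moreover have "?f (vec_nth x j + S) - ?f 0 = u x" using u0 by (simp add: x0_def)
      ultimately show ?thesis using t(2) by (simp add: u_def)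
    qed
  qed
  then show ?case using p(1) unfolding h_def by blast
qed

text \<open>The weight plays the role of a monomial order on the finite set \<open>S\<close>.\<close>

lemma separating_weight_on:
  fixes S :: "('i \<Rightarrow> nat) set"
  assumes "finite I" "finite S" "S \<noteq> {}"
  shows "\<exists>w :: 'i \<Rightarrow> nat. \<exists>\<beta>\<in>S. \<forall>\<gamma>\<in>S. (\<exists>i\<in>I. \<gamma> i \<noteq> \<beta> i) \<longrightarrow> (\<Sum>i\<in>I. w i * \<beta> i) < (\<Sum>i\<in>I. w i * \<gamma> i)"
  using assms
proof (induction I arbitrary: S rule: finite_induct)
  case empty then show ?case by auto
next
  case (insert j I)
  define m where "m = Min ((\<lambda>\<gamma>. \<gamma> j) ` S)"
  have m: "m \<le> \<gamma> j" if "\<gamma> \<in> S" for \<gamma> using that insert.prems by (simp add: m_def)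
  \<comment> \<open>A lexicographic minimum: coordinate \<open>j\<close> is minimized first, and the
    induction hypothesis decides among the minimizers.\<close>
  define S' where "S' = {\<gamma>\<in>S. \<gamma> j = m}"
  have "m \<in> (\<lambda>\<gamma>. \<gamma> j) ` S" unfolding m_def using insert.prems by (intro Min_in) auto
  then have "finite S'" "S' \<noteq> {}" using insert.prems by (auto simp: S'_def)
  from insert.IH[OF this] obtain w :: "'i \<Rightarrow> nat" and \<beta> where w: "\<beta> \<in> S'"
    "\<And>\<gamma>. \<gamma> \<in> S' \<Longrightarrow> \<exists>i\<in>I. \<gamma> i \<noteq> \<beta> i \<Longrightarrow> (\<Sum>i\<in>I. w i * \<beta> i) < (\<Sum>i\<in>I. w i * \<gamma> i)"
    by blast
  \<comment> \<open>One more than the weight of \<open>\<beta>\<close> in the other coordinates, so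
    that a single step up in coordinate \<open>j\<close> already outweighs them.\<close>
  define W where "W = Suc (\<Sum>i\<in>I. w i * \<beta> i)"
  have sum: "(\<Sum>i\<in>insert j I. (w(j := W)) i * \<gamma> i) = W * \<gamma> j + (\<Sum>i\<in>I. w i * \<gamma> i)" for \<gamma> :: "'i \<Rightarrow> nat"
    using insert.hyps by (auto intro!: sum.cong)
  have "(\<Sum>i\<in>insert j I. (w(j := W)) i * \<beta> i) < (\<Sum>i\<in>insert j I. (w(j := W)) i * \<gamma> i)"
    if \<gamma>: "\<gamma> \<in> S" "\<exists>i\<in>insert j I. \<gamma> i \<noteq> \<beta> i" for \<gamma>
  proof (cases "\<gamma> j = m")
    case True
    then have "\<gamma> \<in> S'" "\<exists>i\<in>I. \<gamma> i \<noteq> \<beta> i" using \<gamma> w(1) by (auto simp: S'_def)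
    from w(2)[OF this] show ?thesis unfolding sum using True w(1) by (simp add: S'_def)
  next
    case False
    then have "Suc m \<le> \<gamma> j" using m[OF \<gamma>(1)] by simp
    then have "W * Suc m \<le> W * \<gamma> j" by (rule mult_le_mono2)
    then show ?thesis unfolding sum using w(1) by (simp add: S'_def W_def)
  qed
  then show ?case using w(1) by (intro exI[of _ "w(j := W)"] bexI[of _ \<beta>]) (auto simp: S'_def)
qed

text \<open>The transpose of a nonzero operator with constant coefficients maps polynomials onto
  polynomials: modulo monomials of smaller weight, its term of least weight maps
  \<open>x\<^bsup>\<alpha>+\<beta>\<^esup>\<close> to a nonzero multiple of \<open>x\<^bsup>\<alpha>\<^esup>\<close>.\<close>

lemma polyfun_functional_zero:
  fixes a :: "'n::finite diffop" and L :: "(real^'n \<Rightarrow> complex) \<Rightarrow> complex"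
  assumes a: "a \<noteq> 0"
    and add: "\<And>p q. polyfun p \<Longrightarrow> polyfun q \<Longrightarrow> L (\<lambda>x. p x + q x) = L p + L q"
    and cmult: "\<And>c p. polyfun p \<Longrightarrow> L (\<lambda>x. c * p x) = c * L p"
    and L: "\<And>\<alpha>. (\<Sum>m\<in>Poly_Mapping.keys a.
      Poly_Mapping.lookup a m * ((-1) ^ mdeg m * L (multi_deriv m (mon \<alpha>)))) = 0"
    and "polyfun p"
  shows "L p = 0"
proof -
  let ?S = "Poly_Mapping.lookup ` Poly_Mapping.keys a"
  have "finite ?S" "?S \<noteq> {}" using a by auto
  from separating_weight_on[OF finite this, of UNIV] obtain w :: "'n \<Rightarrow> nat" where
    "\<exists>b\<in>?S. \<forall>\<gamma>\<in>?S. (\<exists>i\<in>UNIV. \<gamma> i \<noteq> b i) \<longrightarrow> (\<Sum>i\<in>UNIV. w i * b i) < (\<Sum>i\<in>UNIV. w i * \<gamma> i)" ..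
  then obtain b where b: "b \<in> ?S"
    "\<forall>\<gamma>\<in>?S. (\<exists>i\<in>UNIV. \<gamma> i \<noteq> b i) \<longrightarrow> (\<Sum>i\<in>UNIV. w i * b i) < (\<Sum>i\<in>UNIV. w i * \<gamma> i)" ..
  obtain \<beta> where \<beta>: "b = Poly_Mapping.lookup \<beta>" "\<beta> \<in> Poly_Mapping.keys a" using b(1) ..
  have w: "(\<Sum>i\<in>UNIV. w i * Poly_Mapping.lookup \<beta> i) < (\<Sum>i\<in>UNIV. w i * Poly_Mapping.lookup \<gamma> i)"
    if \<gamma>: "\<gamma> \<in> Poly_Mapping.keys a" "\<gamma> \<noteq> \<beta>" for \<gamma>
  proof -
    have "\<exists>i\<in>UNIV. Poly_Mapping.lookup \<gamma> i \<noteq> Poly_Mapping.lookup \<beta> i"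
      using \<gamma>(2) by (simp add: poly_mapping_eq_iff fun_eq_iff)
    then show ?thesis
      using bspec[OF b(2) imageI[OF \<gamma>(1)]] unfolding \<beta>(1) by (rule mp[rotated])
  qed
  note \<beta> = \<beta>(2)
  have md: "\<exists>c. multi_deriv m (mon \<alpha>) = (\<lambda>x. c * mon (\<lambda>i. \<alpha> i - Poly_Mapping.lookup m i) x) \<and>
      (c \<noteq> 0 \<longleftrightarrow> (\<forall>i. Poly_Mapping.lookup m i \<le> \<alpha> i))" for m :: "'n \<Rightarrow>\<^sub>0 nat" and \<alpha>
  proof -
    obtain js where "multi_deriv m = iter_deriv js" "\<And>i. count_list js i = Poly_Mapping.lookup m i"
      by (rule multi_deriv_list[of m]) blast
    then show ?thesis using iter_deriv_mon[of js \<alpha>] by simp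
  qed
  define C where "C m \<alpha> = (SOME c. multi_deriv m (mon \<alpha>) = (\<lambda>x. c * mon (\<lambda>i. \<alpha> i - Poly_Mapping.lookup m i) x) \<and>
      (c \<noteq> 0 \<longleftrightarrow> (\<forall>i. Poly_Mapping.lookup m i \<le> \<alpha> i)))" for m :: "'n \<Rightarrow>\<^sub>0 nat" and \<alpha>
  have C: "multi_deriv m (mon \<alpha>) = (\<lambda>x. C m \<alpha> * mon (\<lambda>i. \<alpha> i - Poly_Mapping.lookup m i) x)"
    "C m \<alpha> \<noteq> 0 \<longleftrightarrow> (\<forall>i. Poly_Mapping.lookup m i \<le> \<alpha> i)" for m \<alpha>
    using someI_ex[OF md[of m \<alpha>], folded C_def] by blast+
  have LC: "L (multi_deriv m (mon \<alpha>)) = C m \<alpha> * L (mon (\<lambda>i. \<alpha> i - Poly_Mapping.lookup m i))" for m \<alpha>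
    unfolding C(1) by (rule cmult[OF polyfun_mon])
  have Lmon: "L (mon \<alpha>) = 0" for \<alpha>
  proof (induction "\<Sum>i\<in>UNIV. w i * \<alpha> i" arbitrary: \<alpha> rule: less_induct)
    case less
    define \<alpha>' where "\<alpha>' = (\<lambda>i. \<alpha> i + Poly_Mapping.lookup \<beta> i)"
    have other: "L (multi_deriv m (mon \<alpha>')) = 0" if m: "m \<in> Poly_Mapping.keys a" "m \<noteq> \<beta>" for m
    proof (cases "C m \<alpha>' = 0")
      case True then show ?thesis by (simp add: LC)
    next
      case False
      \<comment> \<open>A nonzero coefficient means that the truncated subtraction in
        \<open>\<delta>\<close> is exact, so that weights add.\<close>
      then have le: "Poly_Mapping.lookup m i \<le> \<alpha>' i" for i using C(2) by blast
      define \<delta> where "\<delta> = (\<lambda>i. \<alpha>' i - Poly_Mapping.lookup m i)"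
      have "(\<Sum>i\<in>UNIV. w i * \<delta> i) + (\<Sum>i\<in>UNIV. w i * Poly_Mapping.lookup m i)
          = (\<Sum>i\<in>UNIV. w i * \<alpha>' i)"
        unfolding sum.distrib[symmetric] distrib_left[symmetric] \<delta>_def using le by simp
      also have "\<dots> = (\<Sum>i\<in>UNIV. w i * \<alpha> i) + (\<Sum>i\<in>UNIV. w i * Poly_Mapping.lookup \<beta> i)"
        unfolding \<alpha>'_def by (simp only: distrib_left sum.distrib)
      finally have "(\<Sum>i\<in>UNIV. w i * \<delta> i) < (\<Sum>i\<in>UNIV. w i * \<alpha> i)"
        using w[OF m] by linarith
      then have "L (mon \<delta>) = 0" by (rule less)
      then show ?thesis by (simp add: LC \<delta>_def)
    qed
    have "(\<lambda>i. \<alpha>' i - Poly_Mapping.lookup \<beta> i) = \<alpha>" by (simp add: \<alpha>'_def)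
    then have "L (multi_deriv \<beta> (mon \<alpha>')) = C \<beta> \<alpha>' * L (mon \<alpha>)" by (simp only: LC)
    moreover have "C \<beta> \<alpha>' \<noteq> 0" unfolding C(2) by (simp add: \<alpha>'_def)
    moreover have "(\<Sum>m\<in>Poly_Mapping.keys a.
        Poly_Mapping.lookup a m * ((-1) ^ mdeg m * L (multi_deriv m (mon \<alpha>')))) =
        Poly_Mapping.lookup a \<beta> * ((-1) ^ mdeg \<beta> * L (multi_deriv \<beta> (mon \<alpha>')))"
      using \<beta> other by (subst sum.remove[OF _ \<beta>]) auto
    ultimately show ?case using L[of \<alpha>'] \<beta> by (simp add: in_keys_iff)
  qed
  show ?thesis using \<open>polyfun p\<close>
  proof (induction rule: polyfun.induct)
    case (monom c \<alpha>) show ?case unfolding cmult[OF polyfun_mon] Lmon by simp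
  next
    case (add p q) then show ?case using assms(2)[of p q] by simp
  qed
qed

section \<open>Cutoff functions\<close>

text \<open>The functions \<open>t^(-k) * exp (-1/t)\<close>, extended by 0. Up to linear
  combinations the whole family is closed under differentiation, which \<open>exp (-1/t)\<close>
  alone is not.\<close>

definition flat :: "nat \<Rightarrow> real \<Rightarrow> real" where
  "flat k t = (if t > 0 then (1 / t) ^ k / exp (1 / t) else 0)"

lemma flat_tendsto_0: "(flat k \<longlongrightarrow> 0) (at 0)"
proof -
  have "((\<lambda>t :: real. (inverse t) ^ k / exp (inverse t)) \<longlongrightarrow> 0) (at_right 0)"
    using filterlim_compose[OF tendsto_power_div_exp_0 filterlim_inverse_at_top_right] .
  then have "(flat k \<longlongrightarrow> 0) (at_right 0)"
    by (rule Lim_transform_eventually)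
      (auto simp: eventually_at_right_field flat_def inverse_eq_divide intro!: exI[of _ 1])
  moreover have "(flat k \<longlongrightarrow> 0) (at_left 0)"
    by (rule Lim_transform_eventually[OF tendsto_const])
      (auto simp: eventually_at_left_field flat_def intro!: exI[of _ "-1"])
  ultimately show ?thesis by (simp add: filterlim_split_at)
qed

lemma flat_deriv: "(flat k has_real_derivative (flat (k + 2) t - real k * flat (k + 1) t)) (at t)"
proof (cases t "0 :: real" rule: linorder_cases)
  case less
  have "((\<lambda>t. 0) has_real_derivative 0) (at t)" by simp
  then have "(flat k has_real_derivative 0) (at t)"
    by (rule has_field_derivative_transform_within_open[of _ _ _ "{..<0}"]) (use less in \<open>auto simp: flat_def\<close>)
  then show ?thesis using less by (simp add: flat_def)
next
  case equal
  have "(flat k has_real_derivative 0) (at 0)"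
    unfolding has_field_derivative_iff
  \<comment> \<open>The difference quotient of \<open>flat k\<close> at 0 is
    \<open>flat (k + 1)\<close>, again a member of the family.\<close>
  proof (rule Lim_transform_eventually[OF flat_tendsto_0[of "k + 1"]])
    show "\<forall>\<^sub>F h in at 0. flat (k + 1) h = (flat k h - flat k 0) / (h - 0)"
      by (auto simp: flat_def intro!: always_eventually)
  qed
  then show ?thesis using equal by (simp add: flat_def)
next
  case greater
  have "((\<lambda>t. (1 / t) ^ k / exp (1 / t)) has_real_derivative
      ((1 / t) ^ (k + 2) / exp (1 / t) - real k * ((1 / t) ^ (k + 1) / exp (1 / t)))) (at t)"
  proof -
    have j: "((\<lambda>u. u ^ k / exp u) has_real_derivative (real k * u ^ (k - 1) - u ^ k) / exp u) (at u)" for u :: real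
      by (auto intro!: derivative_eq_intros simp: field_simps)
    have i: "((\<lambda>t. 1 / t) has_real_derivative (- ((1 / t) * (1 / t)))) (at t)"
      using greater by (auto intro!: derivative_eq_intros)
    have eq: "(real k * u ^ (k - 1) - u ^ k) / exp u * (- (u * u)) =
        u ^ (k + 2) / exp u - real k * (u ^ (k + 1) / exp u)" for u :: real
      by (cases k) (simp_all add: field_simps)
    show ?thesis using DERIV_chain2[OF j i] unfolding eq[of "1 / t"] .
  qed
  then have "(flat k has_real_derivative
      ((1 / t) ^ (k + 2) / exp (1 / t) - real k * ((1 / t) ^ (k + 1) / exp (1 / t)))) (at t)"
    by (rule has_field_derivative_transform_within_open[of _ _ _ "{0<..}"]) (use greater in \<open>auto simp: flat_def\<close>)
  then show ?thesis using greater by (simp add: flat_def)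
qed

lemma smooth_flat:
  fixes i :: "'n::finite"
  shows "smooth (\<lambda>x :: real^'n. of_real (flat k (s * vec_nth x i + c)))"
proof -
  let ?f = "\<lambda>k (x :: real^'n). complex_of_real (flat k (s * vec_nth x i + c))"
  have D: "(?f k has_derivative
      (\<lambda>h. of_real ((flat (k + 2) (s * vec_nth x i + c) - real k * flat (k + 1) (s * vec_nth x i + c))
        * (s * vec_nth h i)))) (at x)" for k x
  proof -
    have "((\<lambda>x :: real^'n. s * vec_nth x i + c) has_derivative (\<lambda>h. s * vec_nth h i + 0)) (at x)"
      by (intro has_derivative_add has_derivative_mult_right has_derivative_const
          bounded_linear_imp_has_derivative bounded_linear_vec_nth)
    then have "((\<lambda>x :: real^'n. s * vec_nth x i + c) has_derivative (\<lambda>h. s * vec_nth h i)) (at x)"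
      by simp
    from has_derivative_compose[OF this flat_deriv[of k, unfolded has_field_derivative_def]]
    have "((\<lambda>x. flat k (s * vec_nth x i + c)) has_derivative
      (\<lambda>h. (flat (k + 2) (s * vec_nth x i + c) - real k * flat (k + 1) (s * vec_nth x i + c)) * (s * vec_nth h i))) (at x)" .
    from bounded_linear.has_derivative[OF bounded_linear_of_real this] show ?thesis .
  qed
  have pd: "partial_deriv j (?f k) =
      (\<lambda>x. (if j = i then of_real s else 0) * (?f (k + 2) x + (- of_nat k) * ?f (k + 1) x))" for j k
    by (rule ext, subst partial_deriv_eq[OF D]) (auto simp: axis_def algebra_simps)
  have "diff_upto m (?f k)" for m k
  proof (induction m arbitrary: k)
    case 0
    then show ?case using D by (auto simp: differentiable_def)
  next
    case (Suc m)
    have c: "diff_upto m (\<lambda>x :: real^'n. d)" for d using smooth_const smooth_iff_diff_upto by blast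
    have "diff_upto m (partial_deriv j (?f k))" for j
      unfolding pd by (intro diff_upto_mult diff_upto_add c Suc.IH)
    then show ?case using D by (auto simp: differentiable_def)
  qed
  then show ?thesis by (simp add: smooth_iff_diff_upto)
qed

text \<open>The quotient of \<open>flat 0 u\<close> by \<open>flat 0 u + flat 0 (1 - u)\<close>,
  where \<open>u\<close> is the affine expression in the statement. One of \<open>u\<close> and
  \<open>1 - u\<close> is positive, so the denominator never vanishes.\<close>

lemma smooth_step_exists:
  fixes i :: "'n::finite"
  assumes "s = 1 \<or> s = -1"
  shows "\<exists>\<sigma> :: real^'n \<Rightarrow> complex. smooth \<sigma> \<and>
    (\<forall>x. (1 \<le> s * vec_nth x i + c \<longrightarrow> \<sigma> x = 1) \<and> (s * vec_nth x i + c \<le> 0 \<longrightarrow> \<sigma> x = 0))"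
proof -
  let ?f = "\<lambda>x :: real^'n. complex_of_real (flat 0 (s * vec_nth x i + c))"
  let ?g = "\<lambda>x :: real^'n. complex_of_real (flat 0 ((- s) * vec_nth x i + (1 - c)))"
  have "flat 0 u + flat 0 v \<noteq> 0" if "u + v = 1" for u v
  proof -
    have "0 < u \<or> 0 < v" using that by linarith
    moreover have "0 \<le> flat 0 u" "0 \<le> flat 0 v" "0 < u \<Longrightarrow> 0 < flat 0 u" "0 < v \<Longrightarrow> 0 < flat 0 v"
      by (auto simp: flat_def)
    ultimately show ?thesis by fastforce
  qed
  then have nz: "?f x + ?g x \<noteq> 0" for x
    by (metis (no_types, lifting) add.assoc add_diff_cancel_left' diff_add_cancel mult_minus_left
        of_real_0 of_real_add of_real_eq_iff uminus_add_conv_diff add.commute)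
  let ?\<sigma> = "\<lambda>x. ?f x * inverse (?f x + ?g x)"
  have "smooth ?\<sigma>" by (intro smooth_mult smooth_inverse smooth_add smooth_flat nz)
  moreover have "?\<sigma> x = 1" if "1 \<le> s * vec_nth x i + c" for x
  proof -
    have "?g x = 0" using that by (simp add: flat_def)
    then show ?thesis using nz[of x] by simp
  qed
  moreover have "?\<sigma> x = 0" if "s * vec_nth x i + c \<le> 0" for x
    using that by (simp add: flat_def)
  ultimately show ?thesis by blast
qed

lemma cutoff_exists:
  "\<exists>\<chi> :: real^'n::finite \<Rightarrow> complex. smooth \<chi> \<and> (\<forall>x\<in>cube R. \<chi> x = 1) \<and> (\<forall>x. x \<notin> cube (R + 1) \<longrightarrow> \<chi> x = 0)"
proof -
  have "\<exists>\<sigma> :: real^'n \<Rightarrow> complex. smooth \<sigma> \<and> (\<forall>x. \<bar>vec_nth x i\<bar> \<le> R \<longrightarrow> \<sigma> x = 1) \<and>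
      (\<forall>x. R + 1 \<le> \<bar>vec_nth x i\<bar> \<longrightarrow> \<sigma> x = 0)" for i
  proof -
    \<comment> \<open>With the offset \<open>R + 1\<close>, \<open>\<sigma>\<close> passes from 0 to
      1 while the coordinate runs from \<open>- (R + 1)\<close> to \<open>- R\<close>;
      \<open>\<tau>\<close> is its mirror image.\<close>
    obtain \<sigma> :: "real^'n \<Rightarrow> complex" where \<sigma>: "smooth \<sigma>"
      "\<forall>x. (1 \<le> 1 * vec_nth x i + (R + 1) \<longrightarrow> \<sigma> x = 1) \<and> (1 * vec_nth x i + (R + 1) \<le> 0 \<longrightarrow> \<sigma> x = 0)"
      using smooth_step_exists[of 1 i "R + 1"] by auto
    obtain \<tau> :: "real^'n \<Rightarrow> complex" where \<tau>: "smooth \<tau>"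
      "\<forall>x. (1 \<le> (-1) * vec_nth x i + (R + 1) \<longrightarrow> \<tau> x = 1) \<and> ((-1) * vec_nth x i + (R + 1) \<le> 0 \<longrightarrow> \<tau> x = 0)"
      using smooth_step_exists[of "-1" i "R + 1"] by auto
    show ?thesis
    proof (intro exI conjI allI impI)
      show "smooth (\<lambda>x. \<sigma> x * \<tau> x)" by (intro smooth_mult \<sigma> \<tau>)
    next
      fix x :: "real^'n" assume "\<bar>vec_nth x i\<bar> \<le> R"
      then have "\<sigma> x = 1" "\<tau> x = 1" using spec[OF \<sigma>(2), of x] spec[OF \<tau>(2), of x] by (auto simp: abs_le_iff)
      then show "\<sigma> x * \<tau> x = 1" by simp
    next
      fix x :: "real^'n" assume "R + 1 \<le> \<bar>vec_nth x i\<bar>"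
      then have "\<sigma> x = 0 \<or> \<tau> x = 0" using spec[OF \<sigma>(2), of x] spec[OF \<tau>(2), of x] by (auto simp: abs_if split: if_splits)
      then show "\<sigma> x * \<tau> x = 0" by auto
    qed
  qed
  then obtain \<sigma> :: "'n \<Rightarrow> real^'n \<Rightarrow> complex" where \<sigma>: "\<And>i. smooth (\<sigma> i)"
    "\<And>i x. \<bar>vec_nth x i\<bar> \<le> R \<Longrightarrow> \<sigma> i x = 1" "\<And>i x. R + 1 \<le> \<bar>vec_nth x i\<bar> \<Longrightarrow> \<sigma> i x = 0"
    by metis
  let ?\<chi> = "\<lambda>x. \<Prod>i\<in>UNIV. \<sigma> i x"
  have "smooth ?\<chi>" by (intro smooth_prod \<sigma>)
  moreover have "?\<chi> x = 1" if "x \<in> cube R" for x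
    using that \<sigma>(2) by (simp add: cube_def)
  moreover have "?\<chi> x = 0" if x: "x \<notin> cube (R + 1)" for x
  proof -
    obtain i where "\<not> \<bar>vec_nth x i\<bar> \<le> R + 1" using x by (auto simp: cube_def)
    then have "\<sigma> i x = 0" by (intro \<sigma>(3)) simp
    then show ?thesis by (auto intro: prod_zero)
  qed
  ultimately show ?thesis by blast
qed

section \<open>Leibniz estimates for multiplication by a cutoff\<close>

lemma iter_deriv_zero: "iter_deriv js (\<lambda>x. 0) = (\<lambda>x. 0)"
  by (induction js) auto

lemma iter_deriv_vanishes:
  assumes "closed K" "smooth f" "\<And>x. x \<notin> K \<Longrightarrow> f x = 0" "x \<notin> K"
  shows "iter_deriv js f x = 0"
  by (rule iter_deriv_local[of "- K" f "\<lambda>x. 0" x js, unfolded iter_deriv_zero])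
    (use assms in auto)

text \<open>A coarse form of the Leibniz rule: the constant is independent of \<open>e\<close>, and
  bounds for \<open>e\<close> on \<open>K\<close> suffice because the product vanishes off
  \<open>K\<close>. The induction splits off the innermost derivative; the product rule then asks
  for the statement about \<open>partial_deriv i \<chi>\<close> too, which again vanishes off
  \<open>K\<close>.\<close>

lemma iter_deriv_mult_bound:
  fixes \<chi> :: "real^'n::finite \<Rightarrow> complex"
  assumes "compact K"
  shows "smooth \<chi> \<Longrightarrow> (\<And>x. x \<notin> K \<Longrightarrow> \<chi> x = 0) \<Longrightarrow>
    \<exists>C\<ge>0. \<forall>e \<delta>. smooth e \<longrightarrow> 0 \<le> \<delta> \<longrightarrow>
      (\<forall>js x. length js \<le> N \<longrightarrow> x \<in> K \<longrightarrow> cmod (iter_deriv js e x) \<le> \<delta>) \<longrightarrow>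
      (\<forall>js x. length js \<le> N \<longrightarrow> cmod (iter_deriv js (\<lambda>x. \<chi> x * e x) x) \<le> C * \<delta>)"
proof (induction N arbitrary: \<chi>)
  case 0
  have "bounded (\<chi> ` K)"
    using compact_continuous_image[OF smooth_continuous_on[OF 0(1)] assms] compact_imp_bounded by blast
  then obtain B where B: "\<And>x. x \<in> K \<Longrightarrow> cmod (\<chi> x) \<le> B" by (auto simp: bounded_iff)
  have "cmod (\<chi> x * e x) \<le> \<bar>B\<bar> * \<delta>" if e: "0 \<le> \<delta>" "\<And>x. x \<in> K \<Longrightarrow> cmod (e x) \<le> \<delta>" for e \<delta> x
  proof (cases "x \<in> K")
    case True
    then have "cmod (\<chi> x) \<le> \<bar>B\<bar>" using B[OF True] by linarith
    then show ?thesis using e(2)[OF True] by (simp add: norm_mult mult_mono)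
  next
    case False then show ?thesis using 0(2) e(1) by simp
  qed
  then show ?case by (intro exI[of _ "\<bar>B\<bar>"]) auto
next
  case (Suc N)
  obtain C0 where C0: "C0 \<ge> 0" "\<And>e \<delta> js x. smooth e \<Longrightarrow> 0 \<le> \<delta> \<Longrightarrow>
      (\<And>js x. length js \<le> N \<Longrightarrow> x \<in> K \<Longrightarrow> cmod (iter_deriv js e x) \<le> \<delta>) \<Longrightarrow>
      length js \<le> N \<Longrightarrow> cmod (iter_deriv js (\<lambda>x. \<chi> x * e x) x) \<le> C0 * \<delta>"
    using Suc.IH[OF Suc.prems] by meson
  have "\<exists>C\<ge>0. \<forall>e \<delta>. smooth e \<longrightarrow> 0 \<le> \<delta> \<longrightarrow>
      (\<forall>js x. length js \<le> N \<longrightarrow> x \<in> K \<longrightarrow> cmod (iter_deriv js e x) \<le> \<delta>) \<longrightarrow>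
      (\<forall>js x. length js \<le> N \<longrightarrow> cmod (iter_deriv js (\<lambda>x. partial_deriv i \<chi> x * e x) x) \<le> C * \<delta>)" for i
  proof (rule Suc.IH)
    show "smooth (partial_deriv i \<chi>)" using Suc.prems(1) by (rule smooth_partial_deriv)
    show "partial_deriv i \<chi> x = 0" if "x \<notin> K" for x
      using iter_deriv_vanishes[OF compact_imp_closed[OF assms] Suc.prems(1,2) that, of "[i]"] by simp
  qed
  then obtain C where C: "\<And>i. C i \<ge> 0" "\<And>i e \<delta> js x. smooth e \<Longrightarrow> 0 \<le> \<delta> \<Longrightarrow>
      (\<And>js x. length js \<le> N \<Longrightarrow> x \<in> K \<Longrightarrow> cmod (iter_deriv js e x) \<le> \<delta>) \<Longrightarrow>
      length js \<le> N \<Longrightarrow> cmod (iter_deriv js (\<lambda>x. partial_deriv i \<chi> x * e x) x) \<le> C i * \<delta>"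
    by metis
  \<comment> \<open>The innermost derivative may have any direction, so the constants of all
    directions are added up.\<close>
  define D where "D = C0 + (\<Sum>i\<in>UNIV. C i)"
  have Ci: "C i \<le> (\<Sum>i\<in>UNIV. C i)" for i using C(1) by (intro member_le_sum) auto
  have "cmod (iter_deriv js (\<lambda>x. \<chi> x * e x) x) \<le> D * \<delta>"
    if e: "smooth e" "0 \<le> \<delta>" "\<And>js x. length js \<le> Suc N \<Longrightarrow> x \<in> K \<Longrightarrow> cmod (iter_deriv js e x) \<le> \<delta>"
      and js: "length js \<le> Suc N" for e \<delta> js x
  proof (cases js rule: rev_cases)
    case Nil
    have "cmod (iter_deriv [] (\<lambda>x. \<chi> x * e x) x) \<le> C0 * \<delta>"
      by (rule C0(2)) (use e in auto)
    also have "\<dots> \<le> D * \<delta>" using e(2) C(1) by (intro mult_right_mono) (auto simp: D_def sum_nonneg)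
    finally show ?thesis using Nil by simp
  next
    case (snoc ks i)
    then have ks: "length ks \<le> N" using js by simp
    have "partial_deriv i (\<lambda>x. \<chi> x * e x) = (\<lambda>x. partial_deriv i \<chi> x * e x + \<chi> x * partial_deriv i e x)"
      by (intro partial_deriv_mult smooth_differentiable Suc.prems e)
    then have "iter_deriv js (\<lambda>x. \<chi> x * e x) =
        iter_deriv ks (\<lambda>x. partial_deriv i \<chi> x * e x + \<chi> x * partial_deriv i e x)"
      by (simp add: snoc)
    also have "\<dots> = (\<lambda>x. iter_deriv ks (\<lambda>x. partial_deriv i \<chi> x * e x) x
        + iter_deriv ks (\<lambda>x. \<chi> x * partial_deriv i e x) x)"
      by (intro iter_deriv_add smooth_mult smooth_partial_deriv Suc.prems(1) e(1))
    finally have eq: "iter_deriv js (\<lambda>x. \<chi> x * e x) x = iter_deriv ks (\<lambda>x. partial_deriv i \<chi> x * e x) x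
        + iter_deriv ks (\<lambda>x. \<chi> x * partial_deriv i e x) x" by simp
    have "cmod (iter_deriv ks (\<lambda>x. partial_deriv i \<chi> x * e x) x) \<le> C i * \<delta>"
      by (rule C(2)) (use e ks in auto)
    moreover have "cmod (iter_deriv ks (\<lambda>x. \<chi> x * partial_deriv i e x) x) \<le> C0 * \<delta>"
    proof (rule C0(2)[OF smooth_partial_deriv[OF e(1)] e(2) _ ks])
      fix js' :: "'n list" and y assume "length js' \<le> N" "y \<in> K"
      then show "cmod (iter_deriv js' (partial_deriv i e) y) \<le> \<delta>"
        using e(3)[of "js' @ [i]" y] by simp
    qed
    ultimately have "cmod (iter_deriv js (\<lambda>x. \<chi> x * e x) x) \<le> C i * \<delta> + C0 * \<delta>"
      unfolding eq by (meson add_mono norm_triangle_le)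
    also have "\<dots> \<le> D * \<delta>"
      using mult_right_mono[OF Ci[of i] e(2)] by (simp add: D_def algebra_simps)
    finally show ?thesis .
  qed
  moreover have "D \<ge> 0" using C0(1) C(1) by (simp add: D_def sum_nonneg)
  ultimately show ?case by blast
qed

section \<open>Compactly supported solutions\<close>

lemma supp_subset: "closed K \<Longrightarrow> (\<And>x. x \<notin> K \<Longrightarrow> f x = 0) \<Longrightarrow> supp f \<subseteq> K"
  unfolding supp_def by (intro closure_minimal) auto

lemma outside_supp: "x \<notin> supp f \<Longrightarrow> f x = 0"
  unfolding supp_def using closure_subset[of "{x. f x \<noteq> 0}"] by auto

lemma test_funI:
  assumes "smooth f" "compact K" "\<And>x. x \<notin> K \<Longrightarrow> f x = 0"
  shows "test_fun f"
proof -
  have "supp f \<subseteq> K" using supp_subset[OF compact_imp_closed[OF assms(2)] assms(3)] .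
  then have "K \<inter> supp f = supp f" by blast
  moreover have "compact (K \<inter> supp f)"
    using assms(2) by (rule compact_Int_closed) (simp add: supp_def)
  ultimately show ?thesis using assms(1) by (simp add: test_fun_def)
qed

text \<open>The complement of an open cube. Being closed, it can contain the support of a test
  function and equals its closure in the definition of controllability.\<close>

definition outer :: "real \<Rightarrow> (real^'n::finite) set" where
  "outer R = {x. \<exists>i. R \<le> \<bar>vec_nth x i\<bar>}"

lemma open_inner: "open (- outer R :: (real^'n::finite) set)"
proof -
  have "(- outer R :: (real^'n) set) = (\<Inter>i\<in>UNIV. {x :: real^'n. \<bar>vec_nth x i\<bar> < R})"
    unfolding outer_def by (rule Set.set_eqI) (simp add: not_le)
  also have "open \<dots>"
    by (intro open_INT finite ballI open_Collect_less continuous_intros)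
  finally show ?thesis .
qed

lemma closed_outer: "closed (outer R)"
  using open_inner by (simp add: closed_def)

text \<open>\<open>L\<close> extends \<open>T\<close>, which lives on the cube, to functions without
  compact support. It kills all polynomials by \<open>polyfun_functional_zero\<close>, so
  \<open>T \<phi>\<close> is unchanged when a polynomial is subtracted from \<open>\<phi>\<close>
  under the cutoff; approximating \<open>\<phi>\<close> up to the order \<open>N\<close> of
  \<open>T\<close> on \<open>?K\<close> makes the value arbitrarily small.\<close>

lemma distribution_compact_support_zero:
  fixes T :: "(real^'n::finite \<Rightarrow> complex) \<Rightarrow> complex"
  assumes T: "distribution T" and a: "a \<noteq> 0" "distr_apply a T = 0" and R: "0 < R"
    and outer: "\<And>\<phi>. test_fun \<phi> \<Longrightarrow> supp \<phi> \<subseteq> outer R \<Longrightarrow> T \<phi> = 0"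
    and \<phi>: "test_fun \<phi>"
  shows "T \<phi> = 0"
proof -
  have T_add: "\<And>\<phi> \<psi>. test_fun \<phi> \<Longrightarrow> test_fun \<psi> \<Longrightarrow> T (\<lambda>x. \<phi> x + \<psi> x) = T \<phi> + T \<psi>"
    and T_cmult: "\<And>c \<phi>. test_fun \<phi> \<Longrightarrow> T (\<lambda>x. c * \<phi> x) = c * T \<phi>"
    and T_bound: "\<And>K. compact K \<Longrightarrow> \<exists>C N. \<forall>\<phi>. test_fun \<phi> \<longrightarrow> supp \<phi> \<subseteq> K \<longrightarrow>
           cmod (T \<phi>) \<le> C * (\<Sum>m | mdeg m \<le> N. SUP x. cmod (multi_deriv m \<phi> x))"
    using T unfolding distribution_def by auto
  obtain \<chi> :: "real^'n \<Rightarrow> complex" where \<chi>: "smooth \<chi>" "\<And>x. x \<in> cube R \<Longrightarrow> \<chi> x = 1"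
    "\<And>x. x \<notin> cube (R + 1) \<Longrightarrow> \<chi> x = 0"
    using cutoff_exists[of R] by blast
  let ?K = "cube (R + 1) :: (real^'n) set"
  have test: "test_fun (\<lambda>x. \<chi> x * p x)" if "smooth p" for p
    by (rule test_funI[OF smooth_mult[OF \<chi>(1) that] compact_cube[of "R + 1"]]) (simp add: \<chi>(3))
  have suppK: "supp (\<lambda>x. \<chi> x * p x) \<subseteq> ?K" for p
    by (rule supp_subset[OF closed_cube]) (simp add: \<chi>(3))
  have inner: "x \<in> cube R" if "x \<notin> outer R" for x :: "real^'n"
    using that by (auto simp: outer_def cube_def not_le less_imp_le)
  \<comment> \<open>\<open>T\<close> sees a test function only through its values in the open cube
    \<open>- outer R\<close>.\<close>
  have T_eq: "T f = T g" if fg: "test_fun f" "test_fun g" "\<And>x. x \<notin> outer R \<Longrightarrow> f x = g x" for f g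
  proof -
    have sm: "smooth f" "smooth g" and c: "compact (supp f)" "compact (supp g)"
      using fg by (auto simp: test_fun_def)
    have t: "test_fun (\<lambda>x. f x - g x)"
      by (rule test_funI[OF smooth_diff[OF sm] compact_Un[OF c]]) (simp add: outside_supp)
    have "supp (\<lambda>x. f x - g x) \<subseteq> outer R"
      by (rule supp_subset[OF closed_outer]) (simp add: fg(3))
    with t have "T (\<lambda>x. f x - g x) = 0" by (rule outer)
    then show ?thesis using T_add[OF t fg(2)] by simp
  qed
  define L where "L p = T (\<lambda>x. \<chi> x * p x)" for p
  have L_add: "L (\<lambda>x. p x + q x) = L p + L q" if "smooth p" "smooth q" for p q
    unfolding L_def using T_add[OF test[OF that(1)] test[OF that(2)]] by (simp add: distrib_left)
  have L_cmult: "L (\<lambda>x. c * p x) = c * L p" if "smooth p" for c p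
    unfolding L_def using T_cmult[OF test[OF that], of c] by (simp add: mult.left_commute)
  \<comment> \<open>On the open cube \<open>\<chi>\<close> is 1, so derivatives of
    \<open>\<chi>\<close> arise only where \<open>T\<close> vanishes, and differentiation may be
    carried out before or after the cutoff.\<close>
  have L_deriv: "L (multi_deriv m q) = T (multi_deriv m (\<lambda>x. \<chi> x * q x))" if q: "smooth q" for m q
  proof -
    obtain js where js: "multi_deriv m = iter_deriv js" by (rule multi_deriv_list[of m]) blast
    show ?thesis unfolding L_def js
    proof (rule T_eq)
      show "test_fun (\<lambda>x. \<chi> x * iter_deriv js q x)" by (rule test[OF smooth_iter_deriv[OF q]])
      show "test_fun (iter_deriv js (\<lambda>x. \<chi> x * q x))"
      proof (rule test_funI[OF smooth_iter_deriv[OF smooth_mult[OF \<chi>(1) q]] compact_cube[of "R + 1"]])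
        show "iter_deriv js (\<lambda>x. \<chi> x * q x) x = 0" if "x \<notin> ?K" for x
          by (rule iter_deriv_vanishes[OF closed_cube smooth_mult[OF \<chi>(1) q] _ that])
            (simp add: \<chi>(3))
      qed
      fix x :: "real^'n" assume x: "x \<notin> outer R"
      have "iter_deriv js (\<lambda>x. \<chi> x * q x) x = iter_deriv js q x"
        by (rule iter_deriv_local[OF open_inner smooth_mult[OF \<chi>(1) q]]) (use x inner \<chi>(2) in auto)
      then show "\<chi> x * iter_deriv js q x = iter_deriv js (\<lambda>x. \<chi> x * q x) x"
        using \<chi>(2)[OF inner[OF x]] by simp
    qed
  qed
  have L0: "L p = 0" if "polyfun p" for p
  proof (rule polyfun_functional_zero[OF a(1) _ _ _ that])
    fix \<alpha>
    have "distr_apply a T (\<lambda>x. \<chi> x * mon \<alpha> x) = 0" by (simp add: a(2))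
    then show "(\<Sum>m\<in>Poly_Mapping.keys a.
      Poly_Mapping.lookup a m * ((-1) ^ mdeg m * L (multi_deriv m (mon \<alpha>)))) = 0"
      unfolding L_deriv[OF smooth_mon] distr_apply_def using test[OF smooth_mon] by simp
  next
    fix p q :: "real^'n \<Rightarrow> complex" assume "polyfun p" "polyfun q"
    then show "L (\<lambda>x. p x + q x) = L p + L q" by (intro L_add polyfun_smooth)
  next
    fix c and p :: "real^'n \<Rightarrow> complex" assume "polyfun p"
    then show "L (\<lambda>x. c * p x) = c * L p" by (intro L_cmult polyfun_smooth)
  qed
  have sm\<phi>: "smooth \<phi>" and c\<phi>: "compact (supp \<phi>)" using \<phi> by (auto simp: test_fun_def)
  obtain B where B: "\<And>x. x \<in> supp \<phi> \<Longrightarrow> norm x \<le> B"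
    using compact_imp_bounded[OF c\<phi>] by (auto simp: bounded_iff)
  \<comment> \<open>Two requirements: \<open>cube S\<close> contains \<open>?K\<close>, outside of
    which the cutoff vanishes, and \<open>\<bar>B\<bar> < S\<close>, so that \<open>\<phi>\<close>
    vanishes on the lower faces from which the approximation is integrated.\<close>
  define S where "S = \<bar>B\<bar> + R + 1"
  have S: "\<bar>B\<bar> < S" "R + 1 \<le> S" "0 < S" using R by (auto simp: S_def)
  have \<phi>0: "\<phi> x = 0" if neg: "\<exists>i. vec_nth x i < - \<bar>B\<bar>" for x
  proof (rule outside_supp, rule notI)
    assume "x \<in> supp \<phi>"
    moreover obtain i where "vec_nth x i < - \<bar>B\<bar>" using neg by blast
    ultimately show False using B[of x] component_le_norm_cart[of x i] by linarith
  qed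
  obtain C N where CN: "\<And>\<psi>. test_fun \<psi> \<Longrightarrow> supp \<psi> \<subseteq> ?K \<Longrightarrow>
      cmod (T \<psi>) \<le> C * (\<Sum>m | mdeg m \<le> N. SUP x. cmod (multi_deriv m \<psi> x))"
    using T_bound[OF compact_cube] by blast
  obtain D where D: "D \<ge> 0" "\<And>e \<delta> js x. smooth e \<Longrightarrow> 0 \<le> \<delta> \<Longrightarrow>
      (\<And>js x. length js \<le> N \<Longrightarrow> x \<in> ?K \<Longrightarrow> cmod (iter_deriv js e x) \<le> \<delta>) \<Longrightarrow>
      length js \<le> N \<Longrightarrow> cmod (iter_deriv js (\<lambda>x. \<chi> x * e x) x) \<le> D * \<delta>"
    using iter_deriv_mult_bound[where K = ?K and N = N, OF compact_cube \<chi>(1) \<chi>(3)] by meson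
  \<comment> \<open>Every list of length at most \<open>N\<close> is, as a multiset, contained in a
    list with \<open>N\<close> copies of each direction.\<close>
  obtain js :: "'n list" where js: "\<And>i. count_list js i = N" using list_with_counts[of "\<lambda>i. N"] by blast
  \<comment> \<open>The factor in front of the approximation error, chosen before that error;
    \<open>\<bar>C\<bar>\<close> because the continuity estimate leaves the sign of \<open>C\<close>
    open.\<close>
  define M where "M = \<bar>C\<bar> * (real (card {m :: 'n \<Rightarrow>\<^sub>0 nat. mdeg m \<le> N}) * D)"
  have M: "M \<ge> 0" using D(1) by (simp add: M_def)
  have bound: "cmod (T \<phi>) \<le> M * \<delta>" if \<delta>: "\<delta> > 0" for \<delta>
  proof -
    obtain p where p: "polyfun p" "\<And>ks x. mset ks \<subseteq># mset js \<Longrightarrow> x \<in> cube S \<Longrightarrow>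
        cmod (iter_deriv ks (\<lambda>x. \<phi> x - p x) x) \<le> \<delta>"
      using polyfun_approx_smooth[OF sm\<phi> \<phi>0 S(1,3) \<delta>, of js] by blast
    define e where "e = (\<lambda>x. \<phi> x - p x)"
    have sme: "smooth e" unfolding e_def by (intro smooth_diff sm\<phi> polyfun_smooth p)
    have e: "cmod (iter_deriv ks e x) \<le> \<delta>" if ks: "length ks \<le> N" and x: "x \<in> ?K" for ks x
    proof -
      have "count_list ks i \<le> count_list js i" for i
        using count_le_length[of ks i] ks js[of i] by simp
      then have "mset ks \<subseteq># mset js" by (simp add: subseteq_mset_def count_mset)
      moreover have "x \<in> cube S" using x S(2) by (auto simp: cube_def intro: order_trans)
      ultimately show ?thesis unfolding e_def by (rule p(2))
    qed
    have "T \<phi> = T (\<lambda>x. \<chi> x * \<phi> x)"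
      by (rule T_eq[OF \<phi> test[OF sm\<phi>]]) (simp add: \<chi>(2) inner)
    also have "(\<lambda>x. \<chi> x * \<phi> x) = (\<lambda>x. \<chi> x * (e x + p x))" by (simp add: e_def)
    also have "T \<dots> = L e + L p"
      using L_add[OF sme polyfun_smooth[OF p(1)]] by (simp only: L_def)
    finally have T\<phi>: "T \<phi> = T (\<lambda>x. \<chi> x * e x)" using L0[OF p(1)] by (simp add: L_def)
    have "(SUP x. cmod (multi_deriv m (\<lambda>x. \<chi> x * e x) x)) \<le> D * \<delta>" if m: "mdeg m \<le> N" for m
    proof (rule cSUP_least)
      fix x
      obtain ks where ks: "multi_deriv m = iter_deriv ks" "length ks = mdeg m"
        by (rule multi_deriv_list[of m]) blast
      show "cmod (multi_deriv m (\<lambda>x. \<chi> x * e x) x) \<le> D * \<delta>"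
        unfolding ks(1) by (rule D(2)[OF sme]) (use \<delta> e m ks in auto)
    qed simp
    then have s: "(\<Sum>m | mdeg m \<le> N. SUP x. cmod (multi_deriv m (\<lambda>x. \<chi> x * e x) x))
        \<le> real (card {m :: 'n \<Rightarrow>\<^sub>0 nat. mdeg m \<le> N}) * (D * \<delta>)"
      by (intro sum_bounded_above) auto
    have s0: "0 \<le> (\<Sum>m | mdeg m \<le> N. SUP x. cmod (multi_deriv m (\<lambda>x. \<chi> x * e x) x))"
    proof (rule sum_nonneg)
      fix m :: "'n \<Rightarrow>\<^sub>0 nat" assume m: "m \<in> {m. mdeg m \<le> N}"
      obtain ks where ks: "multi_deriv m = iter_deriv ks" "length ks = mdeg m"
        by (rule multi_deriv_list[of m]) blast
      \<comment> \<open>A real \<open>SUP\<close> is meaningful only for bounded sets, so its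
        nonnegativity first requires an upper bound.\<close>
      have "bdd_above (range (\<lambda>x. cmod (multi_deriv m (\<lambda>x. \<chi> x * e x) x)))"
        unfolding ks(1) by (rule bdd_aboveI2, rule D(2)[OF sme, of \<delta>]) (use \<delta> e m ks in auto)
      then have "cmod (multi_deriv m (\<lambda>x. \<chi> x * e x) 0) \<le> (SUP x. cmod (multi_deriv m (\<lambda>x. \<chi> x * e x) x))"
        by (rule cSUP_upper[OF UNIV_I])
      then show "0 \<le> (SUP x. cmod (multi_deriv m (\<lambda>x. \<chi> x * e x) x))"
        by (rule order_trans[OF norm_ge_zero])
    qed
    have "cmod (T \<phi>) \<le> C * (\<Sum>m | mdeg m \<le> N. SUP x. cmod (multi_deriv m (\<lambda>x. \<chi> x * e x) x))"
      unfolding T\<phi> by (rule CN[OF test[OF sme] suppK])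
    also have "\<dots> \<le> \<bar>C\<bar> * (\<Sum>m | mdeg m \<le> N. SUP x. cmod (multi_deriv m (\<lambda>x. \<chi> x * e x) x))"
      using s0 by (intro mult_right_mono) auto
    also have "\<dots> \<le> \<bar>C\<bar> * (real (card {m :: 'n \<Rightarrow>\<^sub>0 nat. mdeg m \<le> N}) * (D * \<delta>))"
      using s by (intro mult_left_mono) auto
    also have "\<dots> = M * \<delta>" by (simp add: M_def)
    finally show ?thesis .
  qed
  have "cmod (T \<phi>) \<le> 0"
  proof (rule field_le_epsilon)
    fix \<eta> :: real assume \<eta>: "0 < \<eta>"
    have "cmod (T \<phi>) \<le> M * (\<eta> / (M + 1))" using \<eta> M by (intro bound) auto
    also have "\<dots> \<le> \<eta>" using \<eta> M by (simp add: field_simps)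
    finally show "cmod (T \<phi>) \<le> 0 + \<eta>" by simp
  qed
  then show ?thesis by simp
qed

section \<open>Integration by parts and vanishing moments on cubes\<close>

definition Icube :: "real \<Rightarrow> (real^'n::finite \<Rightarrow> complex) \<Rightarrow> complex" where
  "Icube S f = integral (cube S) f"

lemma smooth_integrable_cube: "smooth f \<Longrightarrow> f integrable_on cube S"
  unfolding cube_cbox by (intro integrable_continuous smooth_continuous_on)

text \<open>The shifted function still vanishes off \<open>cube S\<close>, so both sides are
  integrals over the whole space.\<close>

lemma Icube_translate:
  assumes v: "smooth v" "\<And>x. x \<notin> cube R \<Longrightarrow> v x = 0" and t: "\<bar>t\<bar> \<le> S - R"
  shows "Icube S (\<lambda>x. v (x + t *\<^sub>R axis i 1)) = Icube S v"
proof -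
  let ?e = "t *\<^sub>R axis i 1 :: real^'a"
  have c: "continuous_on A (\<lambda>x. v (x + ?e))" for A
    by (rule continuous_on_compose2[OF smooth_continuous_on[OF v(1), of UNIV]]) (auto intro!: continuous_intros)
  have "\<bar>vec_nth x j\<bar> \<le> S" if "\<bar>vec_nth (x + ?e) j\<bar> \<le> R" for x :: "real^'a" and j
    using that t by (cases "j = i") (auto simp: axis_def abs_le_iff)
  then have out: "v (x + ?e) = 0" if "x \<notin> cube S" for x
    using that by (intro v(2)) (auto simp: cube_def)
  have "R \<le> S" using t by linarith
  then have sub: "(cube R :: (real^'a) set) \<subseteq> cube S" by (auto simp: cube_def intro: order_trans)
  have "(v has_integral Icube S v) (cube S)"
    unfolding Icube_def by (intro integrable_integral smooth_integrable_cube v)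
  from has_integral_affinity[OF this[unfolded cube_cbox], of 1 ?e]
  have "((\<lambda>x. v (x + ?e)) has_integral Icube S v) ((\<lambda>x. x - ?e) ` cube S)"
    by (simp add: cube_cbox)
  then have 1: "((\<lambda>x. v (x + ?e)) has_integral Icube S v) UNIV"
  proof (rule has_integral_on_superset)
    fix x assume "x \<notin> (\<lambda>x. x - ?e) ` cube S"
    then have "x + ?e \<notin> cube S" by (metis add_diff_cancel_right' imageI)
    then show "v (x + ?e) = 0" using v(2) sub by blast
  qed auto
  have "((\<lambda>x. v (x + ?e)) has_integral Icube S (\<lambda>x. v (x + ?e))) (cube S)"
    unfolding Icube_def cube_cbox by (intro integrable_integral integrable_continuous c)
  then have "((\<lambda>x. v (x + ?e)) has_integral Icube S (\<lambda>x. v (x + ?e))) UNIV"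
    by (rule has_integral_on_superset) (auto simp: out)
  from has_integral_unique[OF this 1] show ?thesis .
qed

text \<open>In place of iterated integrals: the integral of a translate of \<open>v\<close> does not
  change with the translation, and differentiating under the integral sign at \<open>t = 0\<close>
  gives the claim. The margin between \<open>R\<close> and \<open>S\<close> provides the interval of
  translations.\<close>

lemma Icube_partial_deriv:
  fixes v :: "real^'n::finite \<Rightarrow> complex"
  assumes v: "smooth v" "\<And>x. x \<notin> cube R \<Longrightarrow> v x = 0" and RS: "R < S"
  shows "Icube S (partial_deriv i v) = 0"
proof -
  define U where "U = {- (S - R)..S - R}"
  let ?f = "\<lambda>t x. v (x + t *\<^sub>R axis i 1)"
  let ?f' = "\<lambda>t x. partial_deriv i v (x + t *\<^sub>R axis i 1)"
  have U: "0 \<in> U" "convex U" using RS by (auto simp: U_def)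
  have "((\<lambda>t. integral (cube S) (?f t)) has_vector_derivative integral (cube S) (?f' 0)) (at 0 within U)"
    unfolding cube_cbox
  proof (rule leibniz_rule_vector_derivative[OF _ _ _ U])
    fix t x
    show "((\<lambda>t. ?f t x) has_vector_derivative ?f' t x) (at t within U)"
      unfolding has_vector_derivative_def
      by (rule has_derivative_at_withinI[OF has_derivative_partial_line[OF smooth_differentiable[OF v(1)]]])
    show "?f t integrable_on cbox (vec_lambda (\<lambda>i. - S)) (vec_lambda (\<lambda>i. S))"
      by (intro integrable_continuous continuous_on_compose2[OF smooth_continuous_on[OF v(1), of UNIV]])
        (auto intro!: continuous_intros)
    show "continuous_on (U \<times> cbox (vec_lambda (\<lambda>i. - S)) (vec_lambda (\<lambda>i. S))) (\<lambda>(t, x). ?f' t x)"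
      unfolding split_beta
      by (intro continuous_on_compose2[OF smooth_continuous_on[OF smooth_partial_deriv[OF v(1)], of UNIV]])
        (auto intro!: continuous_intros)
  qed
  moreover have "((\<lambda>t. integral (cube S) (?f t)) has_vector_derivative 0) (at 0 within U)"
  proof (rule has_vector_derivative_transform[OF U(1) _ has_vector_derivative_const[of "Icube S v"]])
    show "integral (cube S) (?f t) = Icube S v" if "t \<in> U" for t
      using Icube_translate[OF v, where t = t and S = S and i = i] that by (auto simp: Icube_def U_def abs_le_iff)
  qed
  moreover have "at 0 within U \<noteq> bot"
    using RS by (simp add: U_def at_within_Icc_at trivial_limit_at)
  ultimately have "integral (cube S) (?f' 0) = 0" using vector_derivative_unique_within by blast
  then show ?thesis by (simp add: Icube_def)
qed

lemma Icube_add: "smooth f \<Longrightarrow> smooth g \<Longrightarrow> Icube S (\<lambda>x. f x + g x) = Icube S f + Icube S g"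
  unfolding Icube_def by (intro integral_add smooth_integrable_cube)

lemma Icube_cmult: "Icube S (\<lambda>x. c * f x) = c * Icube S f"
  unfolding Icube_def by simp

lemma Icube_by_parts:
  assumes f: "smooth f" "\<And>x. x \<notin> cube R \<Longrightarrow> f x = 0" and q: "smooth q" and "R < S"
  shows "Icube S (\<lambda>x. partial_deriv i f x * q x) = - Icube S (\<lambda>x. f x * partial_deriv i q x)"
proof -
  have "Icube S (partial_deriv i (\<lambda>x. f x * q x)) = 0"
    by (rule Icube_partial_deriv[OF smooth_mult[OF f(1) q] _ \<open>R < S\<close>]) (simp add: f(2))
  also have "partial_deriv i (\<lambda>x. f x * q x) = (\<lambda>x. partial_deriv i f x * q x + f x * partial_deriv i q x)"
    by (intro partial_deriv_mult smooth_differentiable f q)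
  also have "Icube S \<dots> = Icube S (\<lambda>x. partial_deriv i f x * q x) + Icube S (\<lambda>x. f x * partial_deriv i q x)"
    by (intro Icube_add smooth_mult smooth_partial_deriv f(1) q)
  finally show ?thesis by (simp add: eq_neg_iff_add_eq_0)
qed

lemma Icube_by_parts_iter:
  assumes f: "smooth f" "\<And>x. x \<notin> cube R \<Longrightarrow> f x = 0" and q: "smooth q" and RS: "R < S"
  shows "Icube S (\<lambda>x. iter_deriv js f x * q x) = (-1) ^ length js * Icube S (\<lambda>x. f x * iter_deriv js q x)"
  using q
proof (induction js arbitrary: q)
  case (Cons j js)
  have "Icube S (\<lambda>x. iter_deriv (j # js) f x * q x) = - Icube S (\<lambda>x. iter_deriv js f x * partial_deriv j q x)"
    by (simp, rule Icube_by_parts[OF smooth_iter_deriv[OF f(1)] _ Cons.prems RS])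
      (rule iter_deriv_vanishes[OF closed_cube f])
  also have "\<dots> = - ((-1) ^ length js * Icube S (\<lambda>x. f x * iter_deriv js (partial_deriv j q) x))"
    by (subst Cons.IH[OF smooth_partial_deriv[OF Cons.prems]]) simp
  finally show ?case by (simp add: iter_deriv_commute[OF Cons.prems])
qed simp

text \<open>On the cube \<open>cnj f\<close> is a uniform limit of polynomials, so the integral of
  \<open>f * cnj f\<close> vanishes too; a continuous nonnegative function with integral 0 is
  0.\<close>

lemma smooth_zero_of_moments:
  fixes f :: "real^'n::finite \<Rightarrow> complex"
  assumes f: "smooth f" and S: "0 < S" and mom: "\<And>p. polyfun p \<Longrightarrow> Icube S (\<lambda>x. f x * p x) = 0"
    and x: "x \<in> cube S"
  shows "f x = 0"
proof -
  let ?c = "measure lborel (cube S :: (real^'n) set)"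
  have cf: "continuous_on A f" for A by (rule smooth_continuous_on[OF f])
  have ccf: "continuous_on A (\<lambda>x. cnj (f x))" for A by (intro continuous_on_cnj cf)
  have "bounded (f ` cube S)"
    using compact_continuous_image[OF cf compact_cube] compact_imp_bounded by blast
  then obtain B where B: "\<And>x. x \<in> cube S \<Longrightarrow> cmod (f x) \<le> B" by (auto simp: bounded_iff)
  have "0 \<in> (cube S :: (real^'n) set)" using S by (simp add: cube_def)
  then have B0: "0 \<le> B" using B norm_ge_zero order_trans by blast
  have bound: "cmod (Icube S (\<lambda>x. f x * cnj (f x))) \<le> B * \<epsilon> * ?c" if "\<epsilon> > 0" for \<epsilon>
  proof -
    obtain p where p: "polyfun p" "\<forall>x\<in>cube S. cmod (cnj (f x) - p x) < \<epsilon>"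
      using polyfun_dense[OF compact_cube ccf \<open>\<epsilon> > 0\<close>] by blast
    note cp = smooth_continuous_on[OF polyfun_smooth[OF p(1)]]
    have "Icube S (\<lambda>x. f x * cnj (f x)) = Icube S (\<lambda>x. f x * cnj (f x)) - Icube S (\<lambda>x. f x * p x)"
      by (simp add: mom[OF p(1)])
    also have "\<dots> = integral (cube S) (\<lambda>x. f x * cnj (f x) - f x * p x)"
      unfolding Icube_def cube_cbox
      by (intro integral_diff[symmetric] integrable_continuous continuous_intros cf ccf cp)
    also have "cmod \<dots> \<le> B * \<epsilon> * ?c"
      unfolding cube_cbox
    proof (rule integrable_bound)
      show "0 \<le> B * \<epsilon>" using B0 that by simp
      show "(\<lambda>x. f x * cnj (f x) - f x * p x) integrable_on cbox (vec_lambda (\<lambda>i. - S)) (vec_lambda (\<lambda>i. S))"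
        by (intro integrable_continuous continuous_intros cf ccf cp)
      fix x :: "real^'n" assume "x \<in> cbox (vec_lambda (\<lambda>i. - S)) (vec_lambda (\<lambda>i. S))"
      then have x: "x \<in> cube S" by (simp add: cube_cbox)
      have "cmod (f x) * cmod (cnj (f x) - p x) \<le> B * \<epsilon>"
        using B[OF x] bspec[OF p(2) x] B0 by (intro mult_mono) auto
      then show "cmod (f x * cnj (f x) - f x * p x) \<le> B * \<epsilon>"
        by (simp add: norm_mult[symmetric] algebra_simps)
    qed
    finally show ?thesis .
  qed
  have c0: "0 \<le> B * ?c" using B0 by simp
  have "cmod (Icube S (\<lambda>x. f x * cnj (f x))) \<le> 0"
  proof (rule field_le_epsilon)
    fix \<eta> :: real assume \<eta>: "0 < \<eta>"
    \<comment> \<open>The summand 1 keeps the denominator positive even if \<open>B * ?c\<close> is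
      0.\<close>
    have "cmod (Icube S (\<lambda>x. f x * cnj (f x))) \<le> B * (\<eta> / (B * ?c + 1)) * ?c"
      using \<eta> c0 by (intro bound) auto
    also have "\<dots> = (B * ?c) * (\<eta> / (B * ?c + 1))" by simp
    also have "\<dots> \<le> \<eta>" using \<eta> c0 by (simp add: divide_simps mult_left_mono)
    finally show "cmod (Icube S (\<lambda>x. f x * cnj (f x))) \<le> 0 + \<eta>" by simp
  qed
  then have "integral (cube S) (\<lambda>x. f x * cnj (f x)) = 0" by (simp add: Icube_def)
  moreover have "f x * cnj (f x) = complex_of_real ((cmod (f x))\<^sup>2)" for x
    by (rule complex_norm_square[symmetric])
  moreover have "integral (cube S) (\<lambda>x. complex_of_real ((cmod (f x))\<^sup>2))
      = complex_of_real (integral (cube S) (\<lambda>x. (cmod (f x))\<^sup>2))"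
    unfolding cube_cbox
    by (intro integral_unique has_integral_of_real integrable_integral integrable_continuous
        continuous_intros cf)
  ultimately have "integral (cube S) (\<lambda>x. (cmod (f x))\<^sup>2) = 0" by simp
  moreover have "box (vec_lambda (\<lambda>i. - S)) (vec_lambda (\<lambda>i. S)) \<noteq> ({} :: (real^'n) set)"
    using S by (simp add: interval_ne_empty_cart)
  ultimately have "\<forall>x\<in>cube S. (cmod (f x))\<^sup>2 = 0"
    unfolding cube_cbox by (subst (asm) integral_cbox_eq_0_iff) (auto intro!: continuous_intros cf)
  then show ?thesis using x by simp
qed

text \<open>Integration by parts moves the operator from \<open>f\<close> to the monomials with
  exactly the signs of the transposed action, so \<open>polyfun_functional_zero\<close> makes all
  moments of \<open>f\<close> vanish.\<close>

lemma smooth_compact_support_zero: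
  fixes f :: "real^'n::finite \<Rightarrow> complex"
  assumes f: "smooth f" and a: "a \<noteq> 0" "smooth_apply a f = 0" and R: "0 < R"
    and outer: "\<And>x. x \<notin> cube R \<Longrightarrow> f x = 0"
  shows "f = 0"
proof -
  \<comment> \<open>The margin around \<open>cube R\<close> is what removes the boundary terms in
    the integrations by parts.\<close>
  define S where "S = R + 1"
  have S: "R < S" "0 < S" using R by (auto simp: S_def)
  define L where "L p = Icube S (\<lambda>x. f x * p x)" for p
  have L0: "L p = 0" if "polyfun p" for p
  proof (rule polyfun_functional_zero[OF a(1) _ _ _ that])
    fix \<alpha>
    have sm: "smooth (multi_deriv m f)" for m
    proof -
      obtain js where "multi_deriv m = iter_deriv js" by (rule multi_deriv_list[of m]) blast
      then show ?thesis using smooth_iter_deriv[OF f] by simp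
    qed
    have D: "(-1) ^ mdeg m * L (multi_deriv m (mon \<alpha>)) = Icube S (\<lambda>x. multi_deriv m f x * mon \<alpha> x)" for m
    proof -
      obtain js where js: "multi_deriv m = iter_deriv js" "length js = mdeg m"
        by (rule multi_deriv_list[of m]) blast
      have "(-1) ^ mdeg m * ((-1) ^ mdeg m * z) = z" for z :: complex
        by (simp add: mult.assoc[symmetric] power_add[symmetric] mult_2[symmetric])
      then show ?thesis
        using Icube_by_parts_iter[OF f outer smooth_mon[of \<alpha>] S(1), where js = js] by (simp add: L_def js)
    qed
    have "(\<Sum>m\<in>Poly_Mapping.keys a. Poly_Mapping.lookup a m * Icube S (\<lambda>x. multi_deriv m f x * mon \<alpha> x))
      = Icube S (\<lambda>x. \<Sum>m\<in>Poly_Mapping.keys a. Poly_Mapping.lookup a m * (multi_deriv m f x * mon \<alpha> x))"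
      unfolding Icube_cmult[symmetric] unfolding Icube_def
      by (intro integral_sum[symmetric] smooth_integrable_cube smooth_cmult smooth_mult sm smooth_mon) auto
    also have "(\<lambda>x. \<Sum>m\<in>Poly_Mapping.keys a. Poly_Mapping.lookup a m * (multi_deriv m f x * mon \<alpha> x))
      = (\<lambda>x. smooth_apply a f x * mon \<alpha> x)"
      by (simp add: smooth_apply_def sum_distrib_right mult.assoc)
    also have "\<dots> = (\<lambda>x. 0)" by (simp add: a(2))
    finally show "(\<Sum>m\<in>Poly_Mapping.keys a.
      Poly_Mapping.lookup a m * ((-1) ^ mdeg m * L (multi_deriv m (mon \<alpha>)))) = 0"
      by (simp add: D Icube_def)
  next
    fix p q :: "real^'n \<Rightarrow> complex" assume "polyfun p" "polyfun q"
    then show "L (\<lambda>x. p x + q x) = L p + L q"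
      unfolding L_def distrib_left by (intro Icube_add smooth_mult f polyfun_smooth)
  next
    fix c and p :: "real^'n \<Rightarrow> complex"
    have "(\<lambda>x. f x * (c * p x)) = (\<lambda>x. c * (f x * p x))" by (simp add: mult.left_commute)
    then show "L (\<lambda>x. c * p x) = c * L p" unfolding L_def by (simp only: Icube_cmult)
  qed
  have "f x = 0" for x
  proof (cases "x \<in> cube S")
    case True
    then show ?thesis using smooth_zero_of_moments[OF f S(2) _ True] L0 by (simp add: L_def)
  next
    case False
    then have "x \<notin> cube R" using S by (auto simp: cube_def intro: order_trans)
    then show ?thesis by (rule outer)
  qed
  then show ?thesis by (simp add: fun_eq_iff)
qed

section \<open>Uncontrollable behaviors\<close>

lemma norm_le_in_cube: "norm x \<le> R \<Longrightarrow> x \<in> cube R"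
  using component_le_norm_cart[of x] by (auto simp: cube_def intro: order_trans)

text \<open>The common core for both signal spaces. \<open>compact_supp\<close> is the analytic
  result, stated with a set \<open>V\<close> because controllability yields agreement on some
  neighborhood. \<open>detect\<close> says that a nonzero signal is already seen to be nonzero on a
  bounded cube, so that gluing with 0 far away cannot destroy it.\<close>

lemma uncontrollableI:
  fixes F :: "('n::finite, 'f::comm_monoid_add) signal_space" and a :: "'n diffop"
  assumes zero: "0 \<in> signals F" "\<And>p. act F p 0 = 0"
    and act_zero: "\<And>f. act F 0 f = 0"
    and P: "\<And>j. j < k \<Longrightarrow> a \<cdot>\<^sub>v unit_vec k j \<in> P"
    and compact_supp: "\<And>f R V. f \<in> signals F \<Longrightarrow> act F a f = 0 \<Longrightarrow> 0 < R \<Longrightarrow> outer R \<subseteq> V \<Longrightarrow>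
      eq_on F V f 0 \<Longrightarrow> f = 0"
    and detect: "\<And>f. f \<in> signals F \<Longrightarrow> f \<noteq> 0 \<Longrightarrow>
      \<exists>R>0. \<forall>V g. cube R \<subseteq> V \<longrightarrow> eq_on F V g f \<longrightarrow> g \<noteq> 0"
  shows "uncontrollable F k (behavior F k P)"
  unfolding uncontrollable_def
proof (rule notI, elim exE conjE)
  fix Q assume sub: "behavior F k Q \<subseteq> behavior F k P" and ne: "behavior F k Q \<noteq> {0\<^sub>v k}"
    and ctrl: "controllable F k (behavior F k Q)"
  have zero_mem: "0\<^sub>v k \<in> behavior F k Q" using zero by (simp add: behavior_def)
  then obtain f where f: "f \<in> behavior F k Q" "f \<noteq> 0\<^sub>v k" using ne by auto
  then have "f \<in> carrier_vec k" by (simp add: behavior_def)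
  then obtain j where j: "j < k" "f $ j \<noteq> 0" using f(2) by (metis carrier_vecD eq_vecI index_zero_vec)
  have "f $ j \<in> signals F" using f(1) j(1) by (simp add: behavior_def)
  from detect[OF this j(2)] obtain R where R: "R > 0"
    "\<And>V g. cube R \<subseteq> V \<Longrightarrow> eq_on F V g (f $ j) \<Longrightarrow> g \<noteq> 0" by auto
  \<comment> \<open>The gap of width 1 between the two closed sets keeps their closures
    disjoint.\<close>
  have "closure (cube R) \<inter> closure (outer (R + 1)) = ({} :: (real^'n) set)"
    unfolding closure_closed[OF closed_cube] closure_closed[OF closed_outer]
  proof (rule equals0I)
    fix x :: "real^'n" assume x: "x \<in> cube R \<inter> outer (R + 1)"
    then obtain i where "R + 1 \<le> \<bar>vec_nth x i\<bar>" by (auto simp: outer_def)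
    moreover have "\<bar>vec_nth x i\<bar> \<le> R" using x by (simp add: cube_def)
    ultimately show False by simp
  qed
  from ctrl[unfolded controllable_def, rule_format, OF this f(1) zero_mem]
  obtain g V1 V2 where g: "g \<in> behavior F k Q"
    and V1: "cube R \<subseteq> V1" "\<forall>i<k. eq_on F V1 (g $ i) (f $ i)"
    and V2: "outer (R + 1) \<subseteq> V2" "\<forall>i<k. eq_on F V2 (g $ i) (0\<^sub>v k $ i)"
    by (elim bexE exE conjE)
  have "g \<in> behavior F k P" using g sub by auto
  then have gj: "g $ j \<in> signals F"
    and eq: "(\<Sum>i<k. act F ((a \<cdot>\<^sub>v unit_vec k j) $ i) (g $ i)) = 0"
    using P[OF j(1)] j(1) by (auto simp: behavior_def)
  \<comment> \<open>The multiple of the \<open>j\<close>-th unit vector isolates the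
    \<open>j\<close>-th component: the other entries are the operator 0, handled by
    \<open>act_zero\<close>.\<close>
  have "(\<Sum>i<k. act F ((a \<cdot>\<^sub>v unit_vec k j) $ i) (g $ i)) = (\<Sum>i<k. if i = j then act F a (g $ i) else 0)"
    by (rule sum.cong) (use j(1) in \<open>auto simp: act_zero unit_vec_def\<close>)
  then have "act F a (g $ j) = 0" using eq j(1) by simp
  moreover have "eq_on F V2 (g $ j) 0" using V2(2) j(1) by simp
  ultimately have "g $ j = 0" using compact_supp[OF gj _ _ V2(1)] R(1) by simp
  moreover have "g $ j \<noteq> 0" using R(2)[OF V1(1)] V1(2) j(1) by simp
  ultimately show False by simp
qed

lemma uncontrollable_smooth_space:
  fixes a :: "'n::finite diffop"
  assumes a: "a \<noteq> 0" and P: "\<And>j. j < k \<Longrightarrow> a \<cdot>\<^sub>v unit_vec k j \<in> P"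
  shows "uncontrollable smooth_space k (behavior smooth_space k P)"
proof (rule uncontrollableI[OF _ _ _ P])
  show "0 \<in> signals (smooth_space :: ('n, real^'n \<Rightarrow> complex) signal_space)"
    by (simp add: smooth_space_def zero_fun_def)
  show "act smooth_space p 0 = (0 :: real^'n \<Rightarrow> complex)" for p
  proof -
    have "multi_deriv m (\<lambda>x :: real^'n. 0) = (\<lambda>x. 0)" for m
    proof -
      obtain js where "multi_deriv m = iter_deriv js" by (rule multi_deriv_list[of m]) blast
      then show ?thesis by (simp add: iter_deriv_zero)
    qed
    then show ?thesis by (simp add: smooth_space_def smooth_apply_def zero_fun_def)
  qed
  show "act smooth_space 0 f = 0" for f :: "real^'n \<Rightarrow> complex"
    by (simp add: smooth_space_def smooth_apply_def zero_fun_def)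
  show "f = 0" if "f \<in> signals smooth_space" "act smooth_space a f = 0" "0 < R" "outer R \<subseteq> V"
    "eq_on smooth_space V f 0" for f :: "real^'n \<Rightarrow> complex" and R V
  proof (rule smooth_compact_support_zero[OF _ a])
    show "smooth f" "smooth_apply a f = 0" using that by (simp_all add: smooth_space_def)
    show "0 < R" by fact
    fix x :: "real^'n" assume "x \<notin> cube R"
    then obtain i where "R < \<bar>vec_nth x i\<bar>" by (auto simp: cube_def not_le)
    then have "x \<in> outer R" unfolding outer_def by (intro CollectI exI[of _ i]) simp
    then show "f x = 0" using that(4,5) by (auto simp: smooth_space_def)
  qed
  show "\<exists>R>0. \<forall>V g. cube R \<subseteq> V \<longrightarrow> eq_on smooth_space V g f \<longrightarrow> g \<noteq> 0"
    if f: "f \<noteq> 0" for f :: "real^'n \<Rightarrow> complex"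
  proof -
    obtain x where x: "f x \<noteq> 0" using f by (auto simp: fun_eq_iff)
    have "x \<in> cube (norm x + 1)" by (rule norm_le_in_cube) simp
    then have "g \<noteq> 0" if "cube (norm x + 1) \<subseteq> V" "eq_on smooth_space V g f" for V g
      using that x by (auto simp: smooth_space_def)
    then show ?thesis by (intro exI[of _ "norm x + 1"] conjI allI impI) (auto intro: add_nonneg_pos)
  qed
qed

lemma distribution_zero: "distribution 0"
  unfolding distribution_def
proof (intro conjI allI impI)
  fix K :: "(real^'n) set"
  show "\<exists>C N. \<forall>\<phi>. test_fun \<phi> \<longrightarrow> supp \<phi> \<subseteq> K \<longrightarrow>
      cmod ((0 :: (real^'n \<Rightarrow> complex) \<Rightarrow> complex) \<phi>) \<le> C * (\<Sum>m | mdeg m \<le> N. SUP x. cmod (multi_deriv m \<phi> x))"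
    by (rule exI[of _ 0]) simp
qed simp_all

lemma uncontrollable_distr_space:
  fixes a :: "'n::finite diffop"
  assumes a: "a \<noteq> 0" and P: "\<And>j. j < k \<Longrightarrow> a \<cdot>\<^sub>v unit_vec k j \<in> P"
  shows "uncontrollable distr_space k (behavior distr_space k P)"
proof (rule uncontrollableI[OF _ _ _ P])
  show "0 \<in> signals (distr_space :: ('n, (real^'n \<Rightarrow> complex) \<Rightarrow> complex) signal_space)"
    by (simp add: distr_space_def distribution_zero)
  show "act distr_space p 0 = (0 :: (real^'n \<Rightarrow> complex) \<Rightarrow> complex)" for p
    by (rule ext) (simp add: distr_space_def distr_apply_def)
  show "act distr_space 0 f = 0" for f :: "(real^'n \<Rightarrow> complex) \<Rightarrow> complex"
    by (rule ext) (simp add: distr_space_def distr_apply_def)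
  show "T = 0" if T: "T \<in> signals distr_space" "act distr_space a T = 0" "0 < R" "outer R \<subseteq> V"
    "eq_on distr_space V T 0" for T :: "(real^'n \<Rightarrow> complex) \<Rightarrow> complex" and R V
  proof (rule ext)
    fix \<phi> :: "real^'n \<Rightarrow> complex"
    have dist: "distribution T" using T(1) by (simp add: distr_space_def)
    have "T \<phi> = 0"
    proof (cases "test_fun \<phi>")
      case True
      show ?thesis
      proof (rule distribution_compact_support_zero[OF dist a _ T(3) _ True])
        show "distr_apply a T = 0" using T(2) by (simp add: distr_space_def)
        show "T \<psi> = 0" if "test_fun \<psi>" "supp \<psi> \<subseteq> outer R" for \<psi>
          using T(4,5) that by (simp add: distr_space_def)
      qed
    next
      case False
      then show ?thesis using dist unfolding distribution_def by blast
    qed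
    then show "T \<phi> = 0 \<phi>" by simp
  qed
  show "\<exists>R>0. \<forall>V g. cube R \<subseteq> V \<longrightarrow> eq_on distr_space V g T \<longrightarrow> g \<noteq> 0"
    if T: "T \<in> signals distr_space" "T \<noteq> 0" for T :: "(real^'n \<Rightarrow> complex) \<Rightarrow> complex"
  proof -
    obtain \<phi> where \<phi>: "T \<phi> \<noteq> 0" using T(2) by (auto simp: fun_eq_iff)
    have dist: "distribution T" using T(1) by (simp add: distr_space_def)
    have test: "test_fun \<phi>" using dist \<phi> unfolding distribution_def by blast
    then obtain B where B: "\<And>x. x \<in> supp \<phi> \<Longrightarrow> norm x \<le> B"
      using compact_imp_bounded[of "supp \<phi>"] by (auto simp: test_fun_def bounded_iff)
    have "supp \<phi> \<subseteq> cube (\<bar>B\<bar> + 1)"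
    proof
      fix x assume "x \<in> supp \<phi>"
      then show "x \<in> cube (\<bar>B\<bar> + 1)" using B[of x] by (intro norm_le_in_cube) simp
    qed
    then have "g \<noteq> 0" if "cube (\<bar>B\<bar> + 1) \<subseteq> V" "eq_on distr_space V g T" for V g
      using that \<phi> test by (auto simp: distr_space_def)
    then show ?thesis by (intro exI[of _ "\<bar>B\<bar> + 1"] conjI allI impI) (auto intro: add_nonneg_pos)
  qed
qed

section \<open>Minors and submodules\<close>

text \<open>Rows are given by a function, so that replacing a row is a function update; only its
  values below \<open>k\<close> matter.\<close>

definition rows_det :: "nat \<Rightarrow> (nat \<Rightarrow> 'a::comm_ring_1 Matrix.vec) \<Rightarrow> 'a" where
  "rows_det k w = Determinant.det (Matrix.mat k k (\<lambda>(i, j). w i $ j))"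

text \<open>The cofactors along row \<open>n\<close> do not involve that row, so the coefficients
  can be fixed before \<open>v\<close>. This is linearity in one row.\<close>

lemma rows_det_laplace:
  assumes "n < k"
  shows "\<exists>c. \<forall>v. rows_det k (w(n := v)) = (\<Sum>j<k. v $ j * c j)"
proof -
  let ?A = "\<lambda>v. Matrix.mat k k (\<lambda>(i, j). (w(n := v)) i $ j)"
  have cof: "cofactor (?A v) n j = cofactor (?A (0\<^sub>v k)) n j" if "j < k" for v j
  proof -
    have "mat_delete (?A v) n j = mat_delete (?A (0\<^sub>v k)) n j"
      using assms that by (intro eq_matI) (auto simp: mat_delete_def)
    then show ?thesis by (simp add: cofactor_def)
  qed
  have "rows_det k (w(n := v)) = (\<Sum>j<k. v $ j * cofactor (?A (0\<^sub>v k)) n j)" for v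
  proof -
    have "rows_det k (w(n := v)) = (\<Sum>j<k. ?A v $$ (n, j) * cofactor (?A v) n j)"
      unfolding rows_det_def by (rule laplace_expansion_row[OF _ assms]) simp
    also have "\<dots> = (\<Sum>j<k. v $ j * cofactor (?A (0\<^sub>v k)) n j)"
    proof (rule sum.cong[OF refl])
      fix j assume "j \<in> {..<k}"
      then have "j < k" by simp
      then have "?A v $$ (n, j) = v $ j" using assms by simp
      then show "?A v $$ (n, j) * cofactor (?A v) n j = v $ j * cofactor (?A (0\<^sub>v k)) n j"
        unfolding cof[OF \<open>j < k\<close>, of v] by (rule arg_cong)
    qed
    finally show ?thesis .
  qed
  then show ?thesis by blast
qed

lemma rows_det_identical:
  assumes "i < k" "j < k" "i \<noteq> j" "w i = w j"
  shows "rows_det k w = 0"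
  unfolding rows_det_def
  by (rule det_identical_rows[OF _ assms(3,1,2)]) (use assms in \<open>auto intro!: eq_vecI\<close>)

lemma rows_det_unit: "rows_det k (unit_vec k) = (1 :: 'a::comm_ring_1)"
proof -
  have "Matrix.mat k k (\<lambda>(i, j). unit_vec k i $ j) = (1\<^sub>m k :: 'a mat)"
    by (rule eq_matI) auto
  then show ?thesis by (simp add: rows_det_def)
qed

lemma is_submodule_iff:
  "is_submodule k (P :: 'n::finite diffop Matrix.vec set) \<longleftrightarrow>
    P \<subseteq> carrier_vec k \<and> 0\<^sub>v k \<in> P \<and> (\<forall>v\<in>P. \<forall>w\<in>P. v + w \<in> P) \<and> (\<forall>c. \<forall>v\<in>P. c \<cdot>\<^sub>v v \<in> P)"
proof -
  interpret vec_module "TYPE('n diffop)" k .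
  have "Module.module class_ring (free_module k :: ('n diffop, 'n diffop Matrix.vec) module)" ..
  then show ?thesis
    unfolding submodule_def module_vec_simps class_ring_simps by auto
qed

lemma submodule_sum:
  assumes P: "is_submodule k (P :: 'n::finite diffop Matrix.vec set)" and u: "\<And>i. i < (n :: nat) \<Longrightarrow> u i \<in> P"
  shows "Matrix.vec k (\<lambda>c. \<Sum>i<n. a i * u i $ c) \<in> P"
  using u
proof (induction n)
  case 0
  have "Matrix.vec k (\<lambda>c. \<Sum>i<0::nat. a i * u i $ c) = 0\<^sub>v k" by (intro eq_vecI) auto
  then show ?case using P unfolding is_submodule_iff by simp
next
  case (Suc n)
  have un: "u n \<in> P" using Suc.prems by simp
  then have "u n \<in> carrier_vec k" using P unfolding is_submodule_iff by blast
  then have "Matrix.vec k (\<lambda>c. \<Sum>i<Suc n. a i * u i $ c) =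
      Matrix.vec k (\<lambda>c. \<Sum>i<n. a i * u i $ c) + a n \<cdot>\<^sub>v u n"
    by (intro eq_vecI) auto
  moreover have "Matrix.vec k (\<lambda>c. \<Sum>i<n. a i * u i $ c) \<in> P" using Suc by simp
  ultimately show ?case using P un unfolding is_submodule_iff by simp
qed

lemma span_of_props:
  assumes "G \<subseteq> carrier_vec k"
  shows "is_submodule k (span_of k G)" "G \<subseteq> span_of k G"
    "\<And>N. is_submodule k N \<Longrightarrow> G \<subseteq> N \<Longrightarrow> span_of k G \<subseteq> (N :: 'n::finite diffop Matrix.vec set)"
proof -
  interpret vec_module "TYPE('n diffop)" k .
  show "is_submodule k (span_of k G)" using span_is_submodule[OF assms] .
  show "G \<subseteq> span_of k G" using in_own_span[OF assms] .
  show "span_of k G \<subseteq> N" if "is_submodule k N" "G \<subseteq> N" for N using span_is_subset[OF that(2,1)] .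
qed

text \<open>The rows are moved from the generating set into the span one at a time, since the vectors
  annihilated by a determinant in one of its rows form a submodule.\<close>

lemma rows_det_span_zero:
  fixes G :: "'n::finite diffop Matrix.vec set"
  assumes G: "G \<subseteq> carrier_vec k" and zero: "\<And>w. (\<And>i. i < k \<Longrightarrow> w i \<in> G) \<Longrightarrow> rows_det k w = 0"
    and w: "\<And>i. i < k \<Longrightarrow> w i \<in> span_of k G"
  shows "rows_det k w = 0"
proof -
  \<comment> \<open>\<open>n\<close> counts the rows already allowed to lie in the span;
    \<open>n = k\<close> is the claim.\<close>
  have "rows_det k w = 0"
    if "n \<le> k" "\<And>i. i < n \<Longrightarrow> w i \<in> span_of k G" "\<And>i. n \<le> i \<Longrightarrow> i < k \<Longrightarrow> w i \<in> G" for n w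
    using that
  proof (induction n arbitrary: w)
    case 0 then show ?case by (intro zero) auto
  next
    case (Suc n)
    then have n: "n < k" by simp
    obtain c where c: "\<And>v. rows_det k (w(n := v)) = (\<Sum>j<k. v $ j * c j)"
      using rows_det_laplace[OF n] by blast
    let ?N = "{v \<in> carrier_vec k. rows_det k (w(n := v)) = 0}"
    have "is_submodule k ?N"
      unfolding is_submodule_iff c
    proof (intro conjI ballI allI)
      fix v u assume "v \<in> {v \<in> carrier_vec k. (\<Sum>j<k. v $ j * c j) = 0}" "u \<in> {v \<in> carrier_vec k. (\<Sum>j<k. v $ j * c j) = 0}"
      then show "v + u \<in> {v \<in> carrier_vec k. (\<Sum>j<k. v $ j * c j) = 0}"
        by (auto simp: distrib_right sum.distrib)
    next
      fix b v assume "v \<in> {v \<in> carrier_vec k. (\<Sum>j<k. v $ j * c j) = 0}"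
      then show "b \<cdot>\<^sub>v v \<in> {v \<in> carrier_vec k. (\<Sum>j<k. v $ j * c j) = 0}"
        by (auto simp: mult.assoc sum_distrib_left[symmetric])
    qed auto
    moreover have "G \<subseteq> ?N"
    proof
      fix g assume g: "g \<in> G"
      have "rows_det k (w(n := g)) = 0"
      proof (rule Suc.IH)
        show "(w(n := g)) i \<in> span_of k G" if "i < n" for i using that Suc.prems(2) by auto
        show "(w(n := g)) i \<in> G" if "n \<le> i" "i < k" for i
          using that Suc.prems(3)[of i] g by (cases "i = n") auto
      qed (use n in simp)
      then show "g \<in> ?N" using g G by auto
    qed
    ultimately have "span_of k G \<subseteq> ?N" by (rule span_of_props(3)[OF G])
    moreover have "w n \<in> span_of k G" using Suc.prems(2) by simp
    ultimately have "rows_det k (w(n := w n)) = 0" by blast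
    then show ?case by simp
  qed
  from this[of k w] show ?thesis using w by simp
qed

text \<open>Over the field of fractions this says that \<open>P\<close> has full rank
  \<open>k\<close>. It involves no matrix of generators, as both the choice in
  \<open>fitting_ideal\<close> and the quotient topology demand.\<close>

definition nondegenerate :: "nat \<Rightarrow> 'n::finite diffop Matrix.vec set \<Rightarrow> bool" where
  "nondegenerate k P \<longleftrightarrow> (\<exists>w. (\<forall>i<k. w i \<in> P) \<and> rows_det k w \<noteq> 0)"

text \<open>By multilinearity, a determinant that vanishes on all choices of rows of
  \<open>M\<close> vanishes on the whole span. The choice \<open>f\<close> may repeat or reorder
  rows, which spares the bookkeeping with increasing index sets in the openness proof.\<close>

lemma nondegenerate_row_module:
  assumes M: "M \<in> carrier_mat l k"
  shows "nondegenerate k (row_module k M) \<longleftrightarrow>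
    (\<exists>f. (\<forall>i<k. f i < l) \<and> rows_det k (\<lambda>i. Matrix.row M (f i)) \<noteq> 0)"
proof
  have G: "set (rows M) \<subseteq> carrier_vec k" using M by (auto simp: rows_def)
  assume "nondegenerate k (row_module k M)"
  then obtain w where w: "\<And>i. i < k \<Longrightarrow> w i \<in> span_of k (set (rows M))" "rows_det k w \<noteq> 0"
    by (auto simp: nondegenerate_def row_module_def)
  have "\<exists>v. (\<forall>i<k. v i \<in> set (rows M)) \<and> rows_det k v \<noteq> 0"
  proof (rule ccontr)
    assume *: "\<nexists>v. (\<forall>i<k. v i \<in> set (rows M)) \<and> rows_det k v \<noteq> 0"
    have "rows_det k v = 0" if "\<And>i. i < k \<Longrightarrow> v i \<in> set (rows M)" for v
      using * that by auto
    from rows_det_span_zero[OF G this w(1)] w(2) show False by simp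
  qed
  then obtain v where v: "\<And>i. i < k \<Longrightarrow> v i \<in> set (rows M)" "rows_det k v \<noteq> 0" by auto
  have "\<exists>r<l. v i = Matrix.row M r" if "i < k" for i
    using v(1)[OF that] M by (auto simp: rows_def)
  then obtain f where f: "\<And>i. i < k \<Longrightarrow> f i < l" "\<And>i. i < k \<Longrightarrow> v i = Matrix.row M (f i)" by metis
  have "rows_det k v = rows_det k (\<lambda>i. Matrix.row M (f i))"
    unfolding rows_det_def by (rule arg_cong[of _ _ Determinant.det], rule eq_matI) (auto simp: f(2))
  then show "\<exists>f. (\<forall>i<k. f i < l) \<and> rows_det k (\<lambda>i. Matrix.row M (f i)) \<noteq> 0" using f(1) v(2) by auto
next
  have G: "set (rows M) \<subseteq> carrier_vec k" using M by (auto simp: rows_def)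
  assume "\<exists>f. (\<forall>i<k. f i < l) \<and> rows_det k (\<lambda>i. Matrix.row M (f i)) \<noteq> 0"
  then obtain f where f: "\<And>i. i < k \<Longrightarrow> f i < l" "rows_det k (\<lambda>i. Matrix.row M (f i)) \<noteq> 0" by blast
  have "Matrix.row M (f i) \<in> row_module k M" if "i < k" for i
  proof -
    have "Matrix.row M (f i) \<in> set (rows M)" using f(1)[OF that] M by (auto simp: rows_def)
    then show ?thesis using span_of_props(2)[OF G] unfolding row_module_def by blast
  qed
  then show "nondegenerate k (row_module k M)"
    unfolding nondegenerate_def using f(2)
    by (intro exI[of _ "\<lambda>i. Matrix.row M (f i)"] conjI allI impI)
qed

section \<open>Maximal minors and nondegeneracy\<close>

lemma minors_ideal_nonzero_iff:
  "minors_ideal k M \<noteq> {0} \<longleftrightarrow>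
    (\<exists>I \<subseteq> {..<dim_row M}. card I = k \<and> Determinant.det (submatrix M I UNIV) \<noteq> (0 :: 'n::finite diffop))"
proof -
  let ?S = "{Determinant.det (submatrix M I UNIV) | I. I \<subseteq> {..<dim_row M} \<and> card I = k}"
  have R: "Ring.ring (class_ring :: 'n diffop ring)" ..
  have "?S \<subseteq> minors_ideal k M"
    unfolding minors_ideal_def by (rule ring.genideal_self[OF R]) (simp add: class_ring_simps)
  moreover have "minors_ideal k M = {0}" if "?S \<subseteq> {0}"
  proof
    have z: "ideal {0} (class_ring :: 'n diffop ring)"
      using ring.zeroideal[OF R] by (simp add: class_ring_simps)
    show "minors_ideal k M \<subseteq> {0}"
      unfolding minors_ideal_def by (rule ring.genideal_minimal[OF R z that])
    have "ideal (minors_ideal k M) class_ring"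
      unfolding minors_ideal_def by (rule ring.genideal_ideal[OF R]) (simp add: class_ring_simps)
    then have "\<zero>\<^bsub>class_ring :: 'n diffop ring\<^esub> \<in> minors_ideal k M"
      by (intro additive_subgroup.zero_closed ideal.axioms(1))
    then show "{0} \<subseteq> minors_ideal k M" by (simp add: class_ring_simps)
  qed
  ultimately show ?thesis by blast
qed

text \<open>Minors take their rows in increasing order, as enumerated by \<open>pick\<close>,
  whereas \<open>f\<close> is arbitrary. A nonzero determinant forces \<open>f\<close> to be
  injective; then \<open>f\<close> is the increasing enumeration of its image up to a permutation,
  which only affects the sign.\<close>

lemma minors_ideal_nondegenerate:
  assumes M: "M \<in> carrier_mat l k"
  shows "minors_ideal k M \<noteq> {0} \<longleftrightarrow> nondegenerate k (row_module k (M :: 'n::finite diffop mat))"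
proof -
  have sub: "submatrix M I UNIV = Matrix.mat k k (\<lambda>(i, j). Matrix.row M (pick I i) $ j)"
    if I: "I \<subseteq> {..<l}" "card I = k" for I
  proof -
    have e: "{i. i < dim_row M \<and> i \<in> I} = I" using I(1) M by auto
    have "pick I i < l" if "i < k" for i
      using pick_in_set[of i I] that I by auto
    then show ?thesis
      using M I(2) by (intro eq_matI) (auto simp: submatrix_def e pick_UNIV)
  qed
  show ?thesis
    unfolding minors_ideal_nonzero_iff nondegenerate_row_module[OF M]
  proof
    assume "\<exists>I\<subseteq>{..<dim_row M}. card I = k \<and> Determinant.det (submatrix M I UNIV) \<noteq> 0"
    then obtain I where I: "I \<subseteq> {..<l}" "card I = k" "Determinant.det (submatrix M I UNIV) \<noteq> 0"
      using M by auto
    have "pick I i < l" if "i < k" for i using pick_in_set[of i I] that I by auto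
    then show "\<exists>f. (\<forall>i<k. f i < l) \<and> rows_det k (\<lambda>i. Matrix.row M (f i)) \<noteq> 0"
      using I(3) unfolding rows_det_def sub[OF I(1,2)] by (intro exI[of _ "pick I"] conjI allI impI)
  next
    assume "\<exists>f. (\<forall>i<k. f i < l) \<and> rows_det k (\<lambda>i. Matrix.row M (f i)) \<noteq> 0"
    then obtain f where f: "\<And>i. i < k \<Longrightarrow> f i < l" "rows_det k (\<lambda>i. Matrix.row M (f i)) \<noteq> 0" by blast
    have inj: "inj_on f {..<k}"
    proof (rule inj_onI, rule ccontr)
      fix i j assume "i \<in> {..<k}" "j \<in> {..<k}" "f i = f j" "i \<noteq> j"
      then show False using rows_det_identical[of i k j "\<lambda>i. Matrix.row M (f i)"] f(2) by simp
    qed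
    define I where "I = f ` {..<k}"
    have I: "I \<subseteq> {..<l}" "card I = k" using f(1) inj by (auto simp: I_def card_image)
    have inj_pick: "inj_on (pick I) {..<k}"
    proof (rule inj_onI)
      fix i j assume "i \<in> {..<k}" "j \<in> {..<k}" "pick I i = pick I j"
      then show "i = j"
        using pick_mono[of j I i] pick_mono[of i I j] I(2) by (cases i j rule: linorder_cases) auto
    qed
    have bij_pick: "bij_betw (pick I) {..<k} I"
    proof -
      have sub: "pick I ` {..<k} \<subseteq> I" using pick_in_set[of _ I] I(2) by auto
      have "finite I" by (simp add: I_def)
      moreover have "card (pick I ` {..<k}) = card I" using inj_pick I(2) by (simp add: card_image)
      ultimately have "pick I ` {..<k} = I" using sub by (simp add: card_subset_eq)
      then show ?thesis using inj_pick by (simp add: bij_betw_def)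
    qed
    \<comment> \<open>The identity from \<open>k\<close> on, as \<open>permutes\<close>
      requires.\<close>
    define \<pi> where "\<pi> i = (if i < k then inv_into {..<k} (pick I) (f i) else i)" for i
    have bij_f: "bij_betw f {..<k} I" using inj by (simp add: bij_betw_def I_def)
    have "bij_betw (inv_into {..<k} (pick I) \<circ> f) {..<k} {..<k}"
      using bij_betw_trans[OF bij_f bij_betw_inv_into[OF bij_pick]] .
    then have "bij_betw \<pi> {..<k} {..<k}"
      by (rule bij_betw_cong[THEN iffD1, rotated]) (simp add: \<pi>_def)
    then have perm: "\<pi> permutes {0..<k}"
      by (intro bij_imp_permutes) (auto simp: \<pi>_def atLeast0LessThan)
    have pf: "pick I (\<pi> i) = f i" if "i < k" for i
      using that bij_pick unfolding \<pi>_def bij_betw_def by (simp add: f_inv_into_f I_def)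
    let ?A = "Matrix.mat k k (\<lambda>(i, j). Matrix.row M (pick I i) $ j)"
    have \<pi>k: "\<pi> i < k" if "i < k" for i
      using permutes_in_image[OF perm, of i] that by simp
    have "Matrix.mat k k (\<lambda>(i, j). ?A $$ (\<pi> i, j)) = Matrix.mat k k (\<lambda>(i, j). Matrix.row M (f i) $ j)"
      by (rule eq_matI) (auto simp: \<pi>k pf)
    then have "rows_det k (\<lambda>i. Matrix.row M (f i)) = signof \<pi> * Determinant.det ?A"
      unfolding rows_det_def using det_permute_rows[of ?A k \<pi>, OF _ perm] by simp
    then have "Determinant.det (submatrix M I UNIV) \<noteq> 0"
      using f(2) unfolding sub[OF I] by auto
    then show "\<exists>I\<subseteq>{..<dim_row M}. card I = k \<and> Determinant.det (submatrix M I UNIV) \<noteq> 0"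
      using I M by auto
  qed
qed

text \<open>The matrix picked by \<open>SOME\<close> may have any number of rows, not just
  \<open>l\<close>; this is harmless because \<open>nondegenerate\<close> is a property of the row
  module. The minimal matrix \<open>M'\<close> only shows that a choice exists.\<close>

lemma fitting_ideal_nonzero_iff:
  assumes "P \<in> submodules l k"
  shows "fitting_ideal k P \<noteq> {0} \<longleftrightarrow> nondegenerate k P"
proof -
  define M where "M = (SOME M. dim_col M = k \<and> row_module k M = P)"
  obtain M' where "M' \<in> min_mats l k" "P = row_module k M'"
    using assms unfolding row_module_min_mats[symmetric] by blast
  then have "\<exists>M. dim_col M = k \<and> row_module k M = P" by (auto simp: min_mats_def)
  from someI_ex[OF this] have M: "dim_col M = k" "row_module k M = P" unfolding M_def by simp_all
  have "M \<in> carrier_mat (dim_row M) k" using M(1) by auto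
  from minors_ideal_nondegenerate[OF this] show ?thesis by (simp add: fitting_ideal_def M_def[symmetric] M(2))
qed

lemma nondegenerate_multiples:
  assumes P: "is_submodule k P" and nd: "nondegenerate k P"
  shows "\<exists>a. a \<noteq> 0 \<and> (\<forall>j<k. a \<cdot>\<^sub>v unit_vec k j \<in> P)"
proof -
  obtain w where w: "\<And>i. i < k \<Longrightarrow> w i \<in> P" "rows_det k w \<noteq> 0"
    using nd by (auto simp: nondegenerate_def)
  let ?A = "Matrix.mat k k (\<lambda>(i, j). w i $ j)"
  have A: "?A \<in> carrier_mat k k" by simp
  have "rows_det k w \<cdot>\<^sub>v unit_vec k j \<in> P" if j: "j < k" for j
  proof -
    \<comment> \<open>Row \<open>j\<close> of this matrix identity writes the multiple of the unit
      vector as a combination of the rows \<open>w i\<close>.\<close>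
    have e: "(adj_mat ?A * ?A) $$ (j, c) = (rows_det k w \<cdot>\<^sub>m 1\<^sub>m k) $$ (j, c)" for c
      unfolding rows_det_def adj_mat(3)[OF A] ..
    have "(\<Sum>i<k. adj_mat ?A $$ (j, i) * w i $ c) = rows_det k w * (if j = c then 1 else 0)" if "c < k" for c
      using e[of c] that j adj_mat(1)[OF A] by (simp add: scalar_prod_def atLeast0LessThan)
    then have "rows_det k w \<cdot>\<^sub>v unit_vec k j = Matrix.vec k (\<lambda>c. \<Sum>i<k. adj_mat ?A $$ (j, i) * w i $ c)"
      using j by (intro eq_vecI) (auto simp: unit_vec_def)
    then show ?thesis using submodule_sum[OF P, of k w] w(1) by simp
  qed
  then show ?thesis using w(2) by blast
qed

text \<open>The witness for nonemptiness. Fewer than \<open>k\<close> generators cannot suffice: any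
  \<open>k\<close> vectors chosen among them repeat one, so the determinant vanishes on the
  generators and hence on their span, but it is 1 on the unit vectors.\<close>

lemma carrier_vec_submodules: "(carrier_vec k :: 'n::finite diffop Matrix.vec set) \<in> submodules k k"
proof -
  let ?C = "carrier_vec k :: 'n diffop Matrix.vec set"
  let ?U = "set (unit_vecs k) :: 'n diffop Matrix.vec set"
  have C: "is_submodule k ?C" unfolding is_submodule_iff by auto
  have U: "?U \<subseteq> ?C" by (rule unit_vecs_carrier)
  have "span_of k ?U = ?C"
  proof
    show "span_of k ?U \<subseteq> ?C" by (rule span_of_props(3)[OF U C U])
    show "?C \<subseteq> span_of k ?U"
    proof
      fix v assume v: "v \<in> ?C"
      have "v = Matrix.vec k (\<lambda>c. \<Sum>i<k. v $ i * unit_vec k i $ c)"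
        using v by (intro eq_vecI) (auto simp: unit_vec_def if_distrib sum.delta cong: if_cong)
      also have "\<dots> \<in> span_of k ?U"
      proof (rule submodule_sum[OF span_of_props(1)[OF U]])
        fix i assume "i < k"
        then have "unit_vec k i \<in> ?U" by (auto simp: unit_vecs_def)
        then show "unit_vec k i \<in> span_of k ?U" using span_of_props(2)[OF U] by blast
      qed
      finally show "v \<in> span_of k ?U" .
    qed
  qed
  moreover have "card ?U \<le> k" using card_length[of "unit_vecs k"] by (simp add: unit_vecs_def)
  ultimately have "generated_by k k ?C" unfolding generated_by_def using U by blast
  moreover have "\<not> generated_by k r ?C" if "r < k" for r
  proof
    assume "generated_by k r ?C"
    then obtain G where G: "G \<subseteq> ?C" "finite G" "card G \<le> r" "span_of k G = ?C"
      by (auto simp: generated_by_def)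
    have "rows_det k w = 0" if w: "\<And>i. i < k \<Longrightarrow> w i \<in> G" for w
    proof -
      have "\<not> inj_on w {..<k}"
        using card_inj_on_le[of w "{..<k}" G] w G(2,3) \<open>r < k\<close> by auto
      then obtain i j where "i < k" "j < k" "i \<noteq> j" "w i = w j" by (auto simp: inj_on_def)
      then show ?thesis by (rule rows_det_identical)
    qed
    from rows_det_span_zero[OF G(1) this, of "unit_vec k"] show False
      unfolding G(4) rows_det_unit by auto
  qed
  ultimately show ?thesis using C unfolding submodules_def by blast
qed

lemma nondegenerate_carrier_vec: "nondegenerate k (carrier_vec k)"
  unfolding nondegenerate_def by (intro exI[of _ "unit_vec k"]) (auto simp: rows_det_unit)

section \<open>Polynomial families of operators and Zariski openness\<close>

text \<open>Maps from coordinate space to operators whose coefficients are polynomials in the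
  coordinates, only finitely many of them nonzero. Generated by terms under sums, they are closed
  under products, so determinants require no degree bound of their own.\<close>

inductive regular_family :: "'i set \<Rightarrow> (('i \<Rightarrow> complex) \<Rightarrow> 'n::finite diffop) \<Rightarrow> bool" for I where
  single: "mpoly_vars p \<subseteq> I \<Longrightarrow> regular_family I (\<lambda>x. Poly_Mapping.single m (mpoly_eval p x))"
| add: "regular_family I g \<Longrightarrow> regular_family I h \<Longrightarrow> regular_family I (\<lambda>x. g x + h x)"

lemma mpoly_vars_add: "mpoly_vars (p + q) \<subseteq> mpoly_vars p \<union> mpoly_vars q"
  unfolding mpoly_vars_def using Poly_Mapping.keys_add[of p q] by blast

lemma regular_family_const:
  "regular_family I (\<lambda>x. Poly_Mapping.single m c)"
  using regular_family.single[of "Poly_Mapping.single 0 c" I m]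
  by (simp add: mpoly_vars_def mpoly_eval_single)

lemma regular_family_mult:
  assumes "regular_family I g" "regular_family I h"
  shows "regular_family I (\<lambda>x. g x * h x)"
  using assms(1)
proof (induction rule: regular_family.induct)
  case (single p m)
  show ?case using assms(2)
  proof (induction rule: regular_family.induct)
    case (single q m')
    have "mpoly_vars (p * q) \<subseteq> I" using mpoly_vars_mult[of p q] single \<open>mpoly_vars p \<subseteq> I\<close> by blast
    from regular_family.single[OF this, of "m + m'"] show ?case
      by (simp add: mult_single mpoly_eval_mult)
  next
    case (add g h) then show ?case by (simp add: distrib_left regular_family.add)
  qed
next
  case (add g h) then show ?case by (simp add: distrib_right regular_family.add)
qed

lemma regular_family_sum:
  "(\<And>i. i \<in> A \<Longrightarrow> regular_family I (g i)) \<Longrightarrow> regular_family I (\<lambda>x. \<Sum>i\<in>A. g i x)"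
  using regular_family_const[of I 0 0]
  by (induction A rule: infinite_finite_induct) (auto intro: regular_family.add)

lemma regular_family_prod:
  "(\<And>i. i \<in> A \<Longrightarrow> regular_family I (g i)) \<Longrightarrow> regular_family I (\<lambda>x. \<Prod>i\<in>A. g i x)"
  using regular_family_const[of I 0 1]
  by (induction A rule: infinite_finite_induct) (auto intro: regular_family_mult)

lemma regular_family_det:
  assumes "\<And>i j. i < k \<Longrightarrow> j < k \<Longrightarrow> regular_family I (g i j)"
  shows "regular_family I (\<lambda>x. Determinant.det (Matrix.mat k k (\<lambda>(i, j). g i j x)))"
proof -
  let ?P = "{\<sigma>. \<sigma> permutes {0..<k}}"
  have sg: "regular_family I (\<lambda>x. signof \<sigma> :: 'b diffop)" for \<sigma> :: "nat \<Rightarrow> nat"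
    using regular_family_const[of I 0 1] regular_family_const[of I 0 "-1"]
    by (auto simp: sign_def single_uminus)
  have less: "\<sigma> i < k" if "\<sigma> permutes {0..<k}" "i < k" for \<sigma> i
    using permutes_in_image[OF that(1), of i] that(2) by simp
  have "Determinant.det (Matrix.mat k k (\<lambda>(i, j). g i j x)) =
      (\<Sum>\<sigma>\<in>?P. signof \<sigma> * (\<Prod>i\<in>{0..<k}. g i (\<sigma> i) x))" for x
    by (subst det_def') (auto intro!: sum.cong prod.cong simp: less)
  then show ?thesis
    by (simp only:) (intro regular_family_sum regular_family_mult regular_family_prod sg assms,
        auto simp: less)
qed

lemma regular_family_lookup:
  "regular_family I g \<Longrightarrow> \<exists>p. mpoly_vars p \<subseteq> I \<and> (\<forall>x. mpoly_eval p x = Poly_Mapping.lookup (g x) m)"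
proof (induction rule: regular_family.induct)
  case (single p m')
  show ?case
  proof (cases "m' = m")
    case True then show ?thesis using single by (intro exI[of _ p]) auto
  next
    case False then show ?thesis
      by (intro exI[of _ 0]) (auto simp: lookup_single mpoly_vars_def)
  qed
next
  case (add g h)
  then obtain p q where pq: "mpoly_vars p \<subseteq> I" "\<forall>x. mpoly_eval p x = Poly_Mapping.lookup (g x) m"
    "mpoly_vars q \<subseteq> I" "\<forall>x. mpoly_eval q x = Poly_Mapping.lookup (h x) m" by blast
  then show ?case using mpoly_vars_add[of p q]
    by (intro exI[of _ "p + q"]) (auto simp: mpoly_eval_add lookup_add)
qed

lemma finite_mdeg_le: "finite {m :: 'n::finite \<Rightarrow>\<^sub>0 nat. mdeg m \<le> d}"
proof (rule finite_imageD)
  have "Poly_Mapping.lookup m i \<le> mdeg m" for m :: "'n \<Rightarrow>\<^sub>0 nat" and i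
    unfolding mdeg_def by (intro member_le_sum) auto
  then have "Poly_Mapping.lookup ` {m :: 'n \<Rightarrow>\<^sub>0 nat. mdeg m \<le> d} \<subseteq> (\<Pi>\<^sub>E i\<in>UNIV. {..d})"
    by (auto intro: order_trans)
  then show "finite (Poly_Mapping.lookup ` {m :: 'n \<Rightarrow>\<^sub>0 nat. mdeg m \<le> d})"
    by (rule finite_subset) (intro finite_PiE, auto)
  show "inj_on Poly_Mapping.lookup {m :: 'n \<Rightarrow>\<^sub>0 nat. mdeg m \<le> d}"
    by (simp add: inj_on_def)
qed

text \<open>Recovers an entry of degree at most \<open>d\<close> from \<open>mat_coeffs\<close>, but
  is defined for every coordinate vector, so that it forms a polynomial family.\<close>

definition mat_entry :: "nat \<Rightarrow> (nat \<times> nat \<times> ('n::finite \<Rightarrow>\<^sub>0 nat) \<Rightarrow> complex) \<Rightarrow> nat \<Rightarrow> nat \<Rightarrow> 'n diffop" where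
  "mat_entry d x i j = (\<Sum>m | mdeg m \<le> d. Poly_Mapping.single m (x (i, j, m)))"

lemma mat_entry_coeffs:
  assumes "M \<in> mats_deg l k d" "i < l" "j < k"
  shows "mat_entry d (mat_coeffs l k d M) i j = M $$ (i, j)"
proof (rule poly_mapping_eqI)
  fix m
  have "Poly_Mapping.lookup (mat_entry d (mat_coeffs l k d M) i j) m =
      (\<Sum>m' | mdeg m' \<le> d. if m' = m then Poly_Mapping.lookup (M $$ (i, j)) m' else 0)"
    unfolding mat_entry_def lookup_sum using assms
    by (intro sum.cong refl) (auto simp: lookup_single mat_coeffs_def coeff_indices_def)
  also have "\<dots> = (if mdeg m \<le> d then Poly_Mapping.lookup (M $$ (i, j)) m else 0)"
    by (simp add: finite_mdeg_le sum.delta')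
  also have "\<dots> = Poly_Mapping.lookup (M $$ (i, j)) m"
  proof (cases "m \<in> Poly_Mapping.keys (M $$ (i, j))")
    case True then show ?thesis using assms by (auto simp: mats_deg_def)
  qed (simp add: in_keys_iff)
  finally show "Poly_Mapping.lookup (mat_entry d (mat_coeffs l k d M) i j) m = Poly_Mapping.lookup (M $$ (i, j)) m" .
qed

lemma regular_family_mat_entry:
  assumes "i < l" "j < k"
  shows "regular_family (coeff_indices l k d) (\<lambda>x. mat_entry d x i j)"
  unfolding mat_entry_def
proof (rule regular_family_sum)
  fix m :: "'a \<Rightarrow>\<^sub>0 nat" assume m: "m \<in> {m. mdeg m \<le> d}"
  let ?p = "Poly_Mapping.single (Poly_Mapping.single (i, j, m) 1) 1 :: ((nat \<times> nat \<times> ('a \<Rightarrow>\<^sub>0 nat)) \<Rightarrow>\<^sub>0 nat) \<Rightarrow>\<^sub>0 complex"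
  have "mpoly_vars ?p \<subseteq> coeff_indices l k d"
    using assms m by (auto simp: mpoly_vars_def coeff_indices_def)
  from regular_family.single[OF this, of m]
  show "regular_family (coeff_indices l k d) (\<lambda>x. Poly_Mapping.single m (x (i, j, m)))"
    by (simp add: mpoly_eval_single)
qed

text \<open>On each piece of bounded degree, a determinant is nonzero iff one of its coefficients
  is, and these coefficients are polynomials in the affine coordinates; the trace on the piece is
  thus the complement of a common zero set.\<close>

lemma openin_nonzero_minor:
  "openin (mats_topology l k :: 'n::finite diffop mat topology)
    {M \<in> carrier_mat l k. \<exists>f. (\<forall>i<k. f i < l) \<and> rows_det k (\<lambda>i. Matrix.row M (f i)) \<noteq> 0}"
  (is "openin _ ?V")
  unfolding mats_topology_def openin_union_topology
proof (intro conjI ballI)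
  show "?V \<subseteq> (\<Union>d\<in>UNIV. topspace (mats_deg_topology l k d))"
    using topspace_mats_topology[of l k, where 'a = 'n]
    unfolding mats_topology_def topspace_union_topology by auto
  fix d
  let ?I = "coeff_indices l k d :: (nat \<times> nat \<times> ('n \<Rightarrow>\<^sub>0 nat)) set"
  let ?D = "\<lambda>f x. Determinant.det (Matrix.mat k k (\<lambda>(i, j). mat_entry d x (f i) j)) :: 'n diffop"
  \<comment> \<open>The polynomials are collected by their values instead of being constructed;
    \<open>regular_family_lookup\<close> guarantees that every coefficient of every determinant is
    represented.\<close>
  define F where "F = {p. mpoly_vars p \<subseteq> ?I \<and> (\<exists>f m. (\<forall>i<k. f i < l) \<and>
    (\<forall>x. mpoly_eval p x = Poly_Mapping.lookup (?D f x) m))}"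
  define W where "W = (?I \<rightarrow>\<^sub>E UNIV) - {x. \<forall>p\<in>F. mpoly_eval p x = 0}"
  have "openin (zariski_topology ?I) W"
    unfolding openin_zariski_topology W_def by (intro exI[of _ F]) (auto simp: F_def)
  moreover have "?V \<inter> topspace (mats_deg_topology l k d) = mat_coeffs l k d -` W \<inter> mats_deg l k d"
    unfolding topspace_mats_deg_topology
  proof (intro Set.set_eqI)
    fix M :: "'n diffop mat"
    show "M \<in> ?V \<inter> mats_deg l k d \<longleftrightarrow> M \<in> mat_coeffs l k d -` W \<inter> mats_deg l k d"
    proof (cases "M \<in> mats_deg l k d")
      case True
      let ?x = "mat_coeffs l k d M"
      have M: "M \<in> carrier_mat l k" using True by (simp add: mats_deg_def)
      have x: "?x \<in> ?I \<rightarrow>\<^sub>E UNIV" by (auto simp: mat_coeffs_def)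
      have D: "?D f ?x = rows_det k (\<lambda>i. Matrix.row M (f i))" if f: "\<forall>i<k. f i < l" for f
        unfolding rows_det_def
        by (rule arg_cong[of _ _ Determinant.det], rule eq_matI)
          (use f M True in \<open>auto simp: mat_entry_coeffs\<close>)
      have "M \<in> ?V \<longleftrightarrow> (\<exists>f. (\<forall>i<k. f i < l) \<and> ?D f ?x \<noteq> 0)" using M D by auto
      also have "\<dots> \<longleftrightarrow> (\<exists>p\<in>F. mpoly_eval p ?x \<noteq> 0)"
      proof
        assume "\<exists>f. (\<forall>i<k. f i < l) \<and> ?D f ?x \<noteq> 0"
        then obtain f where f: "\<forall>i<k. f i < l" "?D f ?x \<noteq> 0" by blast
        then obtain m where m: "Poly_Mapping.lookup (?D f ?x) m \<noteq> 0"
          by (auto simp: poly_mapping_eq_iff fun_eq_iff)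
        have "regular_family ?I (?D f)"
          by (rule regular_family_det, rule regular_family_mat_entry) (use f in auto)
        from regular_family_lookup[OF this, of m] obtain p where
          p: "mpoly_vars p \<subseteq> ?I" "\<forall>x. mpoly_eval p x = Poly_Mapping.lookup (?D f x) m" by blast
        then have "p \<in> F" unfolding F_def using f(1) by blast
        then show "\<exists>p\<in>F. mpoly_eval p ?x \<noteq> 0" using p(2) m by (intro bexI[of _ p]) auto
      next
        assume "\<exists>p\<in>F. mpoly_eval p ?x \<noteq> 0"
        then obtain p f m where "\<forall>i<k. f i < l" "\<forall>x. mpoly_eval p x = Poly_Mapping.lookup (?D f x) m"
          "mpoly_eval p ?x \<noteq> 0" unfolding F_def by blast
        then show "\<exists>f. (\<forall>i<k. f i < l) \<and> ?D f ?x \<noteq> 0" by (intro exI[of _ f]) auto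
      qed
      also have "\<dots> \<longleftrightarrow> ?x \<in> W" using x by (auto simp: W_def)
      finally show ?thesis using True by simp
    qed simp
  qed
  ultimately show "openin (mats_deg_topology l k d) (?V \<inter> topspace (mats_deg_topology l k d))"
    unfolding mats_deg_topology_def openin_pullback_topology by blast
qed

text \<open>In a quotient topology the preimage under \<open>row_module\<close> decides, and there
  the condition becomes the nonvanishing of some determinant of rows.\<close>

lemma openin_nonzero_fitting_ideal:
  "openin (submodules_topology l k) {P \<in> submodules l k. fitting_ideal k (P :: 'n::finite diffop Matrix.vec set) \<noteq> {0}}"
  (is "openin _ ?G")
  unfolding submodules_topology_def openin_quotient_topology
proof (intro conjI)
  let ?X = "subtopology (mats_topology l k) (min_mats l k) :: 'n diffop mat topology"
  have sub: "min_mats l k \<subseteq> carrier_mat l k" by (auto simp: min_mats_def)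
  then have top: "topspace ?X = min_mats l k" by (auto simp: topspace_mats_topology)
  show "?G \<subseteq> row_module k ` topspace ?X" unfolding top row_module_min_mats by blast
  let ?V = "{M \<in> carrier_mat l k. \<exists>f. (\<forall>i<k. f i < l) \<and> rows_det k (\<lambda>i. Matrix.row M (f i)) \<noteq> 0}
    :: 'n diffop mat set"
  have "{M \<in> topspace ?X. row_module k M \<in> ?G} = ?V \<inter> min_mats l k"
    unfolding top
  proof (intro Set.set_eqI)
    fix M :: "'n diffop mat"
    show "M \<in> {M \<in> min_mats l k. row_module k M \<in> ?G} \<longleftrightarrow> M \<in> ?V \<inter> min_mats l k"
    proof (cases "M \<in> min_mats l k")
      case True
      then have M: "M \<in> carrier_mat l k" and P: "row_module k M \<in> submodules l k"
        using sub row_module_min_mats by blast+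
      show ?thesis
        using True M P nondegenerate_row_module[OF M] fitting_ideal_nonzero_iff[OF P] by simp
    qed simp
  qed
  then show "openin ?X {M \<in> topspace ?X. row_module k M \<in> ?G}"
    unfolding openin_subtopology by (intro exI[of _ ?V] conjI openin_nonzero_minor)
qed

text \<open>The disjoint union topology reduces the claim to each stratum
  \<open>submodules l k\<close>.\<close>

lemma openin_overdet_nonzero_fitting_ideal:
  "openin (overdet_topology k) {P \<in> overdet_submodules k. fitting_ideal k (P :: 'n::finite diffop Matrix.vec set) \<noteq> {0}}"
  (is "openin _ ?G")
  unfolding overdet_topology_def openin_union_topology topspace_submodules_topology
proof (intro conjI ballI)
  show "?G \<subseteq> (\<Union>l\<in>{k..}. submodules l k)" by (auto simp: overdet_submodules_def)
  fix l assume "l \<in> {k..}"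
  then have "?G \<inter> submodules l k = {P \<in> submodules l k. fitting_ideal k P \<noteq> {0}}"
    by (auto simp: overdet_submodules_def)
  then show "openin (submodules_topology l k) (?G \<inter> submodules l k)"
    using openin_nonzero_fitting_ideal by simp
qed

lemma uncontrollable_of_fitting_ideal:
  fixes P :: "'n::finite diffop Matrix.vec set"
  assumes "P \<in> submodules l k" "fitting_ideal k P \<noteq> {0}"
  shows "uncontrollable smooth_space k (behavior smooth_space k P)"
    and "uncontrollable distr_space k (behavior distr_space k P)"
proof -
  have "nondegenerate k P" using fitting_ideal_nonzero_iff[OF assms(1)] assms(2) by simp
  moreover have "is_submodule k P" using assms(1) by (simp add: submodules_def)
  ultimately obtain a where a: "a \<noteq> 0" "\<And>j. j < k \<Longrightarrow> a \<cdot>\<^sub>v unit_vec k j \<in> P"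
    using nondegenerate_multiples by blast
  show "uncontrollable smooth_space k (behavior smooth_space k P)"
    by (rule uncontrollable_smooth_space[OF a])
  show "uncontrollable distr_space k (behavior distr_space k P)"
    by (rule uncontrollable_distr_space[OF a])
qed

theorem theorem6p4:
  fixes k :: nat
  assumes "k \<ge> 1"
  shows
   "(let G = {P \<in> overdet_submodules k.
                fitting_ideal k (P :: ('n::finite) diffop Matrix.vec set) \<noteq> {0}} in
      G \<noteq> {} \<and> openin (overdet_topology k) G \<and>
      (\<forall>P\<in>G. uncontrollable smooth_space k (behavior smooth_space k P) \<and>
              uncontrollable distr_space k (behavior distr_space k P))) \<and>
    (let G = {P \<in> submodules k k.
                fitting_ideal k (P :: 'n diffop Matrix.vec set) \<noteq> {0}} in
      G \<noteq> {} \<and> openin (submodules_topology k k) G \<and>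
      (\<forall>P\<in>G. uncontrollable smooth_space k (behavior smooth_space k P) \<and>
              uncontrollable distr_space k (behavior distr_space k P)))"
proof -
  let ?C = "carrier_vec k :: 'n diffop Matrix.vec set"
  have C: "?C \<in> submodules k k" by (rule carrier_vec_submodules)
  moreover have "fitting_ideal k ?C \<noteq> {0}"
    using fitting_ideal_nonzero_iff[OF C] nondegenerate_carrier_vec by simp
  moreover have "submodules k k \<subseteq> (overdet_submodules k :: 'n diffop Matrix.vec set set)"
    by (auto simp: overdet_submodules_def)
  ultimately have ne:
    "{P \<in> overdet_submodules k. fitting_ideal k (P :: 'n diffop Matrix.vec set) \<noteq> {0}} \<noteq> {}"
    "{P \<in> submodules k k. fitting_ideal k (P :: 'n diffop Matrix.vec set) \<noteq> {0}} \<noteq> {}"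
    by blast+
  have unc: "\<forall>P \<in> {P \<in> overdet_submodules k. fitting_ideal k (P :: 'n diffop Matrix.vec set) \<noteq> {0}}.
      uncontrollable smooth_space k (behavior smooth_space k P) \<and>
      uncontrollable distr_space k (behavior distr_space k P)"
    "\<forall>P \<in> {P \<in> submodules k k. fitting_ideal k (P :: 'n diffop Matrix.vec set) \<noteq> {0}}.
      uncontrollable smooth_space k (behavior smooth_space k P) \<and>
      uncontrollable distr_space k (behavior distr_space k P)"
  proof -
    show "\<forall>P \<in> {P \<in> submodules k k. fitting_ideal k (P :: 'n diffop Matrix.vec set) \<noteq> {0}}.
        uncontrollable smooth_space k (behavior smooth_space k P) \<and>
        uncontrollable distr_space k (behavior distr_space k P)"
    proof (intro ballI conjI)
      fix P :: "'n diffop Matrix.vec set"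
      assume "P \<in> {P \<in> submodules k k. fitting_ideal k P \<noteq> {0}}"
      then have "P \<in> submodules k k" "fitting_ideal k P \<noteq> {0}" by auto
      note uncontrollable_of_fitting_ideal[OF this]
      then show "uncontrollable smooth_space k (behavior smooth_space k P)"
        "uncontrollable distr_space k (behavior distr_space k P)" .
    qed
    show "\<forall>P \<in> {P \<in> overdet_submodules k. fitting_ideal k (P :: 'n diffop Matrix.vec set) \<noteq> {0}}.
        uncontrollable smooth_space k (behavior smooth_space k P) \<and>
        uncontrollable distr_space k (behavior distr_space k P)"
    proof (intro ballI conjI)
      fix P :: "'n diffop Matrix.vec set"
      assume "P \<in> {P \<in> overdet_submodules k. fitting_ideal k P \<noteq> {0}}"
      then obtain l where "P \<in> submodules l k" "fitting_ideal k P \<noteq> {0}"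
        by (auto simp: overdet_submodules_def)
      note uncontrollable_of_fitting_ideal[OF this]
      then show "uncontrollable smooth_space k (behavior smooth_space k P)"
        "uncontrollable distr_space k (behavior distr_space k P)" .
    qed
  qed
  show ?thesis
    unfolding Let_def
    by (intro conjI ne unc openin_overdet_nonzero_fitting_ideal openin_nonzero_fitting_ideal)
qed

end
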